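(* Fix $T\geq 1$ and $0<\alpha<1$. There exists a constant $C=C(\alpha,T)$ such that the following holds. Let $k=tq$, where $t,q$ are positive integers with $1\leq t\leq T$ and $(t,q)=1$, and put $\lambda=P^-(q)$. If $S\subseteq\mathbb Z_k\setminus\{0\}$ satisfies $$C\leq |S|\leq\lambda^{1-\alpha},$$ then $S$ has a valid ordering.
   Context: For a positive integer $m$, $P^-(m)$ denotes the least prime divisor of $m$, with the convention $P^-(1)=\infty$. $(t,q)$ is the greatest common divisor. A valid ordering of a finite set $S=\{s_1,\dots,s_n\}$ of non-zero elements of an additive group is an enumeration $s_1,\dots,s_n$ of $S$ (each element listed exactly once) such that the partial sums $s_1,\ s_1+s_2,\ \dots,\ s_1+\cdots+s_n$ are pairwise distinct. *)

theory Defs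
  imports Complex_Main "HOL-Library.Extended_Real" "HOL-Algebra.Elementary_Groups"
    "HOL-Computational_Algebra.Primes"
begin

(* HOL-Algebra writes groups multiplicatively; for an additive group such as
   integer_mod_group k the list products below are the partial sums
   s_1 + ... + s_i for i = 1, ..., n. The empty sum (i = 0) is not among the
   sums required to be distinct, so a later partial sum may be zero. *)

definition partial_sums :: "('a, 'b) monoid_scheme \<Rightarrow> 'a list \<Rightarrow> 'a list" where
  "partial_sums G xs =
     map (\<lambda>i. foldr (\<lambda>x y. x \<otimes>\<^bsub>G\<^esub> y) (take i xs) \<one>\<^bsub>G\<^esub>) [1..<Suc (length xs)]"

definition valid_ordering :: "('a, 'b) monoid_scheme \<Rightarrow> 'a set \<Rightarrow> 'a list \<Rightarrow> bool" where
  "valid_ordering G S xs \<longleftrightarrow>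
     set xs = S \<and> distinct xs \<and> distinct (partial_sums G xs)"

(* Intended for m > 0 only. *)

definition least_prime_divisor :: "nat \<Rightarrow> enat" where
  "least_prime_divisor m = (if m = 1 then \<infinity> else enat (LEAST p. prime p \<and> p dvd m))"

(* Used for positive exponents only, where the power of infinity is infinity. *)

definition enat_powr :: "enat \<Rightarrow> real \<Rightarrow> ereal" where
  "enat_powr x a = (case x of enat n \<Rightarrow> ereal (real n powr a) | \<infinity> \<Rightarrow> \<infinity>)"

end

(* A uniformly random ordering has few collisions between its partial sums, and those are repaired
   locally. The sum of a random l-subset takes any fixed value with probability at most
   n^(-1-c) unless l or n - l is small. For this, pairs of elements x, y are swapped in and out at
   random: this turns the target set A into the union and the intersection of its translates by x
   and y. If |S| <= |A| and A is much smaller than the least prime divisor of q, then most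
   differences y - x move at least a constant times |S| elements of A, because the differences that
   move few elements form level sets of a pseudo-norm, which grow until they fill a subgroup.

   Consequently, with positive probability, in every window of bounded length only boundedly many
   subsets U yield a sum P_b + sum U that collides with any sum obtainable from outside the window by
   rearranging elements within bounded windows: many such U would yield many nearly independent
   equations, obtained as differences of the colliding sums. Cutting the ordering at positions
   without collisions and permuting each block so that the boundedly many bad subsets are not
   initial segments, and zero-sum subsets are not intervals, produces a valid ordering. *)

theory Submission
  imports Defs "HOL-Combinatorics.Permutations" "HOL-Real_Asymp.Real_Asymp"
begin

section \<open>Level sets of translation defects\<close>

text \<open>A witness of a collision can begin at about n = |S| positions, so a union bound over
  witnesses gains nothing from equations of probability about 1/n each. This forces the saving
  beyond 1/n in the anticoncentration bound. It serves witnesses that are pairwise far apart: two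
  consecutive ones differ by a long segment, whose sum is random. Witnesses within n^(1-\<beta>) of
  one another have only n^(1-\<beta>) positions, and there one random element, with probability
  O(1/n), is enough. In both cases the sum preceding the window is unknown; it cancels when two
  collisions are subtracted, so the union bound never runs over its values. The hypotheses relating
  k to |S| enter only through one consequence: every divisor of k above T is at least
  |S|^(1+\<alpha>). Subgroups of order at most T do no harm, because a level set to which the growth
  argument is applied has at least a constant proportion of |S| elements. Window lengths and
  multiplicities depend on \<alpha> alone and are fixed before |S| is taken large.\<close>

definition periodic :: "int \<Rightarrow> int set \<Rightarrow> bool" where
  "periodic k A \<longleftrightarrow> (\<forall>x. x mod k \<in> A \<longleftrightarrow> x \<in> A)"

definition card_mod :: "int \<Rightarrow> int set \<Rightarrow> nat" where
  "card_mod k A = card (A \<inter> {0..<k})"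

text \<open>Subsets of Z_k are encoded as k-periodic sets of integers, so that a shift is plain
  addition without reduction. In this encoding \<open>translate d A\<close> is the set A -
  d.\<close>

definition translate :: "int \<Rightarrow> int set \<Rightarrow> int set" where
  "translate d A = {x. x + d \<in> A}"

definition defect :: "int \<Rightarrow> int set \<Rightarrow> int \<Rightarrow> nat" where
  "defect k A d = card_mod k (A - translate d A)"

lemma periodic_cong:
  assumes "periodic k A" "x mod k = y mod k"
  shows "x \<in> A \<longleftrightarrow> y \<in> A"
  using assms unfolding periodic_def by metis

lemma periodicI: "(\<And>x y. x mod k = y mod k \<Longrightarrow> x \<in> A \<Longrightarrow> y \<in> A) \<Longrightarrow> periodic k A"
  unfolding periodic_def by (metis mod_mod_trivial)

lemma periodic_translate: "periodic k A \<Longrightarrow> periodic k (translate d A)"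
  by (rule periodicI) (auto simp: translate_def elim!: periodic_cong[THEN iffD1, rotated 2] intro: mod_add_cong)

lemma periodic_Un: "periodic k A \<Longrightarrow> periodic k B \<Longrightarrow> periodic k (A \<union> B)"
  and periodic_Int: "periodic k A \<Longrightarrow> periodic k B \<Longrightarrow> periodic k (A \<inter> B)"
  and periodic_Diff: "periodic k A \<Longrightarrow> periodic k B \<Longrightarrow> periodic k (A - B)"
  by (auto simp: periodic_def)

lemma card_mod_mono: "A \<subseteq> B \<Longrightarrow> card_mod k A \<le> card_mod k B"
  unfolding card_mod_def by (intro card_mono) auto

lemma card_mod_Un_disjoint: "A \<inter> B = {} \<Longrightarrow> card_mod k (A \<union> B) = card_mod k A + card_mod k B"
  unfolding card_mod_def by (subst Int_Un_distrib2, subst card_Un_disjoint) auto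

lemma card_mod_Un_Int: "card_mod k (A \<union> B) + card_mod k (A \<inter> B) = card_mod k A + card_mod k B"
proof -
  have "(A \<union> B) \<inter> {0..<k} = (A \<inter> {0..<k}) \<union> (B \<inter> {0..<k})"
    "(A \<inter> B) \<inter> {0..<k} = (A \<inter> {0..<k}) \<inter> (B \<inter> {0..<k})" by auto
  then show ?thesis
    unfolding card_mod_def using card_Un_Int[of "A \<inter> {0..<k}" "B \<inter> {0..<k}"] by simp
qed

lemma card_mod_Diff: "card_mod k A = card_mod k (A - B) + card_mod k (A \<inter> B)"
  by (subst card_mod_Un_disjoint[symmetric]) (auto intro: arg_cong2[where f = card_mod])

lemma card_mod_translate:
  assumes k: "k > 0" and A: "periodic k A"
  shows "card_mod k (translate d A) = card_mod k A"
proof -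
  have "bij_betw (\<lambda>x. (x + d) mod k) (translate d A \<inter> {0..<k}) (A \<inter> {0..<k})"
  proof (rule bij_betwI[where g = "\<lambda>x. (x - d) mod k"])
    show "(\<lambda>x. (x + d) mod k) \<in> translate d A \<inter> {0..<k} \<rightarrow> A \<inter> {0..<k}"
      using k A by (auto simp: translate_def periodic_def)
    show "(\<lambda>x. (x - d) mod k) \<in> A \<inter> {0..<k} \<rightarrow> translate d A \<inter> {0..<k}"
    proof
      fix x assume x: "x \<in> A \<inter> {0..<k}"
      have "((x - d) mod k + d) mod k = x mod k" by (simp add: mod_add_left_eq)
      from periodic_cong[OF A this] show "(x - d) mod k \<in> translate d A \<inter> {0..<k}"
        using x k by (simp add: translate_def)
    qed
  qed (auto simp: mod_diff_left_eq mod_add_left_eq)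
  then show ?thesis unfolding card_mod_def by (rule bij_betw_same_card)
qed

lemma translate_translate: "translate d (translate e A) = translate (d + e) A"
  by (auto simp: translate_def algebra_simps)

lemma translate_0 [simp]: "translate 0 A = A"
  by (auto simp: translate_def)

lemma translate_Diff: "translate d (A - B) = translate d A - translate d B"
  by (auto simp: translate_def)

lemma defect_0 [simp]: "defect k A 0 = 0"
  by (simp add: defect_def card_mod_def)

lemma defect_between_translates:
  assumes "k > 0" "periodic k A"
  shows "card_mod k (translate x A - translate y A) = defect k A (y - x)"
proof -
  have "translate x A - translate y A = translate x (A - translate (y - x) A)"
    by (simp add: translate_Diff translate_translate)
  then show ?thesis
    unfolding defect_def using assms
    by (simp add: card_mod_translate periodic_Diff periodic_translate)
qed

text \<open>A set and its translate have equally many residues, so as many leave the set as enter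
  it.\<close>

lemma defect_uminus:
  assumes "k > 0" "periodic k A"
  shows "defect k A (- d) = defect k A d"
proof -
  have "card_mod k (A - translate d A) + card_mod k (A \<inter> translate d A)
      = card_mod k (translate d A - A) + card_mod k (A \<inter> translate d A)"
    using card_mod_Diff[of k A "translate d A"] card_mod_Diff[of k "translate d A" A]
      card_mod_translate[OF assms, of d] by (simp add: Int_commute)
  then show ?thesis
    using defect_between_translates[OF assms, of d 0] by (simp add: defect_def)
qed

lemma defect_add:
  assumes "k > 0" "periodic k A"
  shows "defect k A (d + e) \<le> defect k A d + defect k A e"
proof -
  have "card_mod k (A - translate (d + e) A)
      \<le> card_mod k ((A - translate d A) \<union> (translate d A - translate (d + e) A))"
    by (rule card_mod_mono) auto
  also have "\<dots> = card_mod k (A - translate d A) + card_mod k (translate d A - translate (d + e) A)"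
    by (rule card_mod_Un_disjoint) auto
  finally show ?thesis
    using defect_between_translates[OF assms, of d "d + e"] by (simp add: defect_def)
qed

lemma defect_mod_cong:
  assumes "periodic k A" "d mod k = e mod k"
  shows "defect k A d = defect k A e"
proof -
  have "translate d A = translate e A"
    unfolding translate_def
    by (intro Collect_cong periodic_cong[OF assms(1)] mod_add_cong) (use assms(2) in simp_all)
  then show ?thesis by (simp add: defect_def)
qed

text \<open>Lagrange's theorem for the image of \<open>H\<close> in Z_k: a subgroup of the integers
  consists of the multiples of its least positive element h, and h divides \<open>k\<close>, which
  leaves k/h representatives.\<close>

lemma card_subgroup_dvd:
  fixes k :: int
  assumes k: "k > 0" and H: "0 \<in> H" "\<And>x y. x \<in> H \<Longrightarrow> y \<in> H \<Longrightarrow> x + y \<in> H" "\<And>x. x \<in> H \<Longrightarrow> - x \<in> H"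
    and kH: "k \<in> H"
  shows "card_mod k H dvd nat k"
proof -
  define h where "h = (LEAST m::nat. m > 0 \<and> int m \<in> H)"
  have ex: "nat k > 0 \<and> int (nat k) \<in> H" using k kH by simp
  have h: "h > 0" "int h \<in> H"
    using LeastI[of "\<lambda>m. m > 0 \<and> int m \<in> H", OF ex] by (auto simp: h_def)
  have hmin: "h \<le> m" if "m > 0" "int m \<in> H" for m
    unfolding h_def using that by (intro Least_le) auto
  have mult_nat: "int m * int h \<in> H" for m
    by (induction m) (use H(1) H(2)[OF h(2)] in \<open>auto simp: distrib_right\<close>)
  have mult: "z * int h \<in> H" for z
    by (cases z rule: int_cases2) (use mult_nat H(3) in auto)
  have H_dvd: "int h dvd x" if "x \<in> H" for x
  proof (rule ccontr)
    assume nd: "\<not> int h dvd x"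
    have "x + - (x div int h * int h) \<in> H" using that mult H by blast
    then have "x mod int h \<in> H" by (simp add: minus_div_mult_eq_mod)
    moreover have "x mod int h > 0" using nd h(1)
      by (metis dvd_eq_mod_eq_0 order_le_less pos_mod_sign of_nat_0_less_iff)
    ultimately have "h \<le> nat (x mod int h)" "0 < x mod int h"
      using hmin[of "nat (x mod int h)"] by simp_all
    moreover have "x mod int h < int h" using h by simp
    ultimately show False by linarith
  qed
  have H_eq: "H = {x. int h dvd x}"
    using H_dvd mult by (auto simp: dvd_def mult.commute)
  obtain m where m: "k = int h * m" using H_dvd[OF kH] by auto
  have mpos: "m > 0" using m k h by (simp add: zero_less_mult_iff)
  have "H \<inter> {0..<k} = (\<lambda>i. int h * i) ` {0..<m}"
    using h by (auto simp: H_eq m dvd_def zero_le_mult_iff)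
  then have "card_mod k H = nat m"
    unfolding card_mod_def using h by (simp add: card_image inj_on_def)
  then show ?thesis using m mpos by (auto simp: nat_mult_distrib)
qed

text \<open>If \<open>h\<close> lies outside the level set at \<open>(3j+2)\<rho>\<close>, the translate by \<open>h\<close> of the level set at
  \<open>\<rho>\<close> misses the one at \<open>(3j+1)\<rho>\<close>; if there is no such \<open>h\<close> within the level set at \<open>(3j+3)\<rho>\<close>,
  the level sets have saturated at a set whose stabilizer is a large subgroup.\<close>

lemma level_set_growth:
  fixes r :: "int \<Rightarrow> real" and k :: int and \<rho> T lam :: real
  assumes k: "k > 0" and \<rho>: "\<rho> \<ge> 0" and r0: "r 0 = 0"
    and r_add: "\<And>d e. r (d + e) \<le> r d + r e" and r_neg: "\<And>d. r (- d) = r d"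
    and r_mod: "\<And>d e. d mod k = e mod k \<Longrightarrow> r d = r e"
    and subgroups: "\<And>d. d dvd nat k \<Longrightarrow> real d > T \<Longrightarrow> lam \<le> real d"
    and large: "real (card_mod k {d. r d \<le> \<rho>}) > T"
  shows "real (card_mod k {d. r d \<le> real (3 * j + 1) * \<rho>})
           \<ge> min lam (real (j + 1) * real (card_mod k {d. r d \<le> \<rho>}))"
proof (induction j)
  case 0
  then show ?case by simp
next
  case (Suc j)
  define B where "B t = {d. r d \<le> t * \<rho>}" for t :: real
  have B1: "{d. r d \<le> \<rho>} = B 1" by (simp add: B_def)
  have B_add: "x + y \<in> B (s + t)" if "x \<in> B s" "y \<in> B t" for x y s t
    using that r_add[of x y] by (simp add: B_def algebra_simps)
  have B_neg: "- x \<in> B s" if "x \<in> B s" for x s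
    using that r_neg by (simp add: B_def)
  have B_diff: "x - y \<in> B (s + t)" if "x \<in> B s" "y \<in> B t" for x y s t
    using B_add[OF that(1) B_neg[OF that(2)]] by simp
  have B_mono: "B s \<subseteq> B t" if "s \<le> t" for s t
    using mult_right_mono[OF that \<rho>] by (auto simp: B_def)
  have B_per: "periodic k (B t)" for t
  proof (rule periodicI)
    fix x y assume "x mod k = y mod k" "x \<in> B t"
    then show "y \<in> B t" using r_mod[of x y] by (simp add: B_def)
  qed
  let ?s = "real (3 * j + 1)"
  have IH: "real (card_mod k (B ?s)) \<ge> min lam (real (j + 1) * real (card_mod k (B 1)))"
    using Suc by (simp add: B_def)
  have "real (card_mod k (B (?s + 3))) \<ge> min lam (real (j + 2) * real (card_mod k (B 1)))"
  proof (cases "B (?s + 2) \<subseteq> B (?s + 1)")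
    case True
    define X where "X = B (?s + 1)"
    define H where "H = {d. \<forall>x. x \<in> X \<longleftrightarrow> x + d \<in> X}"
    have X_add: "x + d \<in> X" if "x \<in> X" "d \<in> B 1" for x d
      using B_add[of x "?s + 1" d 1] that True by (auto simp: X_def add.assoc)
    have B_H: "B 1 \<subseteq> H"
    proof
      fix d assume d: "d \<in> B 1"
      have "x \<in> X" if "x + d \<in> X" for x
        using X_add[OF that B_neg[OF d]] by simp
      then show "d \<in> H" using X_add[OF _ d] by (auto simp: H_def)
    qed
    have H_add: "x + y \<in> H" if "x \<in> H" "y \<in> H" for x y
      using that unfolding H_def by (simp add: add.assoc[symmetric])
    have H_neg: "- x \<in> H" if "x \<in> H" for x
    proof -
      have "z \<in> X \<longleftrightarrow> z + - x \<in> X" for z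
        using that[unfolded H_def, simplified, rule_format, of "z - x"] by simp
      then show ?thesis by (simp add: H_def)
    qed
    have kH: "k \<in> H"
    proof -
      have "x \<in> X \<longleftrightarrow> x + k \<in> X" for x
        unfolding X_def by (rule periodic_cong[OF B_per]) simp
      then show ?thesis by (simp add: H_def)
    qed
    have "card_mod k H dvd nat k"
    proof (rule card_subgroup_dvd[OF k _ H_add H_neg kH])
      show "0 \<in> H" by (simp add: H_def)
    qed
    moreover have "real (card_mod k H) > T"
      using card_mod_mono[OF B_H, of k] large unfolding B1 by linarith
    ultimately have "lam \<le> real (card_mod k H)" using subgroups by blast
    \<comment> \<open>The saturated level set contains 0, so its stabilizer is contained in it and
      passes its size on to it.\<close>
    moreover have "H \<subseteq> B (?s + 3)"
    proof
      fix d assume d: "d \<in> H"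
      have "0 \<in> X" using \<rho> r0 by (simp add: X_def B_def)
      then have "d \<in> X" using d unfolding H_def by (metis (mono_tags, lifting) add_0 mem_Collect_eq)
      then show "d \<in> B (?s + 3)" using B_mono[of "?s + 1" "?s + 3"] by (auto simp: X_def)
    qed
    ultimately show ?thesis using card_mod_mono[of H "B (?s + 3)" k] by linarith
  next
    case False
    then obtain h where h: "h \<in> B (?s + 2)" "h \<notin> B (?s + 1)" by blast
    have "translate (- h) (B 1) \<inter> B ?s = {}"
    proof (rule ccontr)
      assume "translate (- h) (B 1) \<inter> B ?s \<noteq> {}"
      then obtain x where "x - h \<in> B 1" "x \<in> B ?s" by (auto simp: translate_def)
      then have "x - (x - h) \<in> B (?s + 1)" by (intro B_diff)
      then show False using h by simp
    qed
    then have "card_mod k (translate (- h) (B 1)) + card_mod k (B ?s) =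
      card_mod k (translate (- h) (B 1) \<union> B ?s)"
      by (simp add: card_mod_Un_disjoint)
    also have "\<dots> \<le> card_mod k (B (?s + 3))"
    proof (rule card_mod_mono, rule Un_least)
      show "B ?s \<subseteq> B (?s + 3)" by (rule B_mono) simp
      show "translate (- h) (B 1) \<subseteq> B (?s + 3)"
      proof
        fix x assume "x \<in> translate (- h) (B 1)"
        then have "(x - h) + h \<in> B (1 + (?s + 2))"
          using h by (intro B_add) (auto simp: translate_def)
        then show "x \<in> B (?s + 3)" by (simp add: add.commute)
      qed
    qed
    finally have "card_mod k (B 1) + card_mod k (B ?s) \<le> card_mod k (B (?s + 3))"
      by (simp add: card_mod_translate[OF k B_per])
    then have "real (card_mod k (B 1)) + real (card_mod k (B ?s)) \<le> real (card_mod k (B (?s + 3)))"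
      by linarith
    moreover have "real (j + 2) * real (card_mod k (B 1)) =
      real (card_mod k (B 1)) + real (j + 1) * real (card_mod k (B 1))"
      by (simp add: algebra_simps)
    ultimately show ?thesis using IH by linarith
  qed
  moreover have "?s + 3 = real (3 * Suc j + 1)" "j + 2 = Suc j + 1" by simp_all
  ultimately show ?case unfolding B1 unfolding B_def by simp
qed

text \<open>Double counting: a shift e together with an a for which both a and a + e lie in
  \<open>A\<close> is determined by the pair (a, a + e) of residues of \<open>A\<close>.\<close>

lemma sum_overlaps_le:
  assumes k: "k > 0" and A: "periodic k A" and E: "E \<subseteq> {0..<k}"
  shows "(\<Sum>e\<in>E. card_mod k (A \<inter> translate e A)) \<le> card_mod k A * card_mod k A"
proof -
  have finE: "finite E" using E finite_subset by blast
  have "(\<Sum>e\<in>E. card_mod k (A \<inter> translate e A)) = card (SIGMA e:E. A \<inter> translate e A \<inter> {0..<k})"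
    using finE by (subst card_SigmaI) (auto simp: card_mod_def)
  also have "\<dots> \<le> card ((A \<inter> {0..<k}) \<times> (A \<inter> {0..<k}))"
  proof (rule card_inj_on_le[where f = "\<lambda>(e, a). (a, (a + e) mod k)"])
    show "inj_on (\<lambda>(e, a). (a, (a + e) mod k)) (SIGMA e:E. A \<inter> translate e A \<inter> {0..<k})"
    proof (rule inj_onI, clarsimp)
      fix e e' a assume "e \<in> E" "e' \<in> E" "(a + e) mod k = (a + e') mod k"
      then have "e mod k = e' mod k" by (metis add_diff_cancel_left' mod_diff_left_eq)
      then show "e = e'" using E \<open>e \<in> E\<close> \<open>e' \<in> E\<close> by (auto simp: subset_iff)
    qed
    show "(\<lambda>(e, a). (a, (a + e) mod k)) ` (SIGMA e:E. A \<inter> translate e A \<inter> {0..<k})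
        \<subseteq> (A \<inter> {0..<k}) \<times> (A \<inter> {0..<k})"
      using A k by (auto simp: translate_def periodic_def)
  qed simp
  finally show ?thesis by (simp add: card_mod_def card_cartesian_product)
qed

text \<open>If more than half of the differences had a small defect, the level set at the threshold
  would have more than T elements and, by \<open>level_set_growth\<close>, would reach twice the
  size of \<open>A\<close> at a level still below half of that size. Each shift in it would keep
  more than half of \<open>A\<close>, and these overlaps would exceed the bound of
  \<open>sum_overlaps_le\<close>.\<close>

lemma many_large_defects:
  fixes k :: int and R :: "int set" and T \<Lambda> n1 :: real
  assumes k: "k > 0" and A: "periodic k A" and N: "card_mod k A > 0" "real (card_mod k A) \<le> \<Lambda>"
    and R: "R \<subseteq> {0..<k}" "n1 \<le> real (card R)" and n1: "n1 > 0" "2 * T \<le> n1" "n1 \<le> \<Lambda>"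
    and subgroups: "\<And>d. d dvd nat k \<Longrightarrow> real d > T \<Longrightarrow> 2 * \<Lambda> \<le> real d"
  shows "2 * card {y \<in> R. real (defect k A (y - x)) \<ge> n1 / (64 * \<Lambda>) * card_mod k A} \<ge> card R"
proof (rule ccontr)
  assume neg: "\<not> ?thesis"
  define N' where "N' = real (card_mod k A)"
  define \<rho> where "\<rho> = n1 / (64 * \<Lambda>) * N'"
  have \<Lambda>: "\<Lambda> > 0" using n1 by linarith
  have N': "N' > 0" "N' \<le> \<Lambda>" using N by (auto simp: N'_def)
  have \<rho>: "\<rho> > 0" using N' n1 \<Lambda> by (simp add: \<rho>_def)
  define B where "B t = {d. real (defect k A d) \<le> t}" for t
  have finR: "finite R" using R finite_subset by blast
  define D where "D = {y \<in> R. \<not> real (defect k A (y - x)) \<ge> \<rho>}"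
  have split: "card R = card {y \<in> R. real (defect k A (y - x)) \<ge> \<rho>} + card D"
    unfolding D_def using finR
    by (subst card_Un_disjoint[symmetric]) (auto intro: arg_cong[where f = card])
  have D: "2 * card D > card R"
    using neg split unfolding \<rho>_def N'_def by linarith
  have "card D \<le> card_mod k (B \<rho>)"
  proof -
    have "card D \<le> card (B \<rho> \<inter> {0..<k})"
    proof (rule card_inj_on_le[where f = "\<lambda>y. (y - x) mod k"])
      show "inj_on (\<lambda>y. (y - x) mod k) D"
      proof (rule inj_onI)
        fix y z assume yz: "y \<in> D" "z \<in> D" and "(y - x) mod k = (z - x) mod k"
        then have "(y - x + x) mod k = (z - x + x) mod k" by (metis mod_add_left_eq)
        then show "y = z" using yz R by (auto simp: D_def subset_iff)
      qed
      show "(\<lambda>y. (y - x) mod k) ` D \<subseteq> B \<rho> \<inter> {0..<k}"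
      proof
        fix z assume "z \<in> (\<lambda>y. (y - x) mod k) ` D"
        then obtain y where y: "y \<in> D" "z = (y - x) mod k" by blast
        have "defect k A z = defect k A (y - x)"
          by (rule defect_mod_cong[OF A]) (simp add: y(2))
        then show "z \<in> B \<rho> \<inter> {0..<k}"
          using y k by (simp add: D_def B_def)
      qed
    qed simp
    then show ?thesis by (simp add: card_mod_def)
  qed
  then have B\<rho>: "2 * real (card_mod k (B \<rho>)) > n1" using D R(2) by linarith
  \<comment> \<open>Enough growth steps to bring a level set with more than n1/2 elements above 2N'
    elements.\<close>
  define j where "j = nat \<lfloor>4 * N' / n1\<rfloor>"
  have q0: "4 * N' / n1 \<ge> 0" using N' n1 by simp
  have j: "real j \<le> 4 * N' / n1" "4 * N' / n1 < real j + 1"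
    using q0 unfolding j_def by linarith+
  have growth: "real (card_mod k (B (real (3 * j + 1) * \<rho>)))
      \<ge> min (2 * \<Lambda>) (real (j + 1) * real (card_mod k (B \<rho>)))"
    unfolding B_def
  proof (rule level_set_growth[where T = T])
    show "T < real (card_mod k {d. real (defect k A d) \<le> \<rho>})"
      using B\<rho> n1 unfolding B_def by linarith
    show "real (defect k A (d + e)) \<le> real (defect k A d) + real (defect k A e)" for d e
      using defect_add[OF k A, of d e] by linarith
    show "real (defect k A d) = real (defect k A e)" if "d mod k = e mod k" for d e
      using defect_mod_cong[OF A that] by simp
  qed (use k \<rho> subgroups in \<open>simp_all add: defect_uminus[OF k A]\<close>)
  have "2 * N' < real (j + 1) * real (card_mod k (B \<rho>))"
  proof -
    have "4 * N' < real (j + 1) * n1" using j(2) n1 by (simp add: field_simps)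
    also have "\<dots> \<le> real (j + 1) * (2 * real (card_mod k (B \<rho>)))"
      using B\<rho> by (intro mult_left_mono) auto
    finally show ?thesis by simp
  qed
  then have big: "real (card_mod k (B (real (3 * j + 1) * \<rho>))) \<ge> 2 * N'"
    using growth N' by linarith
  define E where "E = B (real (3 * j + 1) * \<rho>) \<inter> {0..<k}"
  have cardE: "real (card E) \<ge> 2 * N'" using big by (simp add: E_def card_mod_def)
  \<comment> \<open>Here the constant 64 of the threshold is spent: the level reached after j steps
    is at most 13/64 of \<open>N'\<close>.\<close>
  have upper: "real (3 * j + 1) * \<rho> < N' / 2"
  proof -
    have "real (3 * j + 1) * \<rho> \<le> (12 * N' / n1 + 1) * \<rho>"
      using j \<rho> by (intro mult_right_mono) auto
    also have "\<dots> = N' * (12 * N' + n1) / (64 * \<Lambda>)"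
      using n1 \<Lambda> by (simp add: \<rho>_def field_simps)
    also have "\<dots> \<le> N' * (13 * \<Lambda>) / (64 * \<Lambda>)"
      using N' n1 \<Lambda> by (intro divide_right_mono mult_left_mono) auto
    also have "\<dots> < N' / 2" using N' \<Lambda> by (simp add: field_simps)
    finally show ?thesis .
  qed
  have each: "real (card_mod k (A \<inter> translate e A)) > N' / 2" if "e \<in> E" for e
    using that upper card_mod_Diff[of k A "translate e A"]
    by (auto simp: E_def B_def defect_def N'_def)
  have "E \<noteq> {}" using cardE N' by auto
  moreover have finE: "finite E" by (simp add: E_def)
  ultimately have "(\<Sum>e\<in>E. N' / 2) < (\<Sum>e\<in>E. real (card_mod k (A \<inter> translate e A)))"
    using each by (intro sum_strict_mono) auto
  also have "\<dots> \<le> N' * N'"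
    using sum_overlaps_le[OF k A, of E]
    unfolding N'_def of_nat_sum[symmetric] of_nat_mult[symmetric] of_nat_le_iff
    by (auto simp: E_def)
  finally have "real (card E) * (N' / 2) < N' * N'" by simp
  moreover have "2 * N' * (N' / 2) \<le> real (card E) * (N' / 2)"
    using cardE N' by (intro mult_right_mono) auto
  ultimately show False by simp
qed

section \<open>Anticoncentration of subset sums\<close>

definition num_subsets :: "int set \<Rightarrow> nat \<Rightarrow> int set \<Rightarrow> nat" where
  "num_subsets R l A = card {B. B \<subseteq> R \<and> card B = l \<and> \<Sum>B \<in> A}"

lemma num_subsets_le: "finite R \<Longrightarrow> num_subsets R l A \<le> card R choose l"
  unfolding num_subsets_def n_subsets[symmetric] by (intro card_mono) auto

lemma num_subsets_Un_Int:
  assumes "finite R"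
  shows "num_subsets R l (A \<union> B) + num_subsets R l (A \<inter> B) = num_subsets R l A + num_subsets R l B"
proof -
  let ?S = "\<lambda>A. {B. B \<subseteq> R \<and> card B = l \<and> \<Sum>B \<in> A}"
  have "?S (A \<union> B) = ?S A \<union> ?S B" "?S (A \<inter> B) = ?S A \<inter> ?S B" by auto
  then show ?thesis
    using card_Un_Int[of "?S A" "?S B"] assms by (simp add: num_subsets_def)
qed

text \<open>Both sides count the triples \<open>(B, x, y)\<close> with \<open>x \<in> B\<close> and \<open>y \<in> R - B\<close>.\<close>

lemma num_subsets_remove_pair:
  assumes R: "finite R" and l: "l > 0"
  shows "num_subsets R l A * (l * (card R - l)) =
    (\<Sum>x\<in>R. \<Sum>y\<in>R - {x}. num_subsets (R - {x, y}) (l - 1) (translate x A))"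
proof -
  let ?S = "{B. B \<subseteq> R \<and> card B = l \<and> \<Sum>B \<in> A}"
  let ?T = "\<lambda>x y. {B. B \<subseteq> R - {x, y} \<and> card B = l - 1 \<and> \<Sum>B \<in> translate x A}"
  have finS: "finite ?S" using R by simp
  have "num_subsets R l A * (l * (card R - l)) = (\<Sum>B\<in>?S. card (B \<times> (R - B)))"
  proof -
    have "card (B \<times> (R - B)) = l * (card R - l)" if "B \<in> ?S" for B
      using that R by (auto simp: card_cartesian_product card_Diff_subset finite_subset)
    then show ?thesis by (simp add: num_subsets_def)
  qed
  also have "\<dots> = card (SIGMA B:?S. B \<times> (R - B))"
  proof (rule card_SigmaI[symmetric])
    show "\<forall>B\<in>?S. finite (B \<times> (R - B))"
      using R finite_subset[OF _ R] by auto
  qed (rule finS)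
  also have "\<dots> = card (SIGMA x:R. SIGMA y:R - {x}. ?T x y)"
  proof (rule bij_betw_same_card)
    show "bij_betw (\<lambda>(B, x, y). (x, y, B - {x})) (SIGMA B:?S. B \<times> (R - B)) (SIGMA x:R. SIGMA y:R - {x}. ?T x y)"
    proof (rule bij_betwI[where g = "\<lambda>(x, y, B). (insert x B, x, y)"])
      show "(\<lambda>(B, x, y). (x, y, B - {x})) \<in> (SIGMA B:?S. B \<times> (R - B)) \<rightarrow> (SIGMA x:R. SIGMA y:R - {x}. ?T x y)"
      proof
        fix p assume "p \<in> (SIGMA B:?S. B \<times> (R - B))"
        then obtain B x y where p: "p = (B, x, y)" and B: "B \<subseteq> R" "card B = l" "\<Sum>B \<in> A" "x \<in> B" "y \<in> R" "y \<notin> B"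
          by auto
        have "finite B" using B(1) R finite_subset by blast
        then have "\<Sum>B = x + \<Sum>(B - {x})" "card (B - {x}) = l - 1"
          using B by (simp_all add: sum.remove)
        then show "(\<lambda>(B, x, y). (x, y, B - {x})) p \<in> (SIGMA x:R. SIGMA y:R - {x}. ?T x y)"
          using B p by (auto simp: translate_def add.commute)
      qed
      show "(\<lambda>(x, y, B). (insert x B, x, y)) \<in> (SIGMA x:R. SIGMA y:R - {x}. ?T x y) \<rightarrow> (SIGMA B:?S. B \<times> (R - B))"
      proof
        fix p assume "p \<in> (SIGMA x:R. SIGMA y:R - {x}. ?T x y)"
        then obtain x y B where p: "p = (x, y, B)" and B: "x \<in> R" "y \<in> R" "y \<noteq> x" "B \<subseteq> R - {x, y}"
          "card B = l - 1" "\<Sum>B + x \<in> A"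
          by (auto simp: translate_def)
        have "finite B" "x \<notin> B" using B(4) R finite_subset[of B "R - {x, y}"] by auto
        then have "\<Sum>(insert x B) = \<Sum>B + x" "card (insert x B) = l"
          using B l by (simp_all add: add.commute)
        then show "(\<lambda>(x, y, B). (insert x B, x, y)) p \<in> (SIGMA B:?S. B \<times> (R - B))"
          using B p by auto
      qed
    qed (auto simp: insert_absorb)
  qed
  also have "\<dots> = (\<Sum>x\<in>R. card (SIGMA y:R - {x}. ?T x y))"
    using R by (subst card_SigmaI) auto
  also have "\<dots> = (\<Sum>x\<in>R. \<Sum>y\<in>R - {x}. card (?T x y))"
  proof (rule sum.cong[OF refl])
    fix x assume "x \<in> R"
    show "card (SIGMA y:R - {x}. ?T x y) = (\<Sum>y\<in>R - {x}. card (?T x y))"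
      using R by (subst card_SigmaI) auto
  qed
  finally show ?thesis by (simp add: num_subsets_def)
qed

lemma sum_off_diagonal_swap:
  assumes "finite R"
  shows "(\<Sum>x\<in>R. \<Sum>y\<in>R - {x}. f x y) = (\<Sum>x\<in>R. \<Sum>y\<in>R - {x}. f y x)"
proof -
  have eq: "R - {x} = {y \<in> R. x \<noteq> y}" for x by auto
  show ?thesis
    unfolding eq using sum.swap_restrict[OF assms assms, of f "(\<noteq>)"]
    by (simp add: eq_commute)
qed

text \<open>Strict concavity of the square root in quantitative form. Squaring the left side leaves
  the square root of N^2 - r^2, and 1 - 2x \<le> (1 - x)^2 is applied twice; each application halves
  the gain, and the sum of two equal terms halves it once more, which makes \<kappa>^2 into
  \<kappa>^2 / 8.\<close>

lemma sqrt_sum_diff_le: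
  fixes N r \<kappa> :: real
  assumes "0 \<le> r" "r \<le> N" "\<kappa> * N \<le> r" "0 \<le> \<kappa>"
  shows "sqrt (N + r) + sqrt (N - r) \<le> 2 * (1 - \<kappa>\<^sup>2 / 8) * sqrt N"
proof (cases "N = 0")
  case True
  then show ?thesis using assms by simp
next
  case False
  then have N: "N > 0" using assms by linarith
  have \<kappa>1: "\<kappa> \<le> 1"
  proof -
    have "\<kappa> * N \<le> 1 * N" using assms by linarith
    then show ?thesis using N by (simp only: mult_le_cancel_right)
  qed
  then have \<kappa>2: "\<kappa>\<^sup>2 \<le> 1" using assms by (simp add: power_le_one)
  have bern: "1 - 2 * x \<le> (1 - x)\<^sup>2" for x :: real
    by (simp add: power2_diff)
  have "(\<kappa> * N)\<^sup>2 \<le> r\<^sup>2" using assms N by (intro power_mono) auto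
  then have "N\<^sup>2 - r\<^sup>2 \<le> N\<^sup>2 * (1 - \<kappa>\<^sup>2)" by (simp add: power_mult_distrib algebra_simps)
  also have "\<dots> \<le> (N * (1 - \<kappa>\<^sup>2 / 2))\<^sup>2"
    unfolding power_mult_distrib using bern[of "\<kappa>\<^sup>2 / 2"] by (intro mult_left_mono) auto
  finally have "sqrt (N\<^sup>2 - r\<^sup>2) \<le> N * (1 - \<kappa>\<^sup>2 / 2)"
    using N \<kappa>2 by (intro real_le_lsqrt) auto
  moreover have "sqrt (N + r) * sqrt (N - r) = sqrt (N\<^sup>2 - r\<^sup>2)"
    by (simp add: real_sqrt_mult[symmetric] power2_eq_square algebra_simps)
  moreover have "(sqrt (N + r) + sqrt (N - r))\<^sup>2 = 2 * N + 2 * (sqrt (N + r) * sqrt (N - r))"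
    using assms by (simp add: power2_sum)
  ultimately have "(sqrt (N + r) + sqrt (N - r))\<^sup>2 \<le> 4 * N * (1 - \<kappa>\<^sup>2 / 4)"
    by (simp add: algebra_simps)
  also have "\<dots> \<le> 4 * N * (1 - \<kappa>\<^sup>2 / 8)\<^sup>2"
    using N bern[of "\<kappa>\<^sup>2 / 8"] by (intro mult_left_mono) auto
  also have "\<dots> = (2 * (1 - \<kappa>\<^sup>2 / 8) * sqrt N)\<^sup>2"
    unfolding power_mult_distrib using N by simp
  finally show ?thesis
    by (rule power2_le_imp_le) (use N \<kappa>2 in simp)
qed

text \<open>The count of triples in \<open>num_subsets_remove_pair\<close> with no condition on the
  sum. It turns the averaged counts back into a fraction of all l-subsets.\<close>

lemma binomial_remove_pair:
  assumes "0 < l" "l < r"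
  shows "(r choose l) * (l * (r - l)) = r * (r - 1) * ((r - 2) choose (l - 1))"
proof -
  have "l * (r choose l) = r * ((r - 1) choose (l - 1))"
    using times_binomial_minus1_eq[OF assms(1), of r] by simp
  moreover have "(r - l) * ((r - 1) choose (l - 1)) = (r - 1) * ((r - 2) choose (l - 1))"
    using binomial_absorb_comp[of "r - 1" "l - 1"] assms by (simp add: numeral_2_eq_2)
  ultimately show ?thesis by (metis (no_types, lifting) mult.assoc mult.commute)
qed

text \<open>A random pair \<open>x, y\<close> is removed and then assigned to the two sides at random. This replaces
  the target \<open>A\<close> by the union and the intersection of two translates of \<open>A\<close>, whose sizes differ from
  that of \<open>A\<close> by the defect of \<open>y - x\<close>; concavity of the square root yields the decay.\<close>

theorem num_subsets_sqrt_bound: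
  fixes k :: int and T \<Lambda> n1 \<gamma> :: real
  assumes k: "k > 0" and n1: "n1 > 0" "2 * T \<le> n1" "n1 \<le> \<Lambda>"
    and subgroups: "\<And>d. d dvd nat k \<Longrightarrow> real d > T \<Longrightarrow> 2 * \<Lambda> \<le> real d"
    and \<gamma>: "\<gamma> = (n1 / (64 * \<Lambda>))\<^sup>2 / 16"
    and R: "R \<subseteq> {0..<k}" and A: "periodic k A"
    and m: "m \<le> l" "l + m \<le> card R" "n1 + 2 * real m \<le> real (card R)"
  shows "real (num_subsets R l A) \<le> (1 / sqrt \<Lambda> + (1 - \<gamma>) ^ m) * sqrt (card_mod k A) * (card R choose l)"
  using R A m
proof (induction m arbitrary: R l A)
  case 0
  have \<Lambda>: "\<Lambda> > 0" using n1 by linarith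
  have fin: "finite R" using 0 finite_subset by blast
  \<comment> \<open>With no pair to remove the bound is trivial: as soon as the target is nonempty,
    its right side is at least the number of all l-subsets.\<close>
  show ?case
  proof (cases "A \<inter> {0..<k} = {}")
    case True
    have "\<Sum>B \<notin> A" for B
    proof
      assume "\<Sum>B \<in> A"
      then have "\<Sum>B mod k \<in> A \<inter> {0..<k}" using 0(2) k by (simp add: periodic_def)
      then show False using True by blast
    qed
    then show ?thesis using True by (simp add: num_subsets_def card_mod_def)
  next
    case False
    then have "card_mod k A > 0" by (simp add: card_mod_def card_gt_0_iff)
    then have "1 \<le> (1 / sqrt \<Lambda> + 1) * sqrt (card_mod k A)"
      using \<Lambda> mult_mono[of 1 "1 / sqrt \<Lambda> + 1" 1 "sqrt (card_mod k A)"] by simp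
    then have "1 * real (card R choose l) \<le> (1 / sqrt \<Lambda> + 1) * sqrt (card_mod k A) * (card R choose l)"
      by (intro mult_right_mono) auto
    then show ?thesis using num_subsets_le[OF fin, of l A] by simp
  qed
next
  case (Suc m)
  have \<Lambda>: "\<Lambda> > 0" using n1 by linarith
  have fin: "finite R" using Suc.prems(1) finite_subset by blast
  define \<kappa> where "\<kappa> = n1 / (64 * \<Lambda>)"
  have \<kappa>: "0 < \<kappa>" "\<kappa> \<le> 1" using n1 \<Lambda> by (auto simp: \<kappa>_def field_simps)
  have \<gamma>': "\<gamma> = \<kappa>\<^sup>2 / 16" by (simp add: \<gamma> \<kappa>_def)
  have "\<kappa>\<^sup>2 \<le> 1" using \<kappa> by (simp add: power_le_one)
  then have \<gamma>01: "0 < \<gamma>" "\<gamma> < 1" using \<kappa> by (auto simp: \<gamma>')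
  define c where "c = 1 / sqrt \<Lambda> + (1 - \<gamma>) ^ m"
  have c0: "c \<ge> 0" using \<Lambda> \<gamma>01 by (simp add: c_def)
  have c_step: "(1 - \<gamma>) * c \<le> 1 / sqrt \<Lambda> + (1 - \<gamma>) ^ Suc m"
  proof -
    have "(1 - \<gamma>) * (1 / sqrt \<Lambda>) \<le> 1 * (1 / sqrt \<Lambda>)"
      using \<gamma>01 \<Lambda> by (intro mult_right_mono) auto
    then show ?thesis by (simp add: c_def distrib_left)
  qed
  define N where "N = real (card_mod k A)"
  define r where "r = card R"
  have l: "0 < l" "l < r" using Suc.prems(3,4) by (auto simp: r_def)
  consider "N = 0" | "N > \<Lambda>" | "0 < N" "N \<le> \<Lambda>" by (force simp: N_def)
  then show ?case
  proof cases
    case 1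
    have "\<Sum>B \<notin> A" for B
    proof
      assume "\<Sum>B \<in> A"
      then have "\<Sum>B mod k \<in> A \<inter> {0..<k}" using Suc.prems(2) k by (simp add: periodic_def)
      then have "card_mod k A > 0" by (auto simp: card_mod_def card_gt_0_iff)
      then show False using 1 by (simp add: N_def)
    qed
    then show ?thesis using 1 by (simp add: num_subsets_def N_def)
  next
    \<comment> \<open>For a target larger than \<Lambda> the defects give no information, but the
      summand \<open>1 / sqrt \<Lambda>\<close> already makes the bound trivial. The unions formed
      in the induction can grow into this case.\<close>
    case 2
    have "sqrt \<Lambda> \<le> sqrt N" using 2 by simp
    then have "1 \<le> 1 / sqrt \<Lambda> * sqrt N" using \<Lambda> by (simp add: field_simps)
    also have "\<dots> \<le> (1 / sqrt \<Lambda> + (1 - \<gamma>) ^ Suc m) * sqrt N"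
      using \<gamma>01 by (intro mult_right_mono) (auto simp: N_def)
    finally have "1 * real (card R choose l) \<le> (1 / sqrt \<Lambda> + (1 - \<gamma>) ^ Suc m) * sqrt N * (card R choose l)"
      by (intro mult_right_mono) auto
    then show ?thesis using num_subsets_le[OF fin, of l A] by (simp add: N_def)
  next
    case 3
    define b where "b = real ((r - 2) choose (l - 1))"
    define D where "D x y = real (defect k A (y - x))" for x y
    have D_le: "D x y \<le> N" for x y
      using card_mod_mono[of "A - translate (y - x) A" A k] by (auto simp: D_def N_def defect_def)
    let ?n = "\<lambda>x y z. real (num_subsets (R - {x, y}) (l - 1) (translate z A))"
    have pair: "?n x y x + ?n x y y \<le> c * (sqrt (N + D x y) + sqrt (N - D x y)) * b"
      if "x \<in> R" "y \<in> R - {x}" for x y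
    proof -
      let ?R = "R - {x, y}" and ?X = "translate x A" and ?Y = "translate y A"
      have cR: "card ?R = r - 2" using that fin by (simp add: r_def card_Diff_subset)
      have perX: "periodic k ?X" and perY: "periodic k ?Y"
        using Suc.prems(2) by (simp_all add: periodic_translate)
      have IH: "real (num_subsets ?R (l - 1) B) \<le> c * sqrt (card_mod k B) * b" if "periodic k B" for B
        unfolding c_def b_def cR[symmetric]
        using Suc.prems l that by (intro Suc.IH) (auto simp: cR r_def)
      have "card_mod k (?X - ?Y) = defect k A (y - x)"
        using defect_between_translates[OF k Suc.prems(2)] .
      then have "real (card_mod k (?X \<inter> ?Y)) = N - D x y"
        using card_mod_Diff[of k ?X ?Y] card_mod_translate[OF k Suc.prems(2), of x]
        by (simp add: N_def D_def)
      moreover have "real (card_mod k (?X \<union> ?Y)) + real (card_mod k (?X \<inter> ?Y)) = 2 * N"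
        using card_mod_Un_Int[of k ?X ?Y] card_mod_translate[OF k Suc.prems(2)]
        unfolding of_nat_add[symmetric] by (simp add: N_def)
      ultimately have sizes: "real (card_mod k (?X \<inter> ?Y)) = N - D x y" "real (card_mod k (?X \<union> ?Y)) = N + D x y"
        by simp_all
      have "?n x y x + ?n x y y = real (num_subsets ?R (l - 1) (?X \<union> ?Y)) + real (num_subsets ?R (l - 1) (?X \<inter> ?Y))"
        using num_subsets_Un_Int[of ?R "l - 1" ?X ?Y] fin unfolding of_nat_add[symmetric] by simp
      also have "\<dots> \<le> c * sqrt (N + D x y) * b + c * sqrt (N - D x y) * b"
        using IH[OF periodic_Un[OF perX perY]] IH[OF periodic_Int[OF perX perY]] unfolding sizes by linarith
      finally show ?thesis by (simp add: algebra_simps)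
    qed
    have avg: "(\<Sum>y\<in>R - {x}. sqrt (N + D x y) + sqrt (N - D x y)) \<le> 2 * (1 - \<gamma>) * sqrt N * (r - 1)"
      if x: "x \<in> R" for x
    proof -
      define G where "G = {y \<in> R. D x y \<ge> \<kappa> * N}"
      have "\<kappa> * N > 0" using 3 \<kappa> by simp
      then have xG: "x \<notin> G" by (simp add: G_def D_def)
      have GR: "G \<subseteq> R - {x}" using xG by (auto simp: G_def)
      \<comment> \<open>Each induction step takes two elements out of \<open>R\<close>; the
        hypothesis \<open>n1 + 2 * real m \<le> real (card R)\<close> keeps at least
        \<open>n1\<close> of them at every stage.\<close>
      have G: "2 * card G \<ge> r"
        unfolding G_def D_def \<kappa>_def N_def r_def
        by (rule many_large_defects[OF k Suc.prems(2) _ _ Suc.prems(1) _ n1 subgroups])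
          (use 3 Suc.prems in \<open>auto simp: N_def\<close>)
      have le: "sqrt (N + D x y) + sqrt (N - D x y) \<le> 2 * sqrt N - (if y \<in> G then \<kappa>\<^sup>2 / 4 * sqrt N else 0)" for y
      proof (cases "y \<in> G")
        case True
        then show ?thesis
          using sqrt_sum_diff_le[of "D x y" N \<kappa>] D_le[of x y] \<kappa> by (simp add: G_def D_def algebra_simps)
      next
        case False
        then show ?thesis
          using sqrt_sum_diff_le[of "D x y" N 0] D_le[of x y] by (simp add: D_def)
      qed
      have "(\<Sum>y\<in>R - {x}. sqrt (N + D x y) + sqrt (N - D x y))
        \<le> (\<Sum>y\<in>R - {x}. 2 * sqrt N - (if y \<in> G then \<kappa>\<^sup>2 / 4 * sqrt N else 0))"
        by (intro sum_mono le)
      also have "\<dots> = 2 * sqrt N * (r - 1) - card G * (\<kappa>\<^sup>2 / 4 * sqrt N)"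
        using fin x GR by (simp add: sum_subtractf sum.If_cases r_def Int_absorb1)
      \<comment> \<open>Only half of the y are known to have a large defect, so the gain
        \<open>\<kappa>\<^sup>2 / 8\<close> of a single pair is halved to \<gamma> on
        average.\<close>
      also have "\<dots> \<le> 2 * sqrt N * (r - 1) - real (r - 1) / 2 * (\<kappa>\<^sup>2 / 4 * sqrt N)"
        using G 3 by (intro diff_left_mono mult_right_mono) auto
      also have "\<dots> = 2 * (1 - \<gamma>) * sqrt N * (r - 1)" by (simp add: \<gamma>' algebra_simps)
      finally show ?thesis .
    qed
    have "2 * real (num_subsets R l A * (l * (r - l))) = (\<Sum>x\<in>R. \<Sum>y\<in>R - {x}. ?n x y x) + (\<Sum>x\<in>R. \<Sum>y\<in>R - {x}. ?n x y x)"
      using num_subsets_remove_pair[OF fin l(1), of A] by (simp add: r_def)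
    also have "(\<Sum>x\<in>R. \<Sum>y\<in>R - {x}. ?n x y x) + (\<Sum>x\<in>R. \<Sum>y\<in>R - {x}. ?n x y x)
        = (\<Sum>x\<in>R. \<Sum>y\<in>R - {x}. ?n x y x) + (\<Sum>x\<in>R. \<Sum>y\<in>R - {x}. ?n x y y)"
      by (subst (2) sum_off_diagonal_swap[OF fin]) (simp add: insert_commute)
    also have "\<dots> = (\<Sum>x\<in>R. \<Sum>y\<in>R - {x}. ?n x y x + ?n x y y)"
      by (simp add: sum.distrib)
    also have "\<dots> \<le> (\<Sum>x\<in>R. \<Sum>y\<in>R - {x}. c * (sqrt (N + D x y) + sqrt (N - D x y)) * b)"
      by (intro sum_mono pair)
    also have "\<dots> = (\<Sum>x\<in>R. c * b * (\<Sum>y\<in>R - {x}. sqrt (N + D x y) + sqrt (N - D x y)))"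
      by (simp add: sum_distrib_left mult_ac)
    also have "\<dots> \<le> (\<Sum>x\<in>R. c * b * (2 * (1 - \<gamma>) * sqrt N * (r - 1)))"
      using c0 by (intro sum_mono mult_left_mono avg) (auto simp: b_def)
    also have "\<dots> = 2 * (((1 - \<gamma>) * c) * sqrt N * (r * (r - 1) * b))"
      by (simp add: r_def mult_ac)
    also have "\<dots> \<le> 2 * ((1 / sqrt \<Lambda> + (1 - \<gamma>) ^ Suc m) * sqrt N * (r * (r - 1) * b))"
      using c_step 3 by (intro mult_left_mono mult_right_mono) (auto simp: b_def)
    also have "r * (r - 1) * b = real ((r choose l) * (l * (r - l)))"
      using binomial_remove_pair[OF l] by (simp add: b_def)
    finally have "real (num_subsets R l A) * real (l * (r - l))
        \<le> (1 / sqrt \<Lambda> + (1 - \<gamma>) ^ Suc m) * sqrt N * (r choose l) * real (l * (r - l))"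
      by (simp add: mult_ac)
    moreover have "real (l * (r - l)) > 0" using l by simp
    ultimately show ?thesis unfolding N_def r_def by (rule mult_right_le_imp_le)
  qed
qed

section \<open>Concentration of the sum of a random l-subset on a single residue\<close>

definition spread :: "int \<Rightarrow> nat \<Rightarrow> real \<Rightarrow> int set \<Rightarrow> bool" where
  "spread k l \<epsilon> R \<longleftrightarrow>
     (\<forall>x. real (card {B. B \<subseteq> R \<and> card B = l \<and> \<Sum>B mod k = x mod k}) \<le> \<epsilon> * (card R choose l))"

text \<open>Elements of \<open>R\<close> represent distinct residues, so at most one of them hits a
  given residue. This serves the equations in which a single position is random.\<close>

lemma spread_singleton:
  assumes "R \<subseteq> {0..<k}" "R \<noteq> {}"
  shows "spread k 1 (1 / card R) R"
  unfolding spread_def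
proof
  fix x
  have fin: "finite R" using assms finite_subset by blast
  have "{B. B \<subseteq> R \<and> card B = 1 \<and> \<Sum>B mod k = x mod k} \<subseteq> {{x mod k}}"
  proof
    fix B assume "B \<in> {B. B \<subseteq> R \<and> card B = 1 \<and> \<Sum>B mod k = x mod k}"
    moreover from this obtain y where "B = {y}" by (auto simp: card_1_singleton_iff)
    ultimately show "B \<in> {{x mod k}}" using assms by (auto simp: subset_iff)
  qed
  then have "card {B. B \<subseteq> R \<and> card B = 1 \<and> \<Sum>B mod k = x mod k} \<le> 1"
    using card_mono[of "{{x mod k}}"] by fastforce
  then show "real (card {B. B \<subseteq> R \<and> card B = 1 \<and> \<Sum>B mod k = x mod k}) \<le> 1 / card R * (card R choose 1)"
    using assms fin by (simp add: card_gt_0_iff)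
qed

text \<open>Splitting off one element as a shift turns a point into a translate of \<open>- R\<close> as the target;
  this is where the factor \<open>1 / (|R| - l + 1)\<close> comes from.\<close>

theorem spread_large:
  fixes k :: int and T \<Lambda> n1 \<gamma> :: real
  assumes k: "k > 0" and n1: "n1 > 0" "2 * T \<le> n1" "n1 \<le> \<Lambda>"
    and subgroups: "\<And>d. d dvd nat k \<Longrightarrow> real d > T \<Longrightarrow> 2 * \<Lambda> \<le> real d"
    and \<gamma>: "\<gamma> = (n1 / (64 * \<Lambda>))\<^sup>2 / 16"
    and R: "R \<subseteq> {0..<k}"
    and m: "m < l" "l + m \<le> card R" "n1 + 2 * real m \<le> real (card R)"
  shows "spread k l ((1 / sqrt \<Lambda> + (1 - \<gamma>) ^ m) * sqrt (card R) / (card R - l + 1)) R"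
  unfolding spread_def
proof
  fix x
  have fin: "finite R" using R finite_subset by blast
  have \<Lambda>: "\<Lambda> > 0" using n1 by linarith
  define c where "c = 1 / sqrt \<Lambda> + (1 - \<gamma>) ^ m"
  have "(n1 / (64 * \<Lambda>))\<^sup>2 \<le> 1" using n1 \<Lambda> by (intro power_le_one) (auto simp: field_simps)
  then have c0: "c \<ge> 0" using \<Lambda> by (simp add: c_def \<gamma>)
  define A where "A = {z. (x - z) mod k \<in> R}"
  have A: "periodic k A"
    by (auto simp: periodic_def A_def mod_diff_right_eq)
  let ?S = "{B. B \<subseteq> R \<and> card B = l \<and> \<Sum>B mod k = x mod k}"
  let ?S' = "{B. B \<subseteq> R \<and> card B = l - 1 \<and> \<Sum>B \<in> A}"
  have "card_mod k A \<le> card R"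
    unfolding card_mod_def
  proof (rule card_inj_on_le[where f = "\<lambda>z. (x - z) mod k"])
    show "inj_on (\<lambda>z. (x - z) mod k) (A \<inter> {0..<k})"
    proof (rule inj_onI)
      fix y z assume yz: "y \<in> A \<inter> {0..<k}" "z \<in> A \<inter> {0..<k}" and "(x - y) mod k = (x - z) mod k"
      then have "(x - (x - y)) mod k = (x - (x - z)) mod k" by (metis mod_diff_right_eq)
      then show "y = z" using yz by auto
    qed
  qed (use fin in \<open>auto simp: A_def\<close>)
  have "l * card ?S = card (SIGMA B:?S. B)"
  proof -
    have "card (SIGMA B:?S. B) = (\<Sum>B\<in>?S. card B)"
      by (rule card_SigmaI) (use fin finite_subset[OF _ fin] in simp_all)
    also have "\<dots> = (\<Sum>B\<in>?S. l)" by (rule sum.cong) simp_all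
    finally show ?thesis by simp
  qed
  \<comment> \<open>The sum of B is prescribed modulo \<open>k\<close>, so the removed element can
    be recovered from what remains; hence no (l - 1)-subset arises twice.\<close>
  also have "\<dots> \<le> card ?S'"
  proof (rule card_inj_on_le[where f = "\<lambda>(B, y). B - {y}"])
    show "inj_on (\<lambda>(B, y). B - {y}) (SIGMA B:?S. B)"
    proof (rule inj_onI, clarsimp)
      fix B y C z
      assume B: "B \<subseteq> R" "\<Sum>B mod k = x mod k" "y \<in> B" and C: "C \<subseteq> R" "\<Sum>C mod k = x mod k" "z \<in> C"
        and eq: "B - {y} = C - {z}"
      have "finite B" "finite C" using B C fin finite_subset by blast+
      then have "\<Sum>B = y + \<Sum>(B - {y})" "\<Sum>C = z + \<Sum>(B - {y})"
        using B C eq by (simp_all add: sum.remove)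
      then have "(y + \<Sum>(B - {y})) mod k = (z + \<Sum>(B - {y})) mod k" using B C by simp
      then have "y mod k = z mod k" by (metis add_diff_cancel_right' mod_diff_left_eq)
      then have "y = z" using B C R by (auto simp: subset_iff)
      then show "B = C \<and> y = z" using eq B C by (metis insert_Diff)
    qed
    show "(\<lambda>(B, y). B - {y}) ` (SIGMA B:?S. B) \<subseteq> ?S'"
    proof clarsimp
      fix B y assume B: "B \<subseteq> R" "l = card B" "\<Sum>B mod k = x mod k" "y \<in> B"
      have fB: "finite B" using B fin finite_subset by blast
      have "(x - \<Sum>(B - {y})) mod k = (\<Sum>B - \<Sum>(B - {y})) mod k"
        using B by (metis mod_diff_left_eq)
      also have "\<Sum>B - \<Sum>(B - {y}) = y" using fB B by (simp add: sum.remove)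
      also have "y mod k = y" using B R by (auto simp: subset_iff)
      finally have "\<Sum>(B - {y}) \<in> A" using B by (auto simp: A_def)
      then show "B - {y} \<subseteq> R \<and> \<Sum>(B - {y}) \<in> A" using B by auto
    qed
  qed (use fin in simp)
  also have "card ?S' = num_subsets R (l - 1) A" by (simp add: num_subsets_def)
  finally have "real l * real (card ?S) \<le> real (num_subsets R (l - 1) A)"
    unfolding of_nat_mult[symmetric] of_nat_le_iff .
  also have "\<dots> \<le> (1 / sqrt \<Lambda> + (1 - \<gamma>) ^ m) * sqrt (card_mod k A) * (card R choose (l - 1))"
    by (rule num_subsets_sqrt_bound[OF k n1 subgroups \<gamma> R A]) (use m in auto)
  also have "\<dots> \<le> c * sqrt (card R) * (card R choose (l - 1))"
    unfolding c_def[symmetric] using c0 \<open>card_mod k A \<le> card R\<close>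
    by (intro mult_right_mono mult_left_mono) auto
  finally have *: "real l * real (card ?S) \<le> c * sqrt (card R) * (card R choose (l - 1))" .
  define q where "q = card R - l + 1"
  have q: "q > 0" by (simp add: q_def)
  have "l * (card R choose l) = q * (card R choose (l - 1))"
  proof (cases "l = card R")
    case False
    show ?thesis
      using binomial_absorption[of "l - 1" "card R"] binomial_absorb_comp[of "card R" "l - 1"] m False
      by (simp add: q_def Suc_diff_le)
  next
    case True
    then show ?thesis using m by (cases "card R") (auto simp: q_def)
  qed
  then have "real l * (card R choose l) = real q * (card R choose (l - 1))"
    by (metis of_nat_mult)
  then have "c * sqrt (card R) * (card R choose (l - 1)) = real l * (c * sqrt (card R) / q * (card R choose l))"
    using q by (simp add: field_simps)
  then have "real l * real (card ?S) \<le> real l * (c * sqrt (card R) / q * (card R choose l))"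
    using * by linarith
  then have "real (card ?S) \<le> c * sqrt (card R) / q * (card R choose l)"
    by (rule mult_left_le_imp_le) (use m in simp)
  then show "real (card ?S) \<le> (1 / sqrt \<Lambda> + (1 - \<gamma>) ^ m) * sqrt (card R) / (card R - l + 1) * (card R choose l)"
    using m by (simp add: c_def q_def of_nat_diff)
qed

section \<open>Linear conditions on random permutations\<close>

lemma ex_permutes_image:
  assumes "finite Q" "B \<subseteq> Q" "C \<subseteq> Q" "card B = card C"
  obtains p where "p permutes Q" "p ` B = C"
proof -
  have fin: "finite B" "finite C" using assms finite_subset by blast+
  obtain g where g: "bij_betw g B C"
    using finite_same_card_bij[OF fin assms(4)] by blast
  have "card (Q - B) = card (Q - C)"
    using assms fin by (simp add: card_Diff_subset)
  then obtain h where h: "bij_betw h (Q - B) (Q - C)"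
    using finite_same_card_bij[of "Q - B" "Q - C"] assms(1) by blast
  define p where "p x = (if x \<in> B then g x else if x \<in> Q then h x else x)" for x
  have pB: "bij_betw p B C" using g by (simp add: p_def cong: bij_betw_cong)
  have "bij_betw p (Q - B) (Q - C) \<longleftrightarrow> bij_betw h (Q - B) (Q - C)"
    by (rule bij_betw_cong) (auto simp: p_def)
  then have pQB: "bij_betw p (Q - B) (Q - C)" using h by simp
  have "bij_betw p (B \<union> (Q - B)) (C \<union> (Q - C))"
    by (rule bij_betw_combine[OF pB pQB]) auto
  moreover have "B \<union> (Q - B) = Q" "C \<union> (Q - C) = Q" using assms by auto
  ultimately have "bij_betw p Q Q" by simp
  then have "p permutes Q"
    by (rule bij_imp_permutes) (use assms in \<open>auto simp: p_def\<close>)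
  then show thesis using that pB by (auto simp: bij_betw_def)
qed

text \<open>Composition on the left with a permutation that carries one target to another shows that
  all targets of the right size are equally likely; there are \<open>card Q choose card B\<close> of
  them.\<close>

lemma card_permutes_image:
  assumes Q: "finite Q" "B \<subseteq> Q" "C \<subseteq> Q" "card B = card C"
  shows "card {p. p permutes Q \<and> p ` B = C} = fact (card B) * fact (card Q - card B)"
proof -
  let ?P = "\<lambda>D. {p. p permutes Q \<and> p ` B = D}"
  have same: "card (?P D) = card (?P B)" if D: "D \<subseteq> Q" "card D = card B" for D
  proof -
    obtain s where s: "s permutes Q" "s ` B = D"
      using ex_permutes_image[OF Q(1,2) D(1)] D by metis
    have inv: "Hilbert_Choice.inv s permutes Q" "Hilbert_Choice.inv s ` D = B"
      using s permutes_inv[OF s(1)] permutes_inj[OF s(1)] by (auto simp: image_image)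
    have "bij_betw (\<lambda>p. s \<circ> p) (?P B) (?P D)"
    proof (rule bij_betwI[where g = "\<lambda>p. Hilbert_Choice.inv s \<circ> p"])
      show "(\<lambda>p. s \<circ> p) \<in> ?P B \<rightarrow> ?P D"
      proof
        fix p assume "p \<in> ?P B"
        then have p: "p permutes Q" "p ` B = B" by simp_all
        have "(s \<circ> p) ` B = D" by (simp only: image_comp[symmetric] p s(2))
        then show "s \<circ> p \<in> ?P D" using permutes_compose[OF p(1) s(1)] by simp
      qed
      show "(\<lambda>p. Hilbert_Choice.inv s \<circ> p) \<in> ?P D \<rightarrow> ?P B"
      proof
        fix p assume "p \<in> ?P D"
        then have p: "p permutes Q" "p ` B = D" by simp_all
        have "(Hilbert_Choice.inv s \<circ> p) ` B = B" by (simp only: image_comp[symmetric] p inv(2))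
        then show "Hilbert_Choice.inv s \<circ> p \<in> ?P B" using permutes_compose[OF p(1) inv(1)] by simp
      qed
    qed (use permutes_inv_o[OF s(1)] in \<open>simp_all add: o_assoc\<close>)
    then show ?thesis by (rule bij_betw_same_card[symmetric])
  qed
  let ?\<S> = "{D. D \<subseteq> Q \<and> card D = card B}"
  have "fact (card Q) = card {p. p permutes Q}" using Q(1) by (simp add: card_permutations)
  also have "{p. p permutes Q} = (\<Union>D\<in>?\<S>. ?P D)"
  proof (intro Set.set_eqI iffI)
    fix p assume "p \<in> {p. p permutes Q}"
    then have p: "p permutes Q" by simp
    have "p ` B \<subseteq> Q" using permutes_image[OF p] Q(2) by blast
    moreover have "card (p ` B) = card B" by (rule card_image[OF permutes_inj_on[OF p]])
    ultimately show "p \<in> (\<Union>D\<in>?\<S>. ?P D)" using p by blast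
  qed blast
  also have "card \<dots> = (\<Sum>D\<in>?\<S>. card (?P D))"
    using Q(1) finite_permutations[OF Q(1)] by (subst card_UN_disjoint) auto
  also have "\<dots> = (card Q choose card B) * card (?P B)"
    using same Q(1) by (simp add: n_subsets)
  finally have "(card Q choose card B) * card (?P B) = fact (card Q)" by simp
  moreover have "card B \<le> card Q" using Q card_mono by blast
  ultimately have "(card Q choose card B) * card (?P B) = (card Q choose card B) * (fact (card B) * fact (card Q - card B))"
    using binomial_fact_lemma[of "card B" "card Q"] by (simp add: mult_ac)
  then show ?thesis
    using same[of C] Q \<open>card B \<le> card Q\<close> by simp
qed

text \<open>Conditional resampling. The event \<open>B\<close> does not notice a reshuffling of the
  positions in \<open>Q\<close>, so given \<open>B\<close>, the permutation
  \<open>p \<circ> q\<close> with q uniform on \<open>Q\<close> is distributed like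
  \<open>p\<close>. A bound on \<open>A\<close> that holds for each fixed \<open>p\<close> over the
  random q is therefore a bound on the conditional probability. The proof counts the pairs (p, q) in
  both orders.\<close>

lemma card_permutations_averaging:
  fixes \<epsilon> :: real
  assumes X: "finite X" and Q: "Q \<subseteq> X"
    and inv: "\<And>p q. p permutes X \<Longrightarrow> q permutes Q \<Longrightarrow> B (p \<circ> q) \<longleftrightarrow> B p"
    and le: "\<And>p. p permutes X \<Longrightarrow> B p \<Longrightarrow> real (card {q. q permutes Q \<and> A (p \<circ> q)}) \<le> \<epsilon> * fact (card Q)"
  shows "real (card {p. p permutes X \<and> A p \<and> B p}) \<le> \<epsilon> * real (card {p. p permutes X \<and> B p})"
proof -
  let ?P = "{p. p permutes X \<and> B p}" and ?Q = "{q. q permutes Q}"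
  have finQ: "finite Q" using X Q finite_subset by blast
  have finP: "finite ?P" "finite ?Q"
    using finite_permutations[OF X] finite_permutations[OF finQ] by auto
  have shift: "card {p \<in> ?P. A (p \<circ> q)} = card {p. p permutes X \<and> A p \<and> B p}" if q: "q \<in> ?Q" for q
  proof (rule bij_betw_same_card[of "\<lambda>p. p \<circ> q"])
    have qX: "q permutes X" using q Q permutes_subset by auto
    have qi: "Hilbert_Choice.inv q permutes Q" "Hilbert_Choice.inv q permutes X" using q qX permutes_inv by auto
    have cancel: "p \<circ> q \<circ> Hilbert_Choice.inv q = p" "p \<circ> Hilbert_Choice.inv q \<circ> q = p" for p :: "'a \<Rightarrow> 'a"
      using permutes_inv_o[OF qX] by (simp_all add: comp_assoc)
    show "bij_betw (\<lambda>p. p \<circ> q) {p \<in> ?P. A (p \<circ> q)} {p. p permutes X \<and> A p \<and> B p}"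
    proof (rule bij_betwI[where g = "\<lambda>p. p \<circ> Hilbert_Choice.inv q"])
      show "(\<lambda>p. p \<circ> q) \<in> {p \<in> ?P. A (p \<circ> q)} \<rightarrow> {p. p permutes X \<and> A p \<and> B p}"
        using q qX inv permutes_compose by blast
      show "(\<lambda>p. p \<circ> Hilbert_Choice.inv q) \<in> {p. p permutes X \<and> A p \<and> B p} \<rightarrow> {p \<in> ?P. A (p \<circ> q)}"
        using qi inv permutes_compose cancel by auto
    qed (simp_all add: cancel)
  qed
  have "fact (card Q) * card {p. p permutes X \<and> A p \<and> B p} = (\<Sum>q\<in>?Q. card {p \<in> ?P. A (p \<circ> q)})"
    using shift card_permutations[OF refl finQ] by simp
  also have "\<dots> = (\<Sum>p\<in>?P. card {q \<in> ?Q. A (p \<circ> q)})"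
    by (rule sum_multicount_gen[OF finP(2,1), symmetric, THEN sym]) auto
  finally have eq: "fact (card Q) * card {p. p permutes X \<and> A p \<and> B p} = (\<Sum>p\<in>?P. card {q. q permutes Q \<and> A (p \<circ> q)})"
    by simp
  have "fact (card Q) * real (card {p. p permutes X \<and> A p \<and> B p}) = (\<Sum>p\<in>?P. real (card {q. q permutes Q \<and> A (p \<circ> q)}))"
    using arg_cong[OF eq, of real] by (simp only: of_nat_mult of_nat_sum of_nat_fact)
  also have "\<dots> \<le> (\<Sum>p\<in>?P. \<epsilon> * fact (card Q))"
    by (intro sum_mono le) auto
  also have "\<dots> = fact (card Q) * (\<epsilon> * real (card ?P))" by simp
  finally show ?thesis by simp
qed

text \<open>Coefficients belong to positions, and \<open>p\<close> says which element of the
  enumeration \<open>f\<close> stands at a position. Composition of \<open>p\<close> on the right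
  with q thus moves elements between positions while the coefficients stay in place.\<close>

definition lin :: "int \<Rightarrow> nat \<Rightarrow> (nat \<Rightarrow> int) \<Rightarrow> (nat \<Rightarrow> int) \<Rightarrow> (nat \<Rightarrow> nat) \<Rightarrow> bool" where
  "lin k n f c p \<longleftrightarrow> k dvd (\<Sum>i<n. c i * f (p i))"

lemma lin_invariant:
  assumes "q permutes Q" "\<And>i. i \<in> Q \<Longrightarrow> c i = 0"
  shows "lin k n f c (p \<circ> q) \<longleftrightarrow> lin k n f c p"
proof -
  have "c i * f ((p \<circ> q) i) = c i * f (p i)" for i
    using assms by (cases "i \<in> Q") (auto simp: permutes_not_in)
  then show ?thesis by (simp only: lin_def)
qed

text \<open>Under reshuffling of \<open>K \<union> Z\<close> the equation depends only on the set of
  elements that land in \<open>K\<close>: the coefficients are constant there and vanish on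
  \<open>Z\<close>. This set is a uniformly random subset of size \<open>card K\<close>, and the
  equation prescribes its sum modulo \<open>k\<close>.\<close>

lemma card_lin_le:
  fixes \<epsilon> :: real
  assumes f: "inj_on f {..<n}" and p: "p permutes {..<n}"
    and KZ: "K \<subseteq> {..<n}" "Z \<subseteq> {..<n}" "K \<inter> Z = {}"
    and c: "s = 1 \<or> s = -1" "\<And>i. i \<in> K \<Longrightarrow> c i = s" "\<And>i. i \<in> Z \<Longrightarrow> c i = 0"
    and spread: "\<And>R. R \<subseteq> f ` {..<n} \<Longrightarrow> card R = card K + card Z \<Longrightarrow> spread k (card K) \<epsilon> R"
  shows "real (card {q. q permutes K \<union> Z \<and> lin k n f c (p \<circ> q)}) \<le> \<epsilon> * fact (card (K \<union> Z))"
proof -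
  define Q where "Q = K \<union> Z"
  define g where "g = f \<circ> p"
  have QX: "Q \<subseteq> {..<n}" using KZ by (auto simp: Q_def)
  have fin: "finite Q" "finite K" "finite Z" using QX KZ finite_subset by blast+
  have cQ: "card Q = card K + card Z" using fin KZ by (simp add: Q_def card_Un_disjoint)
  have injg: "inj_on g {..<n}"
    unfolding g_def by (rule comp_inj_on[OF permutes_inj_on[OF p]]) (simp add: permutes_image[OF p] f)
  \<comment> \<open>The residue that the elements landing in \<open>K\<close> have to sum to; the
    sign \<open>s\<close> is its own inverse, so multiplication by \<open>s\<close> solves the
    equation for their sum.\<close>
  define x where "x = - s * (\<Sum>i\<in>{..<n} - Q. c i * g i)"
  let ?B = "{B. B \<subseteq> Q \<and> card B = card K \<and> \<Sum>(g ` B) mod k = x mod k}"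
  have image: "q ` K \<in> ?B" if q: "q permutes Q" "lin k n f c (p \<circ> q)" for q
  proof -
    have qK: "q ` K \<subseteq> Q" using permutes_image[OF q(1)] by (auto simp: Q_def)
    have qn: "q permutes {..<n}" using q(1) QX permutes_subset by blast
    have "(\<Sum>i<n. c i * f ((p \<circ> q) i)) = (\<Sum>i\<in>{..<n} - Q. c i * g (q i)) + (\<Sum>i\<in>Q. c i * g (q i))"
      using sum.subset_diff[OF QX] by (simp add: g_def)
    also have "(\<Sum>i\<in>{..<n} - Q. c i * g (q i)) = (\<Sum>i\<in>{..<n} - Q. c i * g i)"
      using permutes_not_in[OF q(1)] by (intro sum.cong) auto
    also have "(\<Sum>i\<in>Q. c i * g (q i)) = (\<Sum>i\<in>K. c i * g (q i)) + (\<Sum>i\<in>Z. c i * g (q i))"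
      unfolding Q_def using fin KZ by (intro sum.union_disjoint) auto
    also have "(\<Sum>i\<in>K. c i * g (q i)) = s * (\<Sum>i\<in>K. g (q i))"
      using c(2) by (simp add: sum_distrib_left)
    also have "(\<Sum>i\<in>Z. c i * g (q i)) = 0" using c(3) by simp
    also have "(\<Sum>i\<in>K. g (q i)) = \<Sum>(g ` q ` K)"
    proof -
      have "inj_on g (q ` K)" using injg qK QX inj_on_subset by blast
      moreover have "inj_on q K" using permutes_inj_on[OF q(1)] .
      ultimately show ?thesis by (simp add: sum.reindex)
    qed
    finally have "k dvd (\<Sum>i\<in>{..<n} - Q. c i * g i) + s * \<Sum>(g ` q ` K)"
      using q(2) by (simp add: lin_def)
    then have "k dvd s * ((\<Sum>i\<in>{..<n} - Q. c i * g i) + s * \<Sum>(g ` q ` K))"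
      by (rule dvd_mult)
    then have "k dvd \<Sum>(g ` q ` K) - x"
      using c(1) by (auto simp: x_def algebra_simps)
    then show ?thesis
      using qK permutes_inj_on[OF q(1), of K] by (simp add: card_image mod_eq_dvd_iff)
  qed
  have finB: "finite ?B" using fin by simp
  have "{q. q permutes Q \<and> lin k n f c (p \<circ> q)} \<subseteq> (\<Union>B\<in>?B. {q. q permutes Q \<and> q ` K = B})"
    using image by blast
  then have "card {q. q permutes Q \<and> lin k n f c (p \<circ> q)} \<le> card (\<Union>B\<in>?B. {q. q permutes Q \<and> q ` K = B})"
    using finB finite_permutations[OF fin(1)] by (intro card_mono) auto
  also have "\<dots> \<le> (\<Sum>B\<in>?B. card {q. q permutes Q \<and> q ` K = B})"
    by (rule card_UN_le[OF finB])
  also have "\<dots> = (\<Sum>B\<in>?B. fact (card K) * fact (card Q - card K))"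
    using fin by (intro sum.cong refl card_permutes_image) (auto simp: Q_def)
  finally have 1: "card {q. q permutes Q \<and> lin k n f c (p \<circ> q)} \<le> card ?B * (fact (card K) * fact (card Q - card K))"
    by simp
  have c1: "card ?B \<le> card {B. B \<subseteq> g ` Q \<and> card B = card K \<and> \<Sum>B mod k = x mod k}"
  proof (rule card_inj_on_le[where f = "(`) g"])
    have injQ: "inj_on g Q" using injg QX inj_on_subset by blast
    show "inj_on ((`) g) ?B"
      by (rule inj_on_subset[OF inj_on_image_Pow[OF injQ]]) auto
    show "(`) g ` ?B \<subseteq> {B. B \<subseteq> g ` Q \<and> card B = card K \<and> \<Sum>B mod k = x mod k}"
      using inj_on_subset[OF injQ] by (auto simp: card_image)
  qed (use fin in simp)
  have c2: "g ` Q \<subseteq> f ` {..<n}"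
    using QX permutes_image[OF p] by (auto simp: g_def image_comp[symmetric])
  have c3: "card (g ` Q) = card Q"
    using injg QX by (meson card_image inj_on_subset)
  have "real (card {B. B \<subseteq> g ` Q \<and> card B = card K \<and> \<Sum>B mod k = x mod k}) \<le> \<epsilon> * (card (g ` Q) choose card K)"
    using spread[OF c2] cQ c3 unfolding spread_def by simp
  with of_nat_mono[OF c1, where 'a = real] have "real (card ?B) \<le> \<epsilon> * (card Q choose card K)"
    unfolding c3 by (rule order_trans)
  then have "real (card ?B) * real (fact (card K) * fact (card Q - card K))
      \<le> \<epsilon> * (card Q choose card K) * real (fact (card K) * fact (card Q - card K))"
    by (rule mult_right_mono) simp
  moreover have "real (card {q. q permutes Q \<and> lin k n f c (p \<circ> q)})
      \<le> real (card ?B) * real (fact (card K) * fact (card Q - card K))"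
    using 1 unfolding of_nat_mult[symmetric] of_nat_le_iff .
  moreover have "\<epsilon> * (card Q choose card K) * real (fact (card K) * fact (card Q - card K)) = \<epsilon> * fact (card Q)"
    using arg_cong[OF binomial_fact_lemma[of "card K" "card Q"], of real] cQ by (simp add: mult_ac)
  ultimately show ?thesis unfolding Q_def[symmetric] by linarith
qed

text \<open>The conditions are revealed in decreasing order of their indices: those with smaller index do
  not involve the positions in \<open>K v \<union> Z\<close>, which are reshuffled to bound the one with index \<open>v\<close>.\<close>

theorem card_all_lin_le:
  fixes \<epsilon> :: real and K :: "nat \<Rightarrow> nat set"
  assumes f: "inj_on f {..<n}" and \<epsilon>: "\<epsilon> \<ge> 0" and I: "finite (I :: nat set)"
    and Z: "Z \<subseteq> {..<n}"
    and K: "\<And>v. v \<in> I \<Longrightarrow> K v \<subseteq> {..<n}" "\<And>v. v \<in> I \<Longrightarrow> K v \<inter> Z = {}"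
    and s: "\<And>v. v \<in> I \<Longrightarrow> s v = 1 \<or> s v = -1"
    and c: "\<And>v i. v \<in> I \<Longrightarrow> i \<in> K v \<Longrightarrow> c v i = s v" "\<And>v i. v \<in> I \<Longrightarrow> i \<in> Z \<Longrightarrow> c v i = 0"
      "\<And>u v i. u \<in> I \<Longrightarrow> v \<in> I \<Longrightarrow> u < v \<Longrightarrow> i \<in> K v \<Longrightarrow> c u i = 0"
    and spread: "\<And>v R. v \<in> I \<Longrightarrow> R \<subseteq> f ` {..<n} \<Longrightarrow> card R = card (K v) + card Z \<Longrightarrow> spread k (card (K v)) \<epsilon> R"
  shows "real (card {p. p permutes {..<n} \<and> (\<forall>v\<in>I. lin k n f (c v) p)}) \<le> \<epsilon> ^ card I * fact n"
  using I K s c spread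
proof (induction I rule: finite_linorder_max_induct)
  case empty
  then show ?case by (simp add: card_permutations)
next
  case (insert v J)
  have vJ: "v \<notin> J" using insert.hyps(2) by blast
  let ?P = "\<lambda>I. {p. p permutes {..<n} \<and> (\<forall>v\<in>I. lin k n f (c v) p)}"
  have IH: "real (card (?P J)) \<le> \<epsilon> ^ card J * fact n"
    by (rule insert.IH; rule insert.prems; (rule insertI2)?; assumption)
  have "real (card {p. p permutes {..<n} \<and> lin k n f (c v) p \<and> (\<forall>u\<in>J. lin k n f (c u) p)})
      \<le> \<epsilon> * real (card (?P J))"
  proof (rule card_permutations_averaging)
    show "K v \<union> Z \<subseteq> {..<n}" using insert.prems(1)[of v] Z by auto
    show "(\<forall>u\<in>J. lin k n f (c u) (p \<circ> q)) \<longleftrightarrow> (\<forall>u\<in>J. lin k n f (c u) p)"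
      if "q permutes K v \<union> Z" for p q
    proof (intro ball_cong refl lin_invariant[OF that])
      fix u i assume "u \<in> J" "i \<in> K v \<union> Z"
      then show "c u i = 0" using insert.prems(5)[of u i] insert.prems(6)[of u v i] insert.hyps(2) by blast
    qed
    show "real (card {q. q permutes K v \<union> Z \<and> lin k n f (c v) (p \<circ> q)}) \<le> \<epsilon> * fact (card (K v \<union> Z))"
      if "p permutes {..<n}" for p
      by (rule card_lin_le[OF f that _ Z, where s = "s v"]; rule insert.prems; (rule insertI1)?; assumption)
  qed simp
  moreover have "{p. p permutes {..<n} \<and> lin k n f (c v) p \<and> (\<forall>u\<in>J. lin k n f (c u) p)} = ?P (insert v J)"
    by auto
  ultimately have "real (card (?P (insert v J))) \<le> \<epsilon> * real (card (?P J))" by (simp only:)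
  also have "\<dots> \<le> \<epsilon> * (\<epsilon> ^ card J * fact n)" using IH \<epsilon> by (intro mult_left_mono)
  also have "\<dots> = \<epsilon> ^ card (insert v J) * fact n" using insert.hyps(1) vJ by simp
  finally show ?case .
qed

section \<open>Collisions of partial sums\<close>

text \<open>The point \<open>x v\<close> separates \<open>U v\<close> from all earlier sets at once;
  this triangular pattern later makes the equations attached to the sets independent. A point
  separating two members splits the family; the larger part keeps half of it and is treated
  recursively, and one member of the other part becomes the last set.\<close>

lemma splitting_sequence:
  assumes "finite \<F>" "2 ^ M \<le> card \<F>"
  shows "\<exists>U x. (\<forall>w\<le>M. U w \<in> \<F>) \<and> (\<forall>v\<le>M. \<forall>u<v. x v \<in> U u \<longleftrightarrow> x v \<notin> U v)"
  using assms
proof (induction M arbitrary: \<F>)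
  case 0
  then obtain U where "U \<in> \<F>" by fastforce
  then show ?case by (intro exI[of _ "\<lambda>_. U"]) auto
next
  case (Suc M)
  have "(1::nat) \<le> 2 ^ M" by simp
  then have "2 \<le> card \<F>" using Suc.prems(2) unfolding power_Suc by linarith
  then have "\<not> card \<F> \<le> Suc 0" by linarith
  then obtain A B where AB: "A \<in> \<F>" "B \<in> \<F>" "A \<noteq> B"
    unfolding card_le_Suc0_iff_eq[OF Suc.prems(1)] by blast
  then obtain y where y: "y \<in> A \<longleftrightarrow> y \<notin> B" by blast
  let ?P = "\<lambda>b. {U \<in> \<F>. (y \<in> U) = b}"
  have "card (?P True) + card (?P False) = card \<F>"
    using Suc.prems(1) by (subst card_Un_disjoint[symmetric]) (auto intro: arg_cong[where f = card])
  then have "2 ^ M \<le> card (?P True) \<or> 2 ^ M \<le> card (?P False)"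
    using Suc.prems(2) unfolding power_Suc by linarith
  then obtain b where b: "2 ^ M \<le> card (?P b)" by blast
  obtain U x where Ux: "\<forall>w\<le>M. U w \<in> ?P b" "\<forall>v\<le>M. \<forall>u<v. x v \<in> U u \<longleftrightarrow> x v \<notin> U v"
    using Suc.IH[OF _ b] Suc.prems(1) by auto
  obtain C where C: "C \<in> \<F>" "(y \<in> C) = (\<not> b)" using AB y by blast
  show ?case
  proof (intro exI[of _ "U(Suc M := C)"] exI[of _ "x(Suc M := y)"] conjI allI impI)
    fix w assume "w \<le> Suc M"
    then show "(U(Suc M := C)) w \<in> \<F>" using Ux C by (auto simp: le_Suc_eq)
  next
    fix v u assume vu: "v \<le> Suc M" "u < v"
    show "(x(Suc M := y)) v \<in> (U(Suc M := C)) u \<longleftrightarrow> (x(Suc M := y)) v \<notin> (U(Suc M := C)) v"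
    proof (cases "v = Suc M")
      case True
      then have "U u \<in> ?P b" using vu Ux(1) by simp
      then show ?thesis using True vu C(2) by simp
    next
      case False
      then show ?thesis using vu Ux(2) by simp
    qed
  qed
qed

text \<open>Greedy choice: take the minimum, discard everything less than \<open>G\<close> above it,
  and repeat. Either this succeeds M times, or the minima taken so far cover
  \<open>J\<close>.\<close>

lemma separated_or_covered:
  fixes J :: "nat set"
  assumes "finite J"
  shows "(\<exists>a. (\<forall>w<M. a w \<in> J) \<and> (\<forall>v<M. \<forall>u<v. a u + G \<le> a v)) \<or>
         (\<exists>D. finite D \<and> card D < M \<and> (\<forall>j\<in>J. \<exists>d\<in>D. d \<le> j \<and> j < d + G))"
  using assms
proof (induction M arbitrary: J)
  case (Suc M)
  show ?case
  proof (cases "J = {}")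
    case True
    then show ?thesis by (intro disjI2 exI[of _ "{}"]) auto
  next
    case False
    define d where "d = Min J"
    have d: "d \<in> J" "\<And>j. j \<in> J \<Longrightarrow> d \<le> j" using Suc.prems False by (auto simp: d_def)
    consider a where "\<forall>w<M. a w \<in> {j \<in> J. d + G \<le> j}" "\<forall>v<M. \<forall>u<v. a u + G \<le> a v"
      | D where "finite D" "card D < M" "\<forall>j\<in>{j \<in> J. d + G \<le> j}. \<exists>d\<in>D. d \<le> j \<and> j < d + G"
      using Suc.IH[of "{j \<in> J. d + G \<le> j}"] Suc.prems by auto
    then show ?thesis
    proof cases
      case 1
      define a' where "a' w = (case w of 0 \<Rightarrow> d | Suc w' \<Rightarrow> a w')" for w
      have "a' w \<in> J" if "w < Suc M" for w
        using that 1 d by (cases w) (auto simp: a'_def)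
      moreover have "a' u + G \<le> a' v" if "v < Suc M" "u < v" for u v
        using that 1 by (cases v; cases u) (auto simp: a'_def)
      ultimately show ?thesis by (intro disjI1 exI[of _ a']) simp
    next
      case 2
      have "\<exists>c\<in>insert d D. c \<le> j \<and> j < c + G" if "j \<in> J" for j
        using that 2(3) d by (cases "d + G \<le> j") auto
      moreover have "card (insert d D) < Suc M"
        using 2 by (simp add: card_insert_if)
      ultimately show ?thesis using 2(1) by (intro disjI2 exI[of _ "insert d D"]) auto
    qed
  qed
qed auto

text \<open>The initial segments of positions that may result at or shortly after position \<open>a\<close> from
  rearranging a window of length \<open>W\<close> that starts at \<open>a\<close> and ends before \<open>hi\<close>.\<close>

definition near_prefixes :: "nat \<Rightarrow> nat \<Rightarrow> nat \<Rightarrow> nat set set" where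
  "near_prefixes W hi a = {F. {..<a} \<subseteq> F \<and> F \<subseteq> {..<min (a + W) hi}}"

lemma near_prefixes_bounds:
  assumes "F \<in> near_prefixes W hi a"
  shows "i < a \<Longrightarrow> i \<in> F" "i \<in> F \<Longrightarrow> i < a + W" "i \<in> F \<Longrightarrow> i < hi"
  using assms by (auto simp: near_prefixes_def subset_iff)

lemma card_near_prefixes: "finite (near_prefixes W hi a)" "card (near_prefixes W hi a) \<le> 2 ^ W"
proof -
  show "finite (near_prefixes W hi a)"
    by (rule finite_subset[of _ "Pow {..<hi}"]) (auto simp: near_prefixes_def)
  have "card (near_prefixes W hi a) \<le> card (Pow {a..<a + W})"
  proof (rule card_inj_on_le[where f = "\<lambda>F. F \<inter> {a..<a + W}"])
    show "inj_on (\<lambda>F. F \<inter> {a..<a + W}) (near_prefixes W hi a)"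
    proof (rule inj_onI)
      fix F F' assume F: "F \<in> near_prefixes W hi a" "F' \<in> near_prefixes W hi a"
        and eq: "F \<inter> {a..<a + W} = F' \<inter> {a..<a + W}"
      have "H = {..<a} \<union> (H \<inter> {a..<a + W})" if "H \<in> near_prefixes W hi a" for H
        using near_prefixes_bounds[OF that] by fastforce
      from this[OF F(1)] this[OF F(2)] show "F = F'" using eq by simp
    qed
  qed auto
  then show "card (near_prefixes W hi a) \<le> 2 ^ W" by (simp add: card_Pow)
qed

text \<open>The coefficient of position \<open>i\<close> in the difference of two collision
  equations, one between \<open>U\<close> and \<open>F\<close>, the other between \<open>U'\<close>
  and \<open>F'\<close>. Subtraction removes the constant \<open>v\<close> common to both.\<close>

definition coef :: "nat set \<Rightarrow> nat set \<Rightarrow> nat set \<Rightarrow> nat set \<Rightarrow> nat \<Rightarrow> int" where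
  "coef F F' U U' i = of_bool (i \<in> F) - of_bool (i \<in> F') - (of_bool (i \<in> U) - of_bool (i \<in> U'))"

lemma lin_coefI:
  fixes v :: int
  assumes sub: "F \<subseteq> {..<n}" "F' \<subseteq> {..<n}" "U \<subseteq> {..<n}" "U' \<subseteq> {..<n}"
    and eq: "(v + (\<Sum>i\<in>U. f (p i))) mod k = (\<Sum>i\<in>F. f (p i)) mod k"
      "(v + (\<Sum>i\<in>U'. f (p i))) mod k = (\<Sum>i\<in>F'. f (p i)) mod k"
  shows "lin k n f (coef F F' U U') p"
proof -
  have ind: "(\<Sum>i<n. of_bool (i \<in> A) * f (p i)) = (\<Sum>i\<in>A. f (p i))" if "A \<subseteq> {..<n}" for A
    using that by (simp add: of_bool_def if_distrib[of "\<lambda>x. x * _"] sum.If_cases Int_absorb1 cong: if_cong)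
  have "(\<Sum>i<n. coef F F' U U' i * f (p i)) =
    ((\<Sum>i\<in>F. f (p i)) - (v + (\<Sum>i\<in>U. f (p i)))) - ((\<Sum>i\<in>F'. f (p i)) - (v + (\<Sum>i\<in>U'. f (p i))))"
    unfolding coef_def left_diff_distrib sum_subtractf ind[OF sub(1)] ind[OF sub(2)] ind[OF sub(3)] ind[OF sub(4)]
    by simp
  moreover have "k dvd (\<Sum>i\<in>F. f (p i)) - (v + (\<Sum>i\<in>U. f (p i)))"
    "k dvd (\<Sum>i\<in>F'. f (p i)) - (v + (\<Sum>i\<in>U'. f (p i)))"
    using eq by (metis mod_eq_dvd_iff)+
  ultimately show ?thesis unfolding lin_def by (simp only: dvd_diff)
qed

lemma spread_mono: "spread k l \<epsilon> R \<Longrightarrow> \<epsilon> \<le> \<epsilon>' \<Longrightarrow> spread k l \<epsilon>' R"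
  unfolding spread_def by (meson mult_right_mono of_nat_0_le_iff order_trans)

text \<open>In the application \<open>v\<close> is the sum of the elements preceding the window that
  contains \<open>U\<close>. It is kept as a free parameter because it depends on \<open>p\<close>
  itself.\<close>

definition collides ::
    "int \<Rightarrow> (nat \<Rightarrow> int) \<Rightarrow> (nat \<Rightarrow> nat) \<Rightarrow> int \<Rightarrow> nat set \<Rightarrow> nat set \<Rightarrow> bool" where
  "collides k f p v U F \<longleftrightarrow> (v + (\<Sum>i\<in>U. f (p i))) mod k = (\<Sum>i\<in>F. f (p i)) mod k"

text \<open>Subtracting the collision with index 0 from the others leaves M equations. At
  \<open>x v\<close> the equation with index v has coefficient 1 or -1 and those with smaller index
  have coefficient 0, since \<open>x v\<close> does not separate the earlier sets from
  \<open>U 0\<close>. Exchanging the single element at \<open>x v\<close> with those on the many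
  positions of coefficient 0 gives each equation probability at most 2/n.\<close>

lemma card_near_collisions:
  fixes a :: "nat \<Rightarrow> nat" and U F :: "nat \<Rightarrow> nat set"
  assumes f: "inj_on f {..<n}" "f ` {..<n} \<subseteq> {0..<k}"
    and win: "e \<le> n" "e \<le> b + W" "hi \<le> n" "e \<le> lo \<or> hi \<le> b"
    and small: "4 * W + 4 * G \<le> n" "n > 0"
    and U: "\<And>w. w \<le> M \<Longrightarrow> U w \<subseteq> {b..<e}"
    and a: "\<And>w. w \<le> M \<Longrightarrow> lo \<le> a w \<and> a w \<le> hi \<and> a w \<le> d + G \<and> d \<le> a w + G"
    and F: "\<And>w. w \<le> M \<Longrightarrow> F w \<in> near_prefixes W hi (a w)"
    and x: "\<And>u v. v \<le> M \<Longrightarrow> u < v \<Longrightarrow> x v \<in> U u \<longleftrightarrow> x v \<notin> U v"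
  shows "real (card {p. p permutes {..<n} \<and> (\<exists>v. \<forall>w\<le>M. collides k f p v (U w) (F w))}) \<le> (2 / n) ^ M * fact n"
proof -
  define I where "I = {1..M}"
  define c where "c w = coef (F w) (F 0) (U w) (U 0)" for w
  \<comment> \<open>Outside the window, two prefixes that begin near \<open>d\<close> can disagree
    only on a short stretch around \<open>d\<close>. Removing both leaves at least half of all
    positions, with coefficient 0 in every equation.\<close>
  define Z where "Z = {..<n} - ({b..<e} \<union> {d - G..<d + G + W})"
  define s where "s v = of_bool (x v \<in> U 0) - (of_bool (x v \<in> U v) :: int)" for v
  have xwin: "x v \<in> {b..<e}" if "v \<in> I" for v
    using x[of v 0] U[of v] U[of 0] that by (auto simp: I_def)
  have cardZ: "n \<le> 2 * card Z"
  proof -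
    have "card ({b..<e} \<union> {d - G..<d + G + W}) \<le> card {b..<e} + card {d - G..<d + G + W}"
      by (rule card_Un_le)
    also have "\<dots> \<le> 2 * W + 2 * G" using win by auto
    finally show ?thesis
      using diff_card_le_card_Diff[of "{b..<e} \<union> {d - G..<d + G + W}" "{..<n}"] small
      by (simp add: Z_def)
  qed
  \<comment> \<open>Each prefix contains the whole window or misses it, on the same side for all w;
    inside the window only the sets \<open>U w\<close> contribute to the coefficients.\<close>
  have F_win: "i \<in> F w \<longleftrightarrow> i \<in> F 0" if "i \<in> {b..<e}" "w \<le> M" for i w
    using that win(4) near_prefixes_bounds[OF F[of w], of i] near_prefixes_bounds[OF F[of 0], of i] a[of w] a[of 0]
    by auto
  have cx: "c u (x v) = of_bool (x v \<in> U 0) - of_bool (x v \<in> U u)" if "v \<in> I" "u \<in> I" for u v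
    using F_win[OF xwin[OF that(1)], of u] that(2) by (simp add: c_def coef_def I_def)
  have "{p. p permutes {..<n} \<and> (\<exists>v. \<forall>w\<le>M. collides k f p v (U w) (F w))}
      \<subseteq> {p. p permutes {..<n} \<and> (\<forall>v\<in>I. lin k n f (c v) p)}"
  proof clarsimp
    fix p v w assume p: "\<forall>w\<le>M. collides k f p v (U w) (F w)" and w: "w \<in> I"
    have Fn: "F w \<subseteq> {..<n}" if "w \<le> M" for w
      using near_prefixes_bounds(3)[OF F[OF that]] win(3) by force
    have Un: "U w \<subseteq> {..<n}" if "w \<le> M" for w
      using U[OF that] win(1) by force
    show "lin k n f (c w) p"
      unfolding c_def using p w Fn[of w] Fn[of 0] Un[of w] Un[of 0]
      by (intro lin_coefI[where v = v]) (auto simp: I_def collides_def)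
  qed
  then have "real (card {p. p permutes {..<n} \<and> (\<exists>v. \<forall>w\<le>M. collides k f p v (U w) (F w))})
      \<le> real (card {p. p permutes {..<n} \<and> (\<forall>v\<in>I. lin k n f (c v) p)})"
    using finite_permutations[of "{..<n}"] by (intro of_nat_mono card_mono) auto
  also have "\<dots> \<le> (2 / n) ^ card I * fact n"
  proof (rule card_all_lin_le[where Z = Z and K = "\<lambda>v. {x v}" and s = s])
    show "{x v} \<subseteq> {..<n}" if "v \<in> I" for v using xwin[OF that] win by auto
    show "{x v} \<inter> Z = {}" if "v \<in> I" for v using xwin[OF that] by (auto simp: Z_def)
    show "s v = 1 \<or> s v = -1" if "v \<in> I" for v
      using x[of v 0] that by (auto simp: s_def I_def)
    show "c v i = s v" if "v \<in> I" "i \<in> {x v}" for v i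
      using cx[of v v] that by (simp add: s_def)
    show "c u i = 0" if "u \<in> I" "v \<in> I" "u < v" "i \<in> {x v}" for u v i
      using cx[of v u] x[of v u] x[of v 0] that by (auto simp: I_def)
    show "c v i = 0" if v: "v \<in> I" and i: "i \<in> Z" for v i
    proof -
      have "i \<in> F v \<longleftrightarrow> i \<in> F 0"
        using v i near_prefixes_bounds[OF F[of v], of i] near_prefixes_bounds[OF F[of 0], of i] a[of v] a[of 0]
        by (auto simp: Z_def I_def)
      moreover have "i \<notin> U v" "i \<notin> U 0" using U[of v] U[of 0] v i by (auto simp: Z_def I_def)
      ultimately show ?thesis by (simp add: c_def coef_def)
    qed
    show "spread k (card {x v}) (2 / n) R" if "R \<subseteq> f ` {..<n}" "card R = card {x v} + card Z" for v R
    proof -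
      have R: "R \<subseteq> {0..<k}" "card R > 0" using that f by auto
      have "1 / real (card R) \<le> 2 / n"
        using that cardZ small by (simp add: field_simps)
      moreover have "spread k 1 (1 / card R) R"
        using R by (intro spread_singleton) auto
      ultimately show ?thesis using spread_mono by auto
    qed
  qed (use f in \<open>auto simp: I_def Z_def\<close>)
  finally show ?thesis by (simp add: I_def)
qed

text \<open>Subtracting consecutive collisions leaves an equation whose coefficients are 1 on the
  long segment between two consecutive prefixes, and these segments do not interfere with one
  another. The sum over each segment is a random subset sum once there is a large reservoir of
  positions with coefficient 0 to exchange elements with.\<close>

lemma card_far_collisions:
  fixes a :: "nat \<Rightarrow> nat" and U F :: "nat \<Rightarrow> nat set" and \<epsilon> :: real
  assumes f: "inj_on f {..<n}"
    and win: "e \<le> n" "e \<le> b + W" "hi \<le> n" "e \<le> lo \<or> hi \<le> b"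
    and small: "4 * (M + 1) * W \<le> n" "n > 0" and M: "M \<ge> 2"
    and U: "\<And>w. w < M \<Longrightarrow> U w \<subseteq> {b..<e}"
    and a: "\<And>w. w < M \<Longrightarrow> lo \<le> a w \<and> a w \<le> hi"
    and sep: "\<And>u v. v < M \<Longrightarrow> u < v \<Longrightarrow> a u + G \<le> a v"
    and F: "\<And>w. w < M \<Longrightarrow> F w \<in> near_prefixes W hi (a w)"
    and \<epsilon>: "0 \<le> \<epsilon>" "\<epsilon> \<le> 1"
    and spread: "\<And>R l. R \<subseteq> f ` {..<n} \<Longrightarrow> G - W \<le> l \<Longrightarrow> l \<le> card R \<Longrightarrow> n \<le> 4 * M * (card R - l) \<Longrightarrow> spread k l \<epsilon> R"
  shows "real (card {p. p permutes {..<n} \<and> (\<exists>v. \<forall>w<M. collides k f p v (U w) (F w))}) \<le> \<epsilon> ^ (M - 2) * fact n"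
proof -
  \<comment> \<open>The first \<open>W\<close> positions after \<open>a w\<close> are left out,
    because the prefix \<open>F w\<close> may already contain some of them. At least
    \<open>G - W\<close> positions remain.\<close>
  define K where "K w = {a w + W..<a (Suc w)}" for w
  define L where "L = {..<M - 1}"
  define c where "c w = coef (F (Suc w)) (F w) (U (Suc w)) (U w)" for w
  define Zout where "Zout = {..<n} - ({b..<e} \<union> {a 0..<a (M - 1) + W})"
  have mono: "a u \<le> a v" if "u \<le> v" "v < M" for u v
    using sep[OF that(2), of u] that(1) by (cases "u = v") auto
  have K_range: "i < hi" "lo \<le> i" "i < n" "i \<notin> {b..<e}" if "w \<in> L" "i \<in> K w" for w i
  proof -
    have wM: "w < M" "Suc w < M" using that(1) by (auto simp: L_def)
    have "lo \<le> i" "i < hi"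
      using that(2) a[OF wM(1)] a[OF wM(2)] by (auto simp: K_def)
    then show "i < hi" "lo \<le> i" "i < n" "i \<notin> {b..<e}"
      using win by auto
  qed
  have Fn: "F w \<subseteq> {..<n}" if "w < M" for w
    using near_prefixes_bounds(3)[OF F[OF that]] win(3) by force
  have Un: "U w \<subseteq> {..<n}" if "w < M" for w
    using U[OF that] win(1) by force
  have c0: "c w i = 0" if w: "w \<in> L" and i: "i \<notin> {b..<e}" "i < a w \<or> a (Suc w) + W \<le> i" for w i
  proof -
    have wM: "w < M" "Suc w < M" using w by (auto simp: L_def)
    have "i \<notin> U w" "i \<notin> U (Suc w)" using U[OF wM(1)] U[OF wM(2)] i(1) by auto
    moreover have "i \<in> F w \<longleftrightarrow> i \<in> F (Suc w)"
      using i(2) near_prefixes_bounds[OF F[OF wM(1)], of i] near_prefixes_bounds[OF F[OF wM(2)], of i]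
        mono[of w "Suc w"] wM by force
    ultimately show ?thesis by (simp add: c_def coef_def)
  qed
  have c1: "c w i = 1" if w: "w \<in> L" and i: "i \<in> K w" for w i
  proof -
    have wM: "w < M" "Suc w < M" using w by (auto simp: L_def)
    have "i \<notin> U w" "i \<notin> U (Suc w)"
      using U[OF wM(1)] U[OF wM(2)] K_range(4)[OF w i] by blast+
    moreover have "i \<in> F (Suc w)" "i \<notin> F w"
      using i near_prefixes_bounds[OF F[OF wM(1)], of i] near_prefixes_bounds[OF F[OF wM(2)], of i]
      by (auto simp: K_def)
    ultimately show ?thesis by (simp add: c_def coef_def)
  qed
  have cK: "c w i = 0" if "w \<in> L" "v \<in> L" "v \<noteq> w" "i \<in> K v" for w v i
  proof (rule c0[OF that(1) K_range(4)[OF that(2,4)]])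
    have vw: "v < M" "w < M" using that by (auto simp: L_def)
    have i: "a v + W \<le> i" "i < a (Suc v)" using that(4) by (auto simp: K_def)
    show "i < a w \<or> a (Suc w) + W \<le> i"
    proof (cases "v < w")
      case True
      then show ?thesis using i mono[of "Suc v" w] vw by simp
    next
      case False
      then show ?thesis using that(3) i mono[of "Suc w" v] vw by simp
    qed
  qed
  have cover: "{..<n} \<subseteq> (Zout \<union> {b..<e}) \<union> ((\<Union>w\<in>L. K w) \<union> (\<Union>w<M. {a w..<a w + W}))"
  proof
    fix i assume i: "i \<in> {..<n}"
    show "i \<in> (Zout \<union> {b..<e}) \<union> ((\<Union>w\<in>L. K w) \<union> (\<Union>w<M. {a w..<a w + W}))"
    proof (cases "i \<in> {a 0..<a (M - 1) + W}")
      case False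
      then show ?thesis using i by (auto simp: Zout_def)
    next
      case True
      define P where "P w \<longleftrightarrow> w < M \<and> a w \<le> i" for w
      have P0: "P 0" using True M by (simp add: P_def)
      have bd: "\<And>y. P y \<Longrightarrow> y \<le> M" by (auto simp: P_def)
      define w where "w = (GREATEST w. P w)"
      have w: "P w" unfolding w_def by (rule GreatestI_nat[of P, OF P0 bd])
      have not_Suc: "\<not> P (Suc w)"
        using Greatest_le_nat[of P "Suc w" M] bd unfolding w_def[symmetric] by auto
      show ?thesis
      proof (cases "i < a w + W")
        case True
        then have "i \<in> {a w..<a w + W}" "w < M" using w by (auto simp: P_def)
        then show ?thesis by blast
      next
        case False
        then have "w \<noteq> M - 1" using \<open>i \<in> {a 0..<a (M - 1) + W}\<close> by auto
        then have "w \<in> L" "Suc w < M" using w M by (auto simp: P_def L_def)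
        moreover from this have "i \<in> K w" using False not_Suc by (auto simp: P_def K_def)
        ultimately show ?thesis by blast
      qed
    qed
  qed
  \<comment> \<open>The reservoir is the complement of all windows and segments if that is large.
    Otherwise some segment \<open>K z\<close> is large; the equation z is given up, and
    \<open>K z\<close> becomes the reservoir, since every other equation has coefficient 0 there.
    This is why only M - 2 equations are guaranteed.\<close>
  have "\<exists>Z I. I \<subseteq> L \<and> M - 2 \<le> card I \<and> Z \<subseteq> {..<n} \<and> n \<le> 4 * M * card Z \<and>
      (\<forall>w\<in>I. K w \<inter> Z = {}) \<and> (\<forall>w\<in>I. \<forall>i\<in>Z. c w i = 0)"
  proof (cases "n \<le> 4 * M * card Zout")
    case True
    have "i < a w \<or> a (Suc w) + W \<le> i" if "w \<in> L" "i \<in> Zout" for w i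
    proof -
      have wM: "w < M" "Suc w \<le> M - 1" "M - 1 < M" using that(1) by (auto simp: L_def)
      have "i < a 0 \<or> a (M - 1) + W \<le> i" using that(2) by (auto simp: Zout_def)
      then show ?thesis using mono[of 0 w] mono[of "Suc w" "M - 1"] wM by linarith
    qed
    then have zero: "c w i = 0" if "w \<in> L" "i \<in> Zout" for w i
      using that by (intro c0) (auto simp: Zout_def)
    have "K w \<inter> Zout = {}" if "w \<in> L" for w
      using c1[OF that] zero[OF that] by (metis disjoint_iff zero_neq_one)
    then show ?thesis
      using True zero by (intro exI[of _ Zout] exI[of _ L]) (auto simp: L_def Zout_def)
  next
    case False
    have "\<exists>z\<in>L. n \<le> 4 * M * card (K z)"
    proof (rule ccontr)
      assume "\<not> ?thesis"
      then have K_small: "4 * M * card (K z) \<le> n" if "z \<in> L" for z using that by force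
      have fin: "finite L" by (simp add: L_def)
      have "n = card {..<n}" by simp
      also have "\<dots> \<le> card ((Zout \<union> {b..<e}) \<union> ((\<Union>w\<in>L. K w) \<union> (\<Union>w<M. {a w..<a w + W})))"
        by (rule card_mono[OF _ cover]) (auto simp: Zout_def K_def fin)
      also have "\<dots> \<le> card (Zout \<union> {b..<e}) + card ((\<Union>w\<in>L. K w) \<union> (\<Union>w<M. {a w..<a w + W}))"
        by (rule card_Un_le)
      also have "\<dots> \<le> (card Zout + card {b..<e}) + (card (\<Union>w\<in>L. K w) + card (\<Union>w<M. {a w..<a w + W}))"
        by (intro add_mono card_Un_le)
      also have "\<dots> \<le> (card Zout + W) + ((\<Sum>w\<in>L. card (K w)) + (\<Sum>w<M. card {a w..<a w + W}))"
        using win by (intro add_mono card_UN_le fin) auto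
      finally have "n \<le> card Zout + (\<Sum>w\<in>L. card (K w)) + (M + 1) * W" by simp
      then have "4 * M * n \<le> 4 * M * (card Zout + (\<Sum>w\<in>L. card (K w)) + (M + 1) * W)"
        by (rule mult_le_mono2)
      also have "\<dots> = 4 * M * card Zout + (\<Sum>w\<in>L. 4 * M * card (K w)) + M * (4 * (M + 1) * W)"
        by (simp add: algebra_simps sum_distrib_left)
      also have "\<dots> \<le> 4 * M * card Zout + (\<Sum>w\<in>L. n) + M * n"
        using small by (intro add_mono sum_mono K_small mult_le_mono2) auto
      also have "\<dots> < n + (\<Sum>w\<in>L. n) + M * n" using False by simp
      also have "\<dots> = n + (M - 1) * n + M * n" by (simp add: L_def)
      also have "\<dots> = 2 * M * n" using M by (cases M) (auto simp: algebra_simps)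
      finally show False using small M by simp
    qed
    then obtain z where z: "z \<in> L" "n \<le> 4 * M * card (K z)" by blast
    have "K w \<inter> K z = {}" if "w \<in> L - {z}" for w
      using c1[of w] cK[of w z] that z by (metis Diff_iff disjoint_iff singletonI zero_neq_one)
    moreover have "K z \<subseteq> {..<n}" using K_range(3)[OF z(1)] by auto
    moreover have "M - 2 \<le> card (L - {z})" using z(1) by (simp add: L_def)
    moreover have "c w i = 0" if "w \<in> L - {z}" "i \<in> K z" for w i
      using cK[of w z] that z by auto
    ultimately show ?thesis
      using z by (intro exI[of _ "K z"] exI[of _ "L - {z}"]) auto
  qed
  then obtain Z I where ZI: "I \<subseteq> L" "M - 2 \<le> card I" "Z \<subseteq> {..<n}" "n \<le> 4 * M * card Z"
      "\<And>w. w \<in> I \<Longrightarrow> K w \<inter> Z = {}" "\<And>w i. w \<in> I \<Longrightarrow> i \<in> Z \<Longrightarrow> c w i = 0"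
    by blast
  have finI: "finite I" using ZI(1) finite_subset by (auto simp: L_def)
  have "{p. p permutes {..<n} \<and> (\<exists>v. \<forall>w<M. collides k f p v (U w) (F w))}
      \<subseteq> {p. p permutes {..<n} \<and> (\<forall>v\<in>I. lin k n f (c v) p)}"
  proof clarsimp
    fix p v w assume p: "\<forall>w<M. collides k f p v (U w) (F w)" and "w \<in> I"
    then have wM: "w < M" "Suc w < M" using ZI(1) by (auto simp: L_def)
    show "lin k n f (c w) p"
      unfolding c_def using p wM Fn[OF wM(1)] Fn[OF wM(2)] Un[OF wM(1)] Un[OF wM(2)]
      by (intro lin_coefI[where v = v]) (auto simp: collides_def)
  qed
  then have "real (card {p. p permutes {..<n} \<and> (\<exists>v. \<forall>w<M. collides k f p v (U w) (F w))})
      \<le> real (card {p. p permutes {..<n} \<and> (\<forall>v\<in>I. lin k n f (c v) p)})"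
    using finite_permutations[of "{..<n}"] by (intro of_nat_mono card_mono) auto
  also have "\<dots> \<le> \<epsilon> ^ card I * fact n"
  proof (rule card_all_lin_le[where Z = Z and K = K and s = "\<lambda>_. 1", OF f \<epsilon>(1) finI ZI(3)])
    show "K v \<subseteq> {..<n}" if "v \<in> I" for v using K_range(3)[of v] ZI(1) that by blast
    show "c v i = 1" if "v \<in> I" "i \<in> K v" for v i using c1 ZI(1) that by blast
    show "c u i = 0" if "u \<in> I" "v \<in> I" "u < v" "i \<in> K v" for u v i
      using cK[of u v i] ZI(1) that by blast
    show "spread k (card (K v)) \<epsilon> R" if v: "v \<in> I" and R: "R \<subseteq> f ` {..<n}" "card R = card (K v) + card Z" for v R
    proof (rule spread[OF R(1)])
      have "v < M" "Suc v < M" using v ZI(1) by (auto simp: L_def)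
      then show "G - W \<le> card (K v)" using sep[of "Suc v" v] by (simp add: K_def)
    qed (use R ZI(4) in simp_all)
  qed (use ZI in auto)
  also have "\<dots> \<le> \<epsilon> ^ (M - 2) * fact n"
    using \<epsilon> ZI(2) by (intro mult_right_mono power_decreasing) auto
  finally show ?thesis .
qed

lemma card_UN_le_mult:
  fixes N x :: real
  assumes C: "finite C" "real (card C) \<le> N" and x: "x \<ge> 0" and E: "\<And>c. c \<in> C \<Longrightarrow> real (card (E c)) \<le> x"
  shows "real (card (\<Union>c\<in>C. E c)) \<le> N * x"
proof -
  have "real (card (\<Union>c\<in>C. E c)) \<le> real (\<Sum>c\<in>C. card (E c))"
    by (intro of_nat_mono card_UN_le C)
  also have "\<dots> = (\<Sum>c\<in>C. real (card (E c)))" by simp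
  also have "\<dots> \<le> real (card C) * x"
    using sum_bounded_above[of C "\<lambda>c. real (card (E c))" x] E by simp
  also have "\<dots> \<le> N * x" using C x by (intro mult_right_mono) auto
  finally show ?thesis .
qed

section \<open>Union bound over the witnesses of collisions\<close>

definition choices :: "nat set \<Rightarrow> nat \<Rightarrow> nat \<Rightarrow> nat \<Rightarrow> nat \<Rightarrow> (nat \<times> nat set \<times> nat set) set" where
  "choices A b e W hi = (SIGMA a:A. Pow {b..<e} \<times> near_prefixes W hi a)"

lemma card_choices:
  assumes "finite A" "e \<le> b + W"
  shows "finite (choices A b e W hi)" "card (choices A b e W hi) \<le> card A * 4 ^ W"
proof -
  show "finite (choices A b e W hi)"
    using assms by (auto simp: choices_def card_near_prefixes)
  have "card (choices A b e W hi) = (\<Sum>a\<in>A. 2 ^ (e - b) * card (near_prefixes W hi a))"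
    unfolding choices_def using assms
    by (subst card_SigmaI) (auto simp: card_near_prefixes card_cartesian_product card_Pow)
  also have "\<dots> \<le> (\<Sum>a\<in>A. 2 ^ W * 2 ^ W)"
    using assms by (intro sum_mono mult_mono card_near_prefixes power_increasing) auto
  also have "\<dots> = card A * 4 ^ W" by (simp add: power_mult_distrib[symmetric])
  finally show "card (choices A b e W hi) \<le> card A * 4 ^ W" .
qed

lemma card_PiE_choices:
  assumes "finite A" "e \<le> b + W"
  shows "finite (PiE {..<m::nat} (\<lambda>_. choices A b e W hi))"
    "real (card (PiE {..<m} (\<lambda>_. choices A b e W hi))) \<le> (real (card A) * 4 ^ W) ^ m"
proof -
  show "finite (PiE {..<m} (\<lambda>_. choices A b e W hi))"
    using card_choices[OF assms] by (intro finite_PiE) auto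
  have "card (PiE {..<m} (\<lambda>_. choices A b e W hi)) = card (choices A b e W hi) ^ m"
    by (simp add: card_PiE)
  also have "\<dots> \<le> (card A * 4 ^ W) ^ m"
    using card_choices[OF assms] by (intro power_mono) auto
  finally have "real (card (PiE {..<m} (\<lambda>_. choices A b e W hi))) \<le> real ((card A * 4 ^ W) ^ m)"
    by (rule of_nat_mono)
  then show "real (card (PiE {..<m} (\<lambda>_. choices A b e W hi))) \<le> (real (card A) * 4 ^ W) ^ m" by simp
qed

text \<open>The witnesses for many colliding sets \<open>U\<close> either contain \<open>M\<close> far apart prefixes, or they lie
  near fewer than \<open>M\<close> positions; a union bound excludes both for some permutation.\<close>

theorem exists_good_permutation:
  fixes \<epsilon> :: real
  assumes f: "inj_on f {..<n}" "f ` {..<n} \<subseteq> {0..<k}"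
    and small: "4 * W + 4 * G \<le> n" "4 * (M + 1) * W \<le> n" "n > 0" and M: "M \<ge> 2"
    and \<epsilon>: "0 \<le> \<epsilon>" "\<epsilon> \<le> 1"
    and spread: "\<And>R l. R \<subseteq> f ` {..<n} \<Longrightarrow> G - W \<le> l \<Longrightarrow> l \<le> card R \<Longrightarrow> n \<le> 4 * M * (card R - l) \<Longrightarrow> spread k l \<epsilon> R"
    and sum: "real (n + 1) ^ 5 * (real G * 4 ^ W) ^ (M + 1) * (2 / n) ^ M
      + real (n + 1) ^ 4 * (real (n + 1) * 4 ^ W) ^ M * \<epsilon> ^ (M - 2) < 1"
  shows "\<exists>p. p permutes {..<n} \<and> (\<forall>b e lo hi v. e \<le> n \<and> e \<le> b + W \<and> hi \<le> n \<and> (e \<le> lo \<or> hi \<le> b) \<longrightarrow>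
    card {U. U \<subseteq> {b..<e} \<and> (\<exists>a F. lo \<le> a \<and> a \<le> hi \<and> F \<in> near_prefixes W hi a \<and> collides k f p v U F)} \<le> M * 2 ^ M)"
proof -
  let ?P = "{p. p permutes {..<n}}"
  \<comment> \<open>One value \<open>v\<close> has to serve all collisions of the tuple
    \<open>h\<close>. It is quantified inside the event, so the union below runs over tuples
    only.\<close>
  define ev :: "nat \<Rightarrow> (nat \<Rightarrow> nat \<times> nat set \<times> nat set) \<Rightarrow> (nat \<Rightarrow> nat) set" where
    "ev m h = {p. p permutes {..<n} \<and> (\<exists>v. \<forall>w<m. collides k f p v (fst (snd (h w))) (snd (snd (h w))))}" for m h
  define Q where "Q = {(b, e, lo, hi). b \<le> n \<and> e \<le> n \<and> lo \<le> n \<and> hi \<le> n \<and> e \<le> b + W \<and> (e \<le> lo \<or> hi \<le> b)}"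
  \<comment> \<open>Tuples of M + 1 entries, one of which is spent on cancelling \<open>v\<close>;
    \<open>d\<close> marks the stretch of length \<open>G\<close> in which all prefixes begin and
    accounts for the fifth factor n + 1.\<close>
  define Near where "Near = (\<lambda>((b, e, lo, hi), d). {h \<in> PiE {..<M + 1} (\<lambda>_. choices {d..<d + G} b e W hi).
     (\<forall>w\<le>M. lo \<le> fst (h w) \<and> fst (h w) \<le> hi) \<and>
     (\<exists>x. \<forall>v\<le>M. \<forall>u<v. x v \<in> fst (snd (h u)) \<longleftrightarrow> x v \<notin> fst (snd (h v)))})"
  define Far where "Far = (\<lambda>(b, e, lo, hi). {h \<in> PiE {..<M} (\<lambda>_. choices {..n} b e W hi).
     (\<forall>w<M. lo \<le> fst (h w) \<and> fst (h w) \<le> hi) \<and> (\<forall>v<M. \<forall>u<v. fst (h u) + G \<le> fst (h v))})"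
  have Q_sub: "Q \<subseteq> {..n} \<times> {..n} \<times> {..n} \<times> {..n}" by (auto simp: Q_def)
  have finQ: "finite Q" by (rule finite_subset[OF Q_sub]) auto
  have "card Q \<le> card ({..n} \<times> {..n} \<times> {..n} \<times> {..n})"
    by (rule card_mono[OF _ Q_sub]) auto
  then have cQ: "card Q \<le> (n + 1) ^ 4"
    by (simp add: card_cartesian_product numeral_eq_Suc)
  have far_card: "real (card (\<Union>q\<in>Q. \<Union>h\<in>Far q. ev M h)) \<le> real (n + 1) ^ 4 * ((real (n + 1) * 4 ^ W) ^ M * (\<epsilon> ^ (M - 2) * fact n))"
  proof (rule card_UN_le_mult[OF finQ])
    show "real (card Q) \<le> real (n + 1) ^ 4"
      using of_nat_mono[OF cQ, where 'a = real] by simp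
    fix q assume "q \<in> Q"
    then obtain b e lo hi where q: "q = (b, e, lo, hi)" and q': "e \<le> n" "hi \<le> n" "e \<le> b + W" "e \<le> lo \<or> hi \<le> b"
      by (auto simp: Q_def)
    have sub: "Far q \<subseteq> PiE {..<M} (\<lambda>_. choices {..n} b e W hi)" by (auto simp: Far_def q)
    note PiE = card_PiE_choices[OF finite_atMost[of n] q'(3), where m = M and hi = hi]
    show "real (card (\<Union>h\<in>Far q. ev M h)) \<le> (real (n + 1) * 4 ^ W) ^ M * (\<epsilon> ^ (M - 2) * fact n)"
    proof (rule card_UN_le_mult)
      show "finite (Far q)" by (rule finite_subset[OF sub PiE(1)])
      have "real (card (Far q)) \<le> real (card (PiE {..<M} (\<lambda>_. choices {..n} b e W hi)))"
        by (intro of_nat_mono card_mono[OF PiE(1) sub])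
      then show "real (card (Far q)) \<le> (real (n + 1) * 4 ^ W) ^ M" using PiE(2) by simp
      fix h assume h: "h \<in> Far q"
      have hw: "fst (snd (h w)) \<subseteq> {b..<e}" "snd (snd (h w)) \<in> near_prefixes W hi (fst (h w))" if "w < M" for w
      proof -
        have "h w \<in> choices {..n} b e W hi" using h sub that by (auto simp: PiE_iff)
        then show "fst (snd (h w)) \<subseteq> {b..<e}" "snd (snd (h w)) \<in> near_prefixes W hi (fst (h w))"
          by (auto simp: choices_def)
      qed
      show "real (card (ev M h)) \<le> \<epsilon> ^ (M - 2) * fact n"
        unfolding ev_def
        by (rule card_far_collisions[OF f(1) q'(1,3,2,4) small(2,3) M hw(1) _ _ hw(2) \<epsilon> spread])
          (use h in \<open>auto simp: Far_def q\<close>)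
    qed (use \<epsilon> in simp)
  qed (use \<epsilon> in simp)
  have near_card: "real (card (\<Union>q\<in>Q \<times> {..n}. \<Union>h\<in>Near q. ev (M + 1) h)) \<le> real (n + 1) ^ 5 * ((real G * 4 ^ W) ^ (M + 1) * ((2 / n) ^ M * fact n))"
  proof (rule card_UN_le_mult)
    show "finite (Q \<times> {..n})" using finQ by simp
    have "card (Q \<times> {..n}) \<le> (n + 1) ^ 5"
      using mult_le_mono1[OF cQ, of "n + 1"] by (simp add: card_cartesian_product numeral_eq_Suc mult_ac)
    then show "real (card (Q \<times> {..n})) \<le> real (n + 1) ^ 5"
      by (metis of_nat_mono of_nat_power)
    fix qd assume "qd \<in> Q \<times> {..n}"
    then obtain b e lo hi d where q: "qd = ((b, e, lo, hi), d)" and q': "e \<le> n" "hi \<le> n" "e \<le> b + W" "e \<le> lo \<or> hi \<le> b"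
      by (auto simp: Q_def)
    have sub: "Near qd \<subseteq> PiE {..<M + 1} (\<lambda>_. choices {d..<d + G} b e W hi)" by (auto simp: Near_def q)
    note PiE = card_PiE_choices[OF finite_atLeastLessThan[of d "d + G"] q'(3), where m = "M + 1" and hi = hi]
    show "real (card (\<Union>h\<in>Near qd. ev (M + 1) h)) \<le> (real G * 4 ^ W) ^ (M + 1) * ((2 / n) ^ M * fact n)"
    proof (rule card_UN_le_mult)
      show "finite (Near qd)" by (rule finite_subset[OF sub PiE(1)])
      have "real (card (Near qd)) \<le> real (card (PiE {..<M + 1} (\<lambda>_. choices {d..<d + G} b e W hi)))"
        by (intro of_nat_mono card_mono[OF PiE(1) sub])
      then show "real (card (Near qd)) \<le> (real G * 4 ^ W) ^ (M + 1)" using PiE(2) by simp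
      fix h assume h: "h \<in> Near qd"
      have hw: "fst (snd (h w)) \<subseteq> {b..<e}" "snd (snd (h w)) \<in> near_prefixes W hi (fst (h w))"
          "d \<le> fst (h w)" "fst (h w) < d + G" if "w \<le> M" for w
      proof -
        have "h w \<in> choices {d..<d + G} b e W hi" using h sub that by (auto simp: PiE_iff)
        then show "fst (snd (h w)) \<subseteq> {b..<e}" "snd (snd (h w)) \<in> near_prefixes W hi (fst (h w))"
          "d \<le> fst (h w)" "fst (h w) < d + G"
          by (auto simp: choices_def)
      qed
      obtain x where x: "\<forall>v\<le>M. \<forall>u<v. x v \<in> fst (snd (h u)) \<longleftrightarrow> x v \<notin> fst (snd (h v))"
        using h by (auto simp: Near_def q)
      have "real (card {p. p permutes {..<n} \<and> (\<exists>v. \<forall>w\<le>M. collides k f p v (fst (snd (h w))) (snd (snd (h w))))}) \<le> (2 / n) ^ M * fact n"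
      proof (rule card_near_collisions[OF f q'(1,3,2,4) small(1,3) hw(1) _ hw(2), where d = d and x = x])
        fix w assume "w \<le> M"
        then show "lo \<le> fst (h w) \<and> fst (h w) \<le> hi \<and> fst (h w) \<le> d + G \<and> d \<le> fst (h w) + G"
          using h hw(3,4)[of w] by (auto simp: Near_def q)
      qed (assumption | rule x[rule_format])+
      then show "real (card (ev (M + 1) h)) \<le> (2 / n) ^ M * fact n"
        by (simp add: ev_def less_Suc_eq_le)
    qed simp
  qed simp
  define Bad where "Bad = (\<Union>q\<in>Q \<times> {..n}. \<Union>h\<in>Near q. ev (M + 1) h) \<union> (\<Union>q\<in>Q. \<Union>h\<in>Far q. ev M h)"
  have "real (card Bad) \<le> real (card (\<Union>q\<in>Q \<times> {..n}. \<Union>h\<in>Near q. ev (M + 1) h)) + real (card (\<Union>q\<in>Q. \<Union>h\<in>Far q. ev M h))"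
    unfolding Bad_def of_nat_add[symmetric] by (intro of_nat_mono card_Un_le)
  also have "\<dots> \<le> (real (n + 1) ^ 5 * (real G * 4 ^ W) ^ (M + 1) * (2 / n) ^ M
      + real (n + 1) ^ 4 * (real (n + 1) * 4 ^ W) ^ M * \<epsilon> ^ (M - 2)) * fact n"
    unfolding distrib_right using add_mono[OF near_card far_card] by (simp only: mult.assoc)
  also have "\<dots> < 1 * fact n" by (intro mult_strict_right_mono sum) simp
  also have "\<dots> = real (card ?P)" by (simp add: card_permutations)
  finally have "card Bad < card ?P" by simp
  moreover have "finite Bad"
    by (rule finite_subset[OF _ finite_permutations[of "{..<n}"]]) (auto simp: Bad_def ev_def)
  ultimately have "\<not> ?P \<subseteq> Bad" using card_mono[of Bad ?P] by linarith
  then obtain p where p: "p permutes {..<n}" "p \<notin> Bad" by blast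
  have no_near: False if "(b, e, lo, hi) \<in> Q" "d \<le> n" "h \<in> Near ((b, e, lo, hi), d)" "p \<in> ev (M + 1) h" for b e lo hi d h
    using p(2) that unfolding Bad_def by blast
  have no_far: False if "(b, e, lo, hi) \<in> Q" "h \<in> Far (b, e, lo, hi)" "p \<in> ev M h" for b e lo hi h
    using p(2) that unfolding Bad_def by blast
  have "card {U. U \<subseteq> {b..<e} \<and> (\<exists>a F. lo \<le> a \<and> a \<le> hi \<and> F \<in> near_prefixes W hi a \<and> collides k f p v U F)} \<le> M * 2 ^ M"
    if A: "e \<le> n" "e \<le> b + W" "hi \<le> n" "e \<le> lo \<or> hi \<le> b" for b e lo hi v
  proof -
    define hit where "hit U a F \<longleftrightarrow> U \<subseteq> {b..<e} \<and> lo \<le> a \<and> a \<le> hi \<and> F \<in> near_prefixes W hi a \<and> collides k f p v U F" for U a F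
    define J where "J = {a. \<exists>U F. hit U a F}"
    have J_le: "lo \<le> a \<and> a \<le> hi \<and> a \<le> n" if "a \<in> J" for a using that A(3) by (auto simp: J_def hit_def)
    have finJ: "finite J" by (rule finite_subset[of _ "{..n}"]) (use J_le in auto)
    let ?Q = "(b, e, lo, hi)"
    show ?thesis
    proof (cases "b < e \<and> lo \<le> hi")
      \<comment> \<open>Degenerate windows have at most the empty set to count. Once they are set
        aside, \<open>b\<close> and \<open>lo\<close> are at most \<open>n\<close>, so the finite
        set \<open>Q\<close> covers all remaining cases.\<close>
      case False
      have "{U. U \<subseteq> {b..<e} \<and> (\<exists>a F. lo \<le> a \<and> a \<le> hi \<and> F \<in> near_prefixes W hi a \<and> collides k f p v U F)} \<subseteq> {{}}"
        using False by auto
      then have "card {U. U \<subseteq> {b..<e} \<and> (\<exists>a F. lo \<le> a \<and> a \<le> hi \<and> F \<in> near_prefixes W hi a \<and> collides k f p v U F)} \<le> card {{} :: nat set}"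
        by (intro card_mono) auto
      also have "\<dots> \<le> M * 2 ^ M" using M by simp
      finally show ?thesis .
    next
      case True
      have inQ: "?Q \<in> Q" using A True by (auto simp: Q_def)
      have "\<not> (\<exists>a. (\<forall>w<M. a w \<in> J) \<and> (\<forall>v<M. \<forall>u<v. a u + G \<le> a v))"
      proof
        assume "\<exists>a. (\<forall>w<M. a w \<in> J) \<and> (\<forall>v<M. \<forall>u<v. a u + G \<le> a v)"
        then obtain a where a: "\<forall>w<M. a w \<in> J" "\<forall>v<M. \<forall>u<v. a u + G \<le> a v" by blast
        then obtain U F where UF: "\<forall>w<M. hit (U w) (a w) (F w)" unfolding J_def mem_Collect_eq by metis
        define h where "h = restrict (\<lambda>w. (a w, U w, F w)) {..<M}"
        have "h \<in> Far ?Q"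
          using UF a(2) J_le a(1) by (auto simp: Far_def h_def choices_def hit_def)
        moreover have "p \<in> ev M h"
          using UF p(1) by (auto simp: ev_def h_def hit_def intro!: exI[of _ v])
        ultimately show False using no_far[OF inQ] by blast
      qed
      then obtain D where D: "finite D" "card D < M" "\<forall>j\<in>J. \<exists>d\<in>D. d \<le> j \<and> j < d + G"
        using separated_or_covered[OF finJ, of M G] by blast
      define \<U> where "\<U> d = {U. \<exists>a F. hit U a F \<and> d \<le> a \<and> a < d + G}" for d
      have fin\<U>: "finite (\<U> d)" for d
        by (rule finite_subset[of _ "Pow {b..<e}"]) (auto simp: \<U>_def hit_def)
      have card\<U>: "card (\<U> d) \<le> 2 ^ M" for d
      proof (rule ccontr)
        assume "\<not> card (\<U> d) \<le> 2 ^ M"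
        then obtain U x where U: "\<forall>w\<le>M. U w \<in> \<U> d" and x: "\<forall>v\<le>M. \<forall>u<v. x v \<in> U u \<longleftrightarrow> x v \<notin> U v"
          using splitting_sequence[OF fin\<U>, of M d] by auto
        then obtain a F where aF: "\<forall>w\<le>M. hit (U w) (a w) (F w) \<and> d \<le> a w \<and> a w < d + G"
          unfolding \<U>_def mem_Collect_eq by metis
        have "d \<le> n" using aF A(3) by (force simp: hit_def)
        define h where "h = restrict (\<lambda>w. (a w, U w, F w)) {..<M + 1}"
        have h_eq: "h w = (a w, U w, F w)" if "w \<le> M" for w using that by (simp add: h_def)
        have "h \<in> PiE {..<M + 1} (\<lambda>_. choices {d..<d + G} b e W hi)"
          unfolding h_def using aF by (intro restrict_PiE_iff[THEN iffD2]) (auto simp: choices_def hit_def less_Suc_eq_le)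
        moreover have "\<forall>w\<le>M. lo \<le> fst (h w) \<and> fst (h w) \<le> hi"
          using aF by (simp add: h_eq hit_def)
        moreover have "\<forall>v\<le>M. \<forall>u<v. x v \<in> fst (snd (h u)) \<longleftrightarrow> x v \<notin> fst (snd (h v))"
          using x by (simp add: h_eq)
        ultimately have "h \<in> Near (?Q, d)"
          unfolding Near_def prod.case mem_Collect_eq by (intro conjI exI[of _ x])
        moreover have "p \<in> ev (M + 1) h"
          using aF p(1) by (auto simp: ev_def h_eq hit_def less_Suc_eq_le intro!: exI[of _ v])
        ultimately show False using no_near[OF inQ \<open>d \<le> n\<close>] by blast
      qed
      have "{U. U \<subseteq> {b..<e} \<and> (\<exists>a F. lo \<le> a \<and> a \<le> hi \<and> F \<in> near_prefixes W hi a \<and> collides k f p v U F)} \<subseteq> (\<Union>d\<in>D. \<U> d)"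
      proof
        fix U assume "U \<in> {U. U \<subseteq> {b..<e} \<and> (\<exists>a F. lo \<le> a \<and> a \<le> hi \<and> F \<in> near_prefixes W hi a \<and> collides k f p v U F)}"
        then obtain a F where "hit U a F" by (auto simp: hit_def)
        moreover from this have "a \<in> J" by (auto simp: J_def)
        ultimately show "U \<in> (\<Union>d\<in>D. \<U> d)" using D(3) by (fastforce simp: \<U>_def)
      qed
      then have "card {U. U \<subseteq> {b..<e} \<and> (\<exists>a F. lo \<le> a \<and> a \<le> hi \<and> F \<in> near_prefixes W hi a \<and> collides k f p v U F)}
          \<le> card (\<Union>d\<in>D. \<U> d)"
        using D fin\<U> by (intro card_mono) auto
      also have "\<dots> \<le> (\<Sum>d\<in>D. card (\<U> d))" by (rule card_UN_le[OF D(1)])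
      also have "\<dots> \<le> card D * 2 ^ M" using sum_bounded_above[of D "\<lambda>d. card (\<U> d)" "2 ^ M"] card\<U> by simp
      also have "\<dots> \<le> M * 2 ^ M" using D(2) by simp
      finally show ?thesis .
    qed
  qed
  then show ?thesis using p(1) by blast
qed

section \<open>Rearrangement within blocks\<close>

lemma le_binomial: "0 < v \<Longrightarrow> v < N \<Longrightarrow> N \<le> N choose v"
proof (induction N arbitrary: v)
  case (Suc N)
  then obtain u where u: "v = Suc u" by (cases v) auto
  show ?case
  proof (cases "u = 0 \<or> v = N")
    case True
    then show ?thesis using u Suc.prems by auto
  next
    case False
    then have "N \<le> N choose u" "N \<le> N choose v" "0 < N" using Suc u by auto
    then show ?thesis by (simp add: u)
  qed
qed simp

text \<open>Equality holds at v = 2 and at v = N - 1, and Pascal's rule carries the bound through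
  the range between. The factor N - v + 1 is the number of intervals of length v in a block of
  length N.\<close>

lemma mult_le_binomial: "2 \<le> v \<Longrightarrow> v < N \<Longrightarrow> N * (N - v + 1) \<le> 2 * (N choose v)"
proof (induction N arbitrary: v)
  case (Suc N)
  then obtain u where u: "v = Suc u" by (cases v) auto
  consider "u = 1" | "v = N" | "2 \<le> u" "v < N" using Suc.prems u by linarith
  then show ?case
  proof cases
    case 1
    have "Suc N * N = (Suc N choose v) * 2"
      using Suc_times_binomial_eq[of N 1] 1 by (simp add: u)
    then show ?thesis using 1 Suc.prems by (simp add: u)
  next
    case 2
    then show ?thesis by simp
  next
    case 3
    then have IH: "N * (N - u + 1) \<le> 2 * (N choose u)" "N * (N - v + 1) \<le> 2 * (N choose v)"
      using Suc by (auto simp: u)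
    obtain d where d: "N = v + Suc d" using less_imp_Suc_add[OF 3(2)] by auto
    have "Suc N * (Suc N - v + 1) \<le> N * (N - u + 1) + N * (N - v + 1)"
      using 3 by (simp add: d u algebra_simps)
    also have "\<dots> \<le> 2 * (Suc N choose v)" using IH by (simp add: u)
    finally show ?thesis .
  qed
qed simp

text \<open>In a random arrangement of a block of length N, a given proper nonempty set is an
  initial segment with probability at most 1/N, and a given proper set of at least two elements is
  an interval with probability at most 2/N. The assumption on the cardinalities makes these
  probabilities sum to less than 1.\<close>

lemma exists_block_arrangement:
  fixes a e :: nat and \<A> \<I> :: "nat set set"
  assumes fin: "finite \<A>" "finite \<I>"
    and A: "\<And>V. V \<in> \<A> \<Longrightarrow> V \<subseteq> {a..<e} \<and> V \<noteq> {} \<and> V \<noteq> {a..<e}"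
    and I: "\<And>E. E \<in> \<I> \<Longrightarrow> E \<subseteq> {a..<e} \<and> 2 \<le> card E \<and> E \<noteq> {a..<e}"
    and card: "card \<A> + 2 * card \<I> < e - a"
  shows "\<exists>q. q permutes {a..<e} \<and> (\<forall>i\<in>{a..e}. q ` {a..<i} \<notin> \<A>) \<and> (\<forall>i j. a \<le> i \<and> j \<le> e \<longrightarrow> q ` {i..<j} \<notin> \<I>)"
proof -
  define N where "N = e - a"
  let ?Q = "{a..<e}"
  let ?P = "\<lambda>B C. {q. q permutes ?Q \<and> q ` B = C}"
  define bad1 where "bad1 = (\<Union>V\<in>\<A>. ?P {a..<a + card V} V)"
  define bad2 where "bad2 = (\<Union>E\<in>\<I>. \<Union>i\<in>{a..e - card E}. ?P {i..<i + card E} E)"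
  have finP: "finite (?P B C)" for B C
    by (rule finite_subset[OF _ finite_permutations[of ?Q]]) auto
  have proper: "card C < N" if "C \<subseteq> ?Q" "C \<noteq> ?Q" for C
    using psubset_card_mono[of ?Q C] that by (auto simp: N_def)
  have cP: "card (?P B C) * (N choose card C) = fact N" if "C \<subseteq> ?Q" "B \<subseteq> ?Q" "card B = card C" for B C
    using card_permutes_image[of ?Q B C] that card_mono[of ?Q C] binomial_fact_lemma[of "card C" N]
    by (simp add: N_def mult_ac)
  have b1: "N * card bad1 \<le> card \<A> * fact N"
  proof -
    have "N * card (?P {a..<a + card V} V) \<le> fact N" if "V \<in> \<A>" for V
    proof -
      have V: "V \<subseteq> ?Q" "card V < N" "card V > 0"
        using A[OF that] proper[of V] finite_subset[of V ?Q] by (auto simp: card_gt_0_iff)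
      have "N * card (?P {a..<a + card V} V) \<le> (N choose card V) * card (?P {a..<a + card V} V)"
        using le_binomial[OF V(3,2)] by (rule mult_le_mono1)
      also have "\<dots> = fact N"
      proof -
        have "{a..<a + card V} \<subseteq> ?Q" using V(2) by (auto simp: N_def)
        from cP[OF V(1) this] show ?thesis by (simp add: mult.commute)
      qed
      finally show ?thesis .
    qed
    then have s1: "(\<Sum>V\<in>\<A>. N * card (?P {a..<a + card V} V)) \<le> card \<A> * fact N"
      using sum_bounded_above[of \<A> "\<lambda>V. N * card (?P {a..<a + card V} V)" "fact N"] by simp
    have s2: "card bad1 \<le> (\<Sum>V\<in>\<A>. card (?P {a..<a + card V} V))"
      unfolding bad1_def by (rule card_UN_le[OF fin(1)])
    show ?thesis
      using order_trans[OF mult_le_mono2[OF s2, of N, unfolded sum_distrib_left] s1] .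
  qed
  have b2: "N * card bad2 \<le> card \<I> * (2 * fact N)"
  proof -
    have "N * card (\<Union>i\<in>{a..e - card E}. ?P {i..<i + card E} E) \<le> 2 * fact N" if "E \<in> \<I>" for E
    proof -
      have E: "E \<subseteq> ?Q" "card E < N" "2 \<le> card E" using I[OF that] proper[of E] by auto
      have each: "card (?P {i..<i + card E} E) * (N choose card E) = fact N" if "i \<in> {a..e - card E}" for i
        using that E by (intro cP) (auto simp: N_def)
      have "card (\<Union>i\<in>{a..e - card E}. ?P {i..<i + card E} E) \<le> (\<Sum>i\<in>{a..e - card E}. card (?P {i..<i + card E} E))"
        by (rule card_UN_le) simp
      then have "N * card (\<Union>i\<in>{a..e - card E}. ?P {i..<i + card E} E) * (N choose card E)
          \<le> N * (\<Sum>i\<in>{a..e - card E}. card (?P {i..<i + card E} E)) * (N choose card E)"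
        by (intro mult_le_mono1 mult_le_mono2)
      also have "\<dots> = N * (\<Sum>i\<in>{a..e - card E}. card (?P {i..<i + card E} E) * (N choose card E))"
        by (simp only: sum_distrib_right mult.assoc)
      also have "\<dots> = N * (\<Sum>i\<in>{a..e - card E}. fact N)"
        by (simp only: each cong: sum.cong)
      also have "\<dots> = N * (N - card E + 1) * fact N"
      proof -
        have "card {a..e - card E} = N - card E + 1" using E(2) by (auto simp: N_def)
        then show ?thesis by (simp only: sum_constant of_nat_id mult.assoc)
      qed
      also have "\<dots> \<le> 2 * (N choose card E) * fact N"
        by (rule mult_le_mono1[OF mult_le_binomial[OF E(3,2)]])
      finally have "N * card (\<Union>i\<in>{a..e - card E}. ?P {i..<i + card E} E) * (N choose card E)
          \<le> 2 * fact N * (N choose card E)"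
        by (simp only: mult_ac)
      then show ?thesis unfolding mult_le_cancel2 using E(2) by simp
    qed
    then have s1: "(\<Sum>E\<in>\<I>. N * card (\<Union>i\<in>{a..e - card E}. ?P {i..<i + card E} E)) \<le> card \<I> * (2 * fact N)"
      using sum_bounded_above[of \<I> "\<lambda>E. N * card (\<Union>i\<in>{a..e - card E}. ?P {i..<i + card E} E)" "2 * fact N"] by simp
    have s2: "card bad2 \<le> (\<Sum>E\<in>\<I>. card (\<Union>i\<in>{a..e - card E}. ?P {i..<i + card E} E))"
      unfolding bad2_def by (rule card_UN_le[OF fin(2)])
    show ?thesis
      using order_trans[OF mult_le_mono2[OF s2, of N, unfolded sum_distrib_left] s1] .
  qed
  have "N * card (bad1 \<union> bad2) \<le> N * (card bad1 + card bad2)"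
    by (intro mult_le_mono2 card_Un_le)
  also have "\<dots> \<le> (card \<A> + 2 * card \<I>) * fact N"
    using b1 b2 by (simp add: algebra_simps)
  also have "\<dots> < N * fact N"
    using card by (simp add: N_def)
  finally have "card (bad1 \<union> bad2) < fact N" by simp
  also have "fact N = card {q. q permutes ?Q}" by (simp add: card_permutations N_def)
  finally have "\<not> {q. q permutes ?Q} \<subseteq> bad1 \<union> bad2"
    using card_mono[of "bad1 \<union> bad2" "{q. q permutes ?Q}"] finP fin
    by (fastforce simp: bad1_def bad2_def)
  then obtain q where q: "q permutes ?Q" "q \<notin> bad1" "q \<notin> bad2" by blast
  have card_q: "card (q ` B) = card B" for B
    by (rule card_image[OF permutes_inj_on[OF q(1)]])
  show ?thesis
  proof (intro exI[of _ q] conjI ballI allI impI notI q(1))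
    fix i assume "i \<in> {a..e}" "q ` {a..<i} \<in> \<A>"
    then have "q \<in> bad1" unfolding bad1_def using q(1) card_q[of "{a..<i}"]
      by (intro UN_I[of "q ` {a..<i}"]) auto
    then show False using q by blast
  next
    fix i j assume ij: "a \<le> i \<and> j \<le> e" and E: "q ` {i..<j} \<in> \<I>"
    then have c: "2 \<le> j - i" using I[OF E] card_q[of "{i..<j}"] by simp
    have "q \<in> bad2" unfolding bad2_def
    proof (intro UN_I[OF E] UN_I[of i])
      show "i \<in> {a..e - card (q ` {i..<j})}" using ij c card_q[of "{i..<j}"] by auto
      show "q \<in> ?P {i..<i + card (q ` {i..<j})} (q ` {i..<j})" using q(1) c card_q[of "{i..<j}"] by auto
    qed
    then show False using q by blast
  qed
qed

section \<open>Cuts and block permutations for an ordering with few collisions\<close>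

lemma segment_near_prefixes: "a \<le> hi \<Longrightarrow> {..<a} \<in> near_prefixes W hi a"
  by (auto simp: near_prefixes_def)

text \<open>From here on \<open>p\<close> is fixed, as supplied by
  \<open>exists_good_permutation\<close>, and no randomness over all of S is left. The assumption
  \<open>nonzero\<close> records that S avoids 0.\<close>

locale few_collisions =
  fixes k :: int and f :: "nat \<Rightarrow> int" and p :: "nat \<Rightarrow> nat" and n W K :: nat
  assumes p: "p permutes {..<n}"
    and nonzero: "\<And>i. i < n \<Longrightarrow> \<not> k dvd f i"
    and few: "\<And>b e lo hi v. e \<le> n \<Longrightarrow> e \<le> b + W \<Longrightarrow> hi \<le> n \<Longrightarrow> e \<le> lo \<or> hi \<le> b \<Longrightarrow>
      card {U. U \<subseteq> {b..<e} \<and> (\<exists>a F. lo \<le> a \<and> a \<le> hi \<and> F \<in> near_prefixes W hi a \<and> collides k f p v U F)} \<le> K"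
begin

definition X :: "nat set \<Rightarrow> int" where
  "X F = (\<Sum>i\<in>F. f (p i))"

text \<open>The two alternatives for \<open>F\<close> are the prefixes that end before the window
  and those that contain all of it. Together they include every initial segment outside the window
  that can arise when blocks of length at most \<open>W\<close> are permuted.\<close>

definition colliding :: "nat \<Rightarrow> nat \<Rightarrow> nat set set" where
  "colliding b e = {U. U \<subseteq> {b..<e} \<and> (\<exists>a F. (a \<le> b \<and> F \<in> near_prefixes W b a \<or> e \<le> a \<and> a \<le> n \<and> F \<in> near_prefixes W n a)
     \<and> X ({..<b} \<union> U) mod k = X F mod k)}"

lemma X_Un: "U \<subseteq> {b..<e} \<Longrightarrow> X ({..<b} \<union> U) = X {..<b} + X U"
  unfolding X_def by (rule sum.union_disjoint) (auto dest: finite_subset)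

lemma finite_colliding: "finite (colliding b e)"
  by (rule finite_subset[of _ "Pow {b..<e}"]) (auto simp: colliding_def)

lemma card_colliding:
  assumes "b \<le> e" "e \<le> n" "e \<le> b + W"
  shows "card (colliding b e) \<le> 2 * K"
proof -
  let ?B = "\<lambda>lo hi. {U. U \<subseteq> {b..<e} \<and> (\<exists>a F. lo \<le> a \<and> a \<le> hi \<and> F \<in> near_prefixes W hi a \<and> collides k f p (X {..<b}) U F)}"
  have "colliding b e \<subseteq> ?B 0 b \<union> ?B e n"
  proof
    fix U assume "U \<in> colliding b e"
    then obtain a F where U: "U \<subseteq> {b..<e}" "X ({..<b} \<union> U) mod k = X F mod k"
      and aF: "a \<le> b \<and> F \<in> near_prefixes W b a \<or> e \<le> a \<and> a \<le> n \<and> F \<in> near_prefixes W n a"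
      by (auto simp: colliding_def)
    have "collides k f p (X {..<b}) U F"
      using U(2) unfolding X_Un[OF U(1)] by (simp add: collides_def X_def)
    then show "U \<in> ?B 0 b \<union> ?B e n" using aF U(1) by blast
  qed
  moreover have "finite (?B lo hi)" for lo hi
    by (rule finite_subset[of _ "Pow {b..<e}"]) auto
  ultimately have "card (colliding b e) \<le> card (?B 0 b \<union> ?B e n)"
    by (intro card_mono) auto
  also have "\<dots> \<le> card (?B 0 b) + card (?B e n)" by (rule card_Un_le)
  also have "\<dots> \<le> K + K"
    using assms by (intro add_mono few) auto
  finally show ?thesis by simp
qed

text \<open>There are H - 1 candidates \<open>c\<close>, and each one that fails contributes its own
  set \<open>{b..<c}\<close> to the at most 2K colliding sets of the window.\<close>

lemma exists_good_cut:
  assumes "b + H \<le> n" "H \<le> W" "2 * K + 1 < H"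
  shows "\<exists>c. b < c \<and> c < b + H \<and> (\<forall>a\<le>n. a \<le> b \<or> b + H \<le> a \<longrightarrow> X {..<c} mod k \<noteq> X {..<a} mod k)"
proof (rule ccontr)
  assume neg: "\<not> ?thesis"
  have "(\<lambda>c. {b..<c}) ` {b<..<b + H} \<subseteq> colliding b (b + H)"
  proof
    fix U assume "U \<in> (\<lambda>c. {b..<c}) ` {b<..<b + H}"
    then obtain c where c: "b < c" "c < b + H" "U = {b..<c}" by auto
    then obtain a where a: "a \<le> n" "a \<le> b \<or> b + H \<le> a" "X {..<c} mod k = X {..<a} mod k"
      using neg by blast
    have eq: "{..<b} \<union> U = {..<c}" using c by auto
    show "U \<in> colliding b (b + H)"
      unfolding colliding_def mem_Collect_eq eq
      using a c segment_near_prefixes[of a b W] segment_near_prefixes[of a n W]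
      by (intro conjI exI[of _ a] exI[of _ "{..<a}"]) auto
  qed
  then have "card ((\<lambda>c. {b..<c}) ` {b<..<b + H}) \<le> 2 * K"
    using card_mono[OF finite_colliding] card_colliding[of b "b + H"] assms by (meson le_add1 add_left_mono order_trans)
  moreover have "inj_on (\<lambda>c. {b..<c}) {b<..<b + H}"
    by (rule inj_onI) (auto simp: atLeastLessThan_eq_iff)
  ultimately show False using assms by (simp add: card_image)
qed

text \<open>A subset of the block with sum zero collides with the prefix ending where the block
  begins, so there are at most K of these as well; none is a singleton, because S avoids 0. With at
  most 2K colliding sets to avoid as initial segments, the length required by
  \<open>exists_block_arrangement\<close> is 2K + 2K. The empty and the full block are left out:
  their sums belong to the cuts.\<close>

lemma exists_good_block:
  assumes "c \<le> e" "e \<le> n" "e \<le> c + W" "4 * K < e - c"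
  shows "\<exists>q. q permutes {c..<e} \<and> (\<forall>i. c < i \<and> i < e \<longrightarrow> q ` {c..<i} \<notin> colliding c e) \<and>
    (\<forall>i j. c < i \<and> i < j \<and> j < e \<longrightarrow> \<not> k dvd X (q ` {i..<j}))"
proof -
  define \<A> where "\<A> = {V \<in> colliding c e. V \<noteq> {} \<and> V \<noteq> {c..<e}}"
  define \<I> where "\<I> = {E. E \<subseteq> {c..<e} \<and> E \<noteq> {} \<and> E \<noteq> {c..<e} \<and> k dvd X E}"
  have fin: "finite \<A>" "finite \<I>"
    using finite_colliding by (auto simp: \<A>_def \<I>_def)
  have A: "card \<A> \<le> 2 * K"
    using card_mono[OF finite_colliding, of \<A> c e] card_colliding[OF assms(1-3)] by (auto simp: \<A>_def)
  let ?B = "{U. U \<subseteq> {c..<e} \<and> (\<exists>a F. 0 \<le> a \<and> a \<le> c \<and> F \<in> near_prefixes W c a \<and> collides k f p (X {..<c}) U F)}"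
  have "\<I> \<subseteq> ?B"
  proof
    fix E assume E: "E \<in> \<I>"
    then have "collides k f p (X {..<c}) E {..<c}"
      by (auto simp: \<I>_def collides_def X_def[symmetric] mod_add_eq[symmetric, of _ "X E"] dvd_eq_mod_eq_0)
    then show "E \<in> ?B"
      using E segment_near_prefixes[of c c W] by (auto simp: \<I>_def)
  qed
  then have I: "card \<I> \<le> K"
    using few[of e c c 0 "X {..<c}"] assms card_mono[of ?B \<I>] by auto
  have "\<exists>q. q permutes {c..<e} \<and> (\<forall>i\<in>{c..e}. q ` {c..<i} \<notin> \<A>) \<and> (\<forall>i j. c \<le> i \<and> j \<le> e \<longrightarrow> q ` {i..<j} \<notin> \<I>)"
  proof (rule exists_block_arrangement[OF fin])
    show "V \<subseteq> {c..<e} \<and> V \<noteq> {} \<and> V \<noteq> {c..<e}" if "V \<in> \<A>" for V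
      using that by (auto simp: \<A>_def colliding_def)
    show "E \<subseteq> {c..<e} \<and> 2 \<le> card E \<and> E \<noteq> {c..<e}" if "E \<in> \<I>" for E
    proof -
      have E: "E \<subseteq> {c..<e}" "E \<noteq> {}" "E \<noteq> {c..<e}" "k dvd X E" using that by (auto simp: \<I>_def)
      have "card E \<noteq> 1"
      proof
        assume "card E = 1"
        then obtain y where y: "E = {y}" by (auto simp: card_1_singleton_iff)
        then have "y < n" using E assms by auto
        then have "p y < n" using permutes_in_image[OF p, of y] by simp
        then show False using nonzero[of "p y"] E y by (simp add: X_def)
      qed
      moreover have "card E \<noteq> 0" using E finite_subset[of E "{c..<e}"] by simp
      ultimately show ?thesis using E by linarith
    qed
    show "card \<A> + 2 * card \<I> < e - c" using A I assms by linarith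
  qed
  then obtain q where q: "q permutes {c..<e}" "\<And>i. i \<in> {c..e} \<Longrightarrow> q ` {c..<i} \<notin> \<A>"
    "\<And>i j. c \<le> i \<Longrightarrow> j \<le> e \<Longrightarrow> q ` {i..<j} \<notin> \<I>" by blast
  have cq: "card (q ` B) = card B" for B by (rule card_image[OF permutes_inj_on[OF q(1)]])
  have sub: "q ` B \<subseteq> {c..<e}" if "B \<subseteq> {c..<e}" for B
    using permutes_image[OF q(1)] that by blast
  have proper: "q ` B \<noteq> {c..<e}" if "card B < e - c" for B
    using cq[of B] that by auto
  show ?thesis
  proof (intro exI[of _ q] conjI allI impI q(1))
    fix i assume i: "c < i \<and> i < e"
    then have "card {c..<i} < e - c" unfolding card_atLeastLessThan by linarith
    with i show "q ` {c..<i} \<notin> colliding c e"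
      using q(2)[of i] proper[of "{c..<i}"] by (auto simp: \<A>_def)
  next
    fix i j assume ij: "c < i \<and> i < j \<and> j < e"
    then have "card {i..<j} < e - c" unfolding card_atLeastLessThan by linarith
    with ij show "\<not> k dvd X (q ` {i..<j})"
      using q(3)[of i j] proper[of "{i..<j}"] sub[of "{i..<j}"] by (auto simp: \<I>_def)
  qed
qed

text \<open>Cuts are sought in slots of length \<open>H\<close> whose left ends are spaced by
  \<open>2 * H\<close> and counted back from \<open>n\<close>. Consecutive cuts after the first are
  then between H and 3H apart. The remainder of the division falls into the first block, whose
  length may approach 5H; this is the origin of \<open>W = 5 * H\<close>.\<close>

lemma exists_cuts:
  assumes W: "W = 5 * H" and H: "4 * K + 2 < H" and n: "2 * H \<le> n"
  obtains c m where "c 0 = 0" "c m = n" "\<And>s. s < m \<Longrightarrow> c s + H \<le> c (Suc s) \<and> c (Suc s) \<le> c s + W"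
    "\<And>s t. 0 < s \<Longrightarrow> s < t \<Longrightarrow> t \<le> m \<Longrightarrow> X {..<c s} mod k \<noteq> X {..<c t} mod k"
proof -
  define m where "m = n div (2 * H)"
  have H0: "H > 0" using H by simp
  have m: "m * (2 * H) \<le> n" "n < (m + 1) * (2 * H)" "m > 0"
    using H0 n dividend_less_div_times[of "2 * H" n] by (auto simp: m_def div_greater_zero_iff)
  define base where "base i = n - (m - i) * (2 * H)" for i
  have base_le: "(m - i) * (2 * H) \<le> n" for i
    using order_trans[OF mult_le_mono1[of "m - i" m "2 * H"] m(1)] by simp
  have base_Suc: "base (Suc i) = base i + 2 * H" if i: "i < m" for i
  proof -
    obtain d where "m - i = Suc d" "m - Suc i = d" using i by (cases "m - i") auto
    then show ?thesis using base_le[of i] by (simp add: base_def)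
  qed
  have base_m: "base m = n" by (simp add: base_def)
  have base_0: "base 0 < 2 * H" using m by (simp add: base_def algebra_simps)
  have base_mono: "base i + (j - i) * (2 * H) = base j" if "i \<le> j" "j \<le> m" for i j
    using that
  proof (induction j)
    case (Suc j)
    then show ?case using base_Suc[of j] by (cases "i = Suc j") (auto simp: Suc_diff_le)
  qed simp
  have "\<exists>g. \<forall>i. i < m \<longrightarrow> base i < g i \<and> g i < base i + H \<and>
      (\<forall>a\<le>n. a \<le> base i \<or> base i + H \<le> a \<longrightarrow> X {..<g i} mod k \<noteq> X {..<a} mod k)"
  proof (intro choice allI)
    fix i
    show "\<exists>y. i < m \<longrightarrow> base i < y \<and> y < base i + H \<and>
      (\<forall>a\<le>n. a \<le> base i \<or> base i + H \<le> a \<longrightarrow> X {..<y} mod k \<noteq> X {..<a} mod k)"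
    proof (cases "i < m")
      case True
      have "base i + 2 * H \<le> base m"
        using base_Suc[OF True] base_mono[of "Suc i" m] True by linarith
      then have "base i + H \<le> n" using base_m by linarith
      then show ?thesis using exists_good_cut[of "base i" H] W H by auto
    qed simp
  qed
  then obtain g where g: "\<And>i. i < m \<Longrightarrow> base i < g i" "\<And>i. i < m \<Longrightarrow> g i < base i + H"
      "\<And>i a. i < m \<Longrightarrow> a \<le> n \<Longrightarrow> a \<le> base i \<or> base i + H \<le> a \<Longrightarrow> X {..<g i} mod k \<noteq> X {..<a} mod k"
    by metis
  \<comment> \<open>The ends 0 and \<open>n\<close> are cuts without a search. The empty sum is not
    among those compared, and a collision with the total sum is excluded by the choice of the other
    cut.\<close>
  define c where "c i = (if i = 0 then 0 else if i < m then g i else n)" for i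
  have c_range: "base i \<le> c i" "c i < base i + H" if "0 < i" "i \<le> m" for i
    using that g[of i] base_m H0 by (auto simp: c_def le_less)
  show thesis
  proof
    show "c 0 = 0" "c m = n" using m by (auto simp: c_def)
    show "c s + H \<le> c (Suc s) \<and> c (Suc s) \<le> c s + W" if s: "s < m" for s
    proof (cases "s = 0")
      case True
      then show ?thesis
        using c_range[of 1] base_Suc[of 0] base_0 m(3) W by (auto simp: c_def[of 0])
    next
      case False
      then show ?thesis
        using c_range[of s] c_range[of "Suc s"] base_Suc[OF s] s W by auto
    qed
    show "X {..<c s} mod k \<noteq> X {..<c t} mod k" if st: "0 < s" "s < t" "t \<le> m" for s t
    proof -
      have "base s + 2 * H \<le> base t"
      proof -
        have "1 * (2 * H) \<le> (t - s) * (2 * H)" by (rule mult_le_mono1) (use st in simp)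
        moreover have "base s + (t - s) * (2 * H) = base t" by (rule base_mono) (use st in auto)
        ultimately show ?thesis by linarith
      qed
      then have "base s + H \<le> c t" using c_range[of t] st by linarith
      moreover have "base t \<le> n" by (simp add: base_def)
      moreover have "c t \<le> n"
      proof (cases "t < m")
        case True
        then have "base t + 2 * H \<le> base m"
          using base_Suc[OF True] base_mono[of "Suc t" m] by linarith
        then show ?thesis using c_range[of t] st base_m by linarith
      qed (use st in \<open>auto simp: c_def\<close>)
      ultimately show ?thesis using g(3)[of s "c t"] st by (simp add: c_def[of s])
    qed
  qed
qed

text \<open>Permuting the blocks leaves the initial segments at cuts unchanged, so sums at two cuts
  differ by the choice of the cuts. A position inside a block is distinguished from every position
  outside the open block because its initial segment within the block is not colliding. Two
  positions inside one block differ by the sum over an interval of the permuted block, which is not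
  zero.\<close>

theorem exists_distinct_prefix_sums:
  assumes W: "W = 5 * H" and H: "4 * K + 2 < H" and n: "2 * H \<le> n"
  shows "\<exists>q. q permutes {..<n} \<and>
    (\<forall>i j. 0 < i \<and> i < j \<and> j \<le> n \<longrightarrow> (\<Sum>x<i. f (q x)) mod k \<noteq> (\<Sum>x<j. f (q x)) mod k)"
proof -
  obtain c m where c: "c 0 = 0" "c m = n"
      and c_step: "\<And>s. s < m \<Longrightarrow> c s + H \<le> c (Suc s) \<and> c (Suc s) \<le> c s + W"
      and c_sums: "\<And>s t. 0 < s \<Longrightarrow> s < t \<Longrightarrow> t \<le> m \<Longrightarrow> X {..<c s} mod k \<noteq> X {..<c t} mod k"
    using exists_cuts[OF assms] by metis
  have c_mono: "c s \<le> c t" if "s \<le> t" "t \<le> m" for s t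
    using that
  proof (induction t)
    case (Suc t)
    then show ?case using c_step[of t] by (cases "s = Suc t") auto
  qed simp
  have c_le: "c s \<le> n" if "s \<le> m" for s using c_mono[OF that] c by simp
  have "\<exists>\<tau>. \<forall>s. s < m \<longrightarrow> \<tau> s permutes {c s..<c (Suc s)} \<and>
      (\<forall>i. c s < i \<and> i < c (Suc s) \<longrightarrow> \<tau> s ` {c s..<i} \<notin> colliding (c s) (c (Suc s))) \<and>
      (\<forall>i j. c s < i \<and> i < j \<and> j < c (Suc s) \<longrightarrow> \<not> k dvd X (\<tau> s ` {i..<j}))"
  proof (intro choice allI)
    fix s
    show "\<exists>q. s < m \<longrightarrow> q permutes {c s..<c (Suc s)} \<and>
      (\<forall>i. c s < i \<and> i < c (Suc s) \<longrightarrow> q ` {c s..<i} \<notin> colliding (c s) (c (Suc s))) \<and>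
      (\<forall>i j. c s < i \<and> i < j \<and> j < c (Suc s) \<longrightarrow> \<not> k dvd X (q ` {i..<j}))"
    proof (cases "s < m")
      case True
      have "\<exists>q. q permutes {c s..<c (Suc s)} \<and>
        (\<forall>i. c s < i \<and> i < c (Suc s) \<longrightarrow> q ` {c s..<i} \<notin> colliding (c s) (c (Suc s))) \<and>
        (\<forall>i j. c s < i \<and> i < j \<and> j < c (Suc s) \<longrightarrow> \<not> k dvd X (q ` {i..<j}))"
        using c_step[OF True] c_le[of "Suc s"] True H by (intro exists_good_block) auto
      then show ?thesis by (rule ex_forward) (intro impI)
    qed simp
  qed
  then obtain \<tau> where \<tau>: "\<And>s. s < m \<Longrightarrow> \<tau> s permutes {c s..<c (Suc s)}"
      and \<tau>_prefix: "\<And>s i. s < m \<Longrightarrow> c s < i \<Longrightarrow> i < c (Suc s) \<Longrightarrow> \<tau> s ` {c s..<i} \<notin> colliding (c s) (c (Suc s))"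
      and \<tau>_inner: "\<And>s i j. s < m \<Longrightarrow> c s < i \<Longrightarrow> i < j \<Longrightarrow> j < c (Suc s) \<Longrightarrow> \<not> k dvd X (\<tau> s ` {i..<j})"
    by metis
  define idx where "idx i = (LEAST s. i < c (Suc s))" for i
  define \<pi> where "\<pi> i = (if i < n then \<tau> (idx i) i else i)" for i
  have idx: "idx i = s" if "s < m" "c s \<le> i" "i < c (Suc s)" for s i
    unfolding idx_def
  proof (rule Least_equality)
    fix t assume "i < c (Suc t)"
    show "s \<le> t"
    proof (rule ccontr)
      assume "\<not> s \<le> t"
      then have "c (Suc t) \<le> c s" using c_mono[of "Suc t" s] that by simp
      then show False using \<open>i < c (Suc t)\<close> that by simp
    qed
  qed (rule that(3))
  have block: "\<exists>s<m. c s \<le> i \<and> i < c (Suc s)" if "i < n" for i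
  proof -
    have ex: "i < c (Suc (m - 1))" "m > 0" using that c by (cases m; auto)+
    have "i < c (Suc (idx i))" unfolding idx_def by (rule LeastI[of "\<lambda>s. i < c (Suc s)", OF ex(1)])
    moreover have "idx i \<le> m - 1" unfolding idx_def by (rule Least_le[of "\<lambda>s. i < c (Suc s)", OF ex(1)])
    moreover have "c (idx i) \<le> i"
    proof (cases "idx i")
      case (Suc t)
      then have "t < (LEAST s. i < c (Suc s))" by (simp add: idx_def)
      then have "\<not> i < c (Suc t)" by (rule not_less_Least)
      then show ?thesis using Suc by simp
    qed (simp add: c)
    ultimately show ?thesis using ex by (intro exI[of _ "idx i"]) auto
  qed
  have \<pi>_block: "\<pi> ` B = \<tau> s ` B" if "s < m" "B \<subseteq> {c s..<c (Suc s)}" for s B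
  proof (rule image_cong[OF refl])
    fix i assume "i \<in> B"
    then have "c s \<le> i" "i < c (Suc s)" using that by auto
    then show "\<pi> i = \<tau> s i" using idx[OF that(1)] c_le[of "Suc s"] that(1) by (simp add: \<pi>_def)
  qed
  have \<pi>_cut: "\<pi> ` {..<c s} = {..<c s}" if "s \<le> m" for s
    using that
  proof (induction s)
    case (Suc s)
    have "{..<c (Suc s)} = {..<c s} \<union> {c s..<c (Suc s)}" using c_step[of s] Suc by auto
    then show ?case
      using Suc \<pi>_block[of s "{c s..<c (Suc s)}"] permutes_image[OF \<tau>[of s]] by (simp add: image_Un)
  qed (simp add: c)
  have \<pi>_perm: "\<pi> permutes {..<n}"
  proof (rule bij_imp_permutes)
    have "\<pi> ` {..<n} = {..<n}" using \<pi>_cut[of m] c by simp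
    then show "bij_betw \<pi> {..<n} {..<n}"
      by (simp add: bij_betw_def eq_card_imp_inj_on)
  qed (simp add: \<pi>_def)
  define G where "G i = \<pi> ` {..<i}" for i
  have G_cut: "G (c s) = {..<c s}" if "s \<le> m" for s using \<pi>_cut[OF that] by (simp add: G_def)
  have G_mono: "i \<le> j \<Longrightarrow> G i \<subseteq> G j" for i j by (auto simp: G_def)
  have G_block: "G i = {..<c s} \<union> \<tau> s ` {c s..<i}" if "s < m" "c s \<le> i" "i \<le> c (Suc s)" for s i
  proof -
    have "{..<i} = {..<c s} \<union> {c s..<i}" using that by auto
    then have "G i = G (c s) \<union> \<pi> ` {c s..<i}" by (simp add: G_def image_Un)
    then show ?thesis using G_cut[of s] \<pi>_block[of s "{c s..<i}"] that by simp
  qed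
  \<comment> \<open>The last cut at or before \<open>i\<close> makes \<open>G i\<close> a near
    prefix. Its maximality is recorded because an \<open>i\<close> beyond a block must also have its
    cut beyond that block. The position \<open>n\<close> lies in no block and is a cut
    itself.\<close>
  have G_near: "\<exists>t\<le>m. c t \<le> i \<and> (\<forall>r\<le>m. c r \<le> i \<longrightarrow> c r \<le> c t) \<and> G i \<subseteq> {..<c t + W} \<and> {..<c t} \<subseteq> G i" if i: "i \<le> n" for i
  proof (cases "i = n")
    case True
    then show ?thesis using c c_le G_cut[of m] by (intro exI[of _ m]) auto
  next
    case False
    then obtain t where t: "t < m" "c t \<le> i" "i < c (Suc t)" using block[of i] i by auto
    have "c r \<le> c t" if "r \<le> m" "c r \<le> i" for r
      using that t c_mono[of "Suc t" r] c_mono[of r t] by (cases "r \<le> t") auto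
    moreover have "G i \<subseteq> {..<c t + W}"
      using G_mono[of i "c (Suc t)"] G_cut[of "Suc t"] c_step[of t] t by auto
    moreover have "{..<c t} \<subseteq> G i" using G_mono[of "c t" i] G_cut[of t] t by simp
    ultimately show ?thesis using t by (intro exI[of _ t]) auto
  qed
  have inner: "X (G i) mod k \<noteq> X (G j) mod k"
    if s: "s < m" and i: "c s < i" "i < c (Suc s)" and j: "j \<le> n" "j \<le> c s \<or> c (Suc s) \<le> j" for s i j
  proof
    assume eq: "X (G i) mod k = X (G j) mod k"
    obtain t where t: "t \<le> m" "c t \<le> j" "\<And>r. r \<le> m \<Longrightarrow> c r \<le> j \<Longrightarrow> c r \<le> c t" "G j \<subseteq> {..<c t + W}" "{..<c t} \<subseteq> G j"
      using G_near[OF j(1)] by blast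
    have Gi: "G i = {..<c s} \<union> \<tau> s ` {c s..<i}" using G_block[of s i] s i by simp
    have "(c t \<le> c s \<and> G j \<in> near_prefixes W (c s) (c t)) \<or> (c (Suc s) \<le> c t \<and> c t \<le> n \<and> G j \<in> near_prefixes W n (c t))"
      using j(2)
    proof
      assume "j \<le> c s"
      then show ?thesis
        using t G_mono[of j "c s"] G_cut[of s] s by (auto simp: near_prefixes_def)
    next
      assume "c (Suc s) \<le> j"
      then show ?thesis
        using t G_mono[of j n] G_cut[of m] c c_le[of t] t(3)[of "Suc s"] s j by (auto simp: near_prefixes_def)
    qed
    moreover have "\<tau> s ` {c s..<i} \<subseteq> {c s..<c (Suc s)}"
      using permutes_image[OF \<tau>[OF s]] i by auto
    ultimately have "\<tau> s ` {c s..<i} \<in> colliding (c s) (c (Suc s))"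
      unfolding colliding_def mem_Collect_eq using eq[unfolded Gi] by (intro conjI exI[of _ "c t"] exI[of _ "G j"])
    then show False using \<tau>_prefix[OF s i] by blast
  qed
  have X_G: "X (G i) = (\<Sum>x<i. f (p (\<pi> x)))" for i
    unfolding X_def G_def using permutes_inj_on[OF \<pi>_perm] by (simp add: sum.reindex)
  have "X (G i) mod k \<noteq> X (G j) mod k" if ij: "0 < i" "i < j" "j \<le> n" for i j
  proof -
    have cut: "\<exists>s\<le>m. i = c s" if "i \<le> n" "\<not> (\<exists>s<m. c s < i \<and> i < c (Suc s))" for i
    proof (cases "i = n")
      case False
      then obtain s where "s < m" "c s \<le> i" "i < c (Suc s)" using block[of i] \<open>i \<le> n\<close> by auto
      then have "i = c s" using that(2) le_neq_implies_less by blast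
      then show ?thesis using \<open>s < m\<close> by (intro exI[of _ s]) simp
    next
      case True
      then show ?thesis using c by (intro exI[of _ m]) simp
    qed
    show ?thesis
    proof (cases "\<exists>s<m. c s < i \<and> i < c (Suc s)")
      case True
      then obtain s where s: "s < m" "c s < i" "i < c (Suc s)" by blast
      show ?thesis
      proof (cases "c (Suc s) \<le> j")
        case False
        have "X (G j) = X (G i) + (\<Sum>x\<in>{i..<j}. f (p (\<pi> x)))"
          unfolding X_G lessThan_atLeast0 using ij by (simp add: sum.atLeastLessThan_concat)
        also have "(\<Sum>x\<in>{i..<j}. f (p (\<pi> x))) = X (\<pi> ` {i..<j})"
          unfolding X_def using permutes_inj_on[OF \<pi>_perm] by (simp add: sum.reindex)
        also have "\<pi> ` {i..<j} = \<tau> s ` {i..<j}"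
          using s False by (intro \<pi>_block) auto
        finally have eq: "X (G j) = X (G i) + X (\<tau> s ` {i..<j})" .
        show ?thesis
        proof
          assume "X (G i) mod k = X (G j) mod k"
          then have "k dvd X (G j) - X (G i)" by (metis mod_eq_dvd_iff)
          then show False using \<tau>_inner[OF s(1,2) ij(2)] False eq by simp
        qed
      qed (use inner[OF s ij(3)] in blast)
    next
      case False
      then obtain s where s: "s \<le> m" "i = c s" using cut[of i] ij by auto
      show ?thesis
      proof (cases "\<exists>t<m. c t < j \<and> j < c (Suc t)")
        case True
        then obtain t where t: "t < m" "c t < j" "j < c (Suc t)" by blast
        have "s \<le> t"
        proof (rule ccontr)
          assume "\<not> s \<le> t"
          then have "c (Suc t) \<le> c s" using c_mono[of "Suc t" s] s by simp
          then show False using t s ij by simp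
        qed
        then have "i \<le> c t" using c_mono[of s t] t s by simp
        then show ?thesis using inner[OF t, of i] ij by fastforce
      next
        case False
        then obtain t where t: "t \<le> m" "j = c t" using cut[of j] ij by auto
        have "s < t"
        proof (rule ccontr)
          assume "\<not> s < t"
          then have "c t \<le> c s" using c_mono[of t s] s by simp
          then show False using t s ij by simp
        qed
        moreover have "0 < s" using s ij c by (cases s) auto
        ultimately show ?thesis
          using c_sums[of s t] t s G_cut by simp
      qed
    qed
  qed
  then show ?thesis
    unfolding X_G using permutes_compose[OF \<pi>_perm p] by (intro exI[of _ "p \<circ> \<pi>"]) simp
qed

end

section \<open>Choice of the parameters\<close>

text \<open>The choice \<Lambda> = n^(1+\<beta>) makes \<open>1 / sqrt \<Lambda>\<close> smaller
  than n^(-1/2) by the factor n^(-\<beta>/2), while 2\<Lambda> stays below the divisors of k above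
  T. Half of the bound n/(4M) on \<open>card R - l\<close> goes into \<open>n1\<close>, the other
  half pays for the removed pairs. As \<gamma> has order n^(-2\<beta>) and the number of pairs has
  order n^(1-\<beta>), the power of 1 - \<gamma> falls below 1/n. The square root of
  \<open>card R\<close> over \<open>card R - l\<close> contributes the remaining n^(-1/2).\<close>

lemma spread_random_subset_sum:
  fixes T \<alpha> \<beta> :: real and n M W G l :: nat and k :: int
  assumes \<beta>: "0 < \<beta>" "\<beta> \<le> 1 / 8" and M: "M > 0" and n: "n > 0"
    and large: "2 * T \<le> n / (8 * M)" "2 * n powr (1 + \<beta>) \<le> n powr (1 + \<alpha>)"
      "n powr (1 - \<beta>) \<le> n / (4 * M)" "W < 3 / 4 * (n powr (1 - \<beta>) - 1)"
      "ln n \<le> n powr (- 2 * \<beta>) / ((512 * M)\<^sup>2 * 16) * ((n powr (1 - \<beta>) - 8) / 4)"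
    and G: "G = nat \<lfloor>n powr (1 - \<beta>)\<rfloor>"
    and k: "k > 0" and subgroups: "\<And>d. d dvd nat k \<Longrightarrow> T < real d \<Longrightarrow> n powr (1 + \<alpha>) \<le> real d"
    and R: "R \<subseteq> {0..<k}" "card R \<le> n" "G - W \<le> l" "l \<le> card R" "n \<le> 4 * M * (card R - l)"
  shows "spread k l (8 * real M * n powr (- 1 - \<beta> / 2)) R"
proof -
  define \<Lambda> where "\<Lambda> = n powr (1 + \<beta>)"
  define n1 where "n1 = n / (8 * real M)"
  define \<gamma> where "\<gamma> = (n1 / (64 * \<Lambda>))\<^sup>2 / 16"
  define m where "m = G div 4"
  have n1: "n1 > 0" "2 * T \<le> n1" using n M large(1) by (auto simp: n1_def)
  have "n1 \<le> real n" using n M by (simp add: n1_def field_simps)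
  also have "real n \<le> \<Lambda>" using n \<beta> powr_mono[of 1 "1 + \<beta>" "real n"] by (simp add: \<Lambda>_def)
  finally have n1\<Lambda>: "n1 \<le> \<Lambda>" .
  have \<Lambda>: "\<Lambda> > 0" using n by (simp add: \<Lambda>_def)
  have G_le: "real G \<le> n powr (1 - \<beta>)" and G_ge: "n powr (1 - \<beta>) - 1 < real G"
    unfolding G by simp_all
  have m: "real m \<le> real G / 4" "real G / 4 - 1 \<le> real m" unfolding m_def by linarith+
  have ql: "real n / (4 * M) \<le> real (card R - l)"
    using of_nat_mono[OF R(5), where 'a = real] M by (simp add: field_simps)
  then have ql': "2 * n1 \<le> real (card R) - real l" using R(4) by (simp add: n1_def of_nat_diff)
  have G_n1: "real G \<le> 2 * n1" using G_le large(3) by (simp add: n1_def)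
  have "3 / 4 * (n powr (1 - \<beta>) - 1) < 3 / 4 * real G" using G_ge by simp
  with large(4) have "real W < 3 / 4 * real G" by (rule less_trans)
  moreover have "real G \<le> real l + real W" using R(3) by linarith
  ultimately have m_l: "m < l" using m by linarith
  have l_m: "l + m \<le> card R" using m(1) G_n1 ql' n1(1) by linarith
  have n1_m: "n1 + 2 * real m \<le> real (card R)" using m(1) G_n1 ql' n1(1) by linarith
  have spread: "spread k l ((1 / sqrt \<Lambda> + (1 - \<gamma>) ^ m) * sqrt (card R) / (card R - l + 1)) R"
  proof (rule spread_large[OF k n1 n1\<Lambda> _ \<gamma>_def R(1) m_l l_m n1_m])
    show "2 * \<Lambda> \<le> real d" if "d dvd nat k" "T < real d" for d
      using subgroups[OF that] large(2) by (simp add: \<Lambda>_def)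
  qed
  have \<gamma>: "\<gamma> = n powr (- 2 * \<beta>) / ((512 * M)\<^sup>2 * 16)"
  proof -
    have "n1 / (64 * \<Lambda>) = n powr (- \<beta>) / (512 * M)"
      using n by (simp add: n1_def \<Lambda>_def powr_add powr_minus field_simps)
    moreover have "(n powr (- \<beta>))\<^sup>2 = n powr (- 2 * \<beta>)"
      using n by (simp add: power2_eq_square powr_add[symmetric])
    ultimately show ?thesis by (simp add: \<gamma>_def power_divide)
  qed
  have "n1 / (64 * \<Lambda>) \<le> 1" using n1 n1\<Lambda> \<Lambda> by (simp add: field_simps)
  then have "(n1 / (64 * \<Lambda>))\<^sup>2 \<le> 1" using n1 \<Lambda> by (intro power_le_one) auto
  then have \<gamma>01: "0 \<le> \<gamma>" "\<gamma> \<le> 1" by (auto simp: \<gamma>_def)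
  have "ln n \<le> \<gamma> * ((n powr (1 - \<beta>) - 8) / 4)"
    using large(5) unfolding \<gamma> .
  also have "\<dots> \<le> \<gamma> * real m"
  proof (rule mult_left_mono[OF _ \<gamma>01(1)])
    have "(n powr (1 - \<beta>) - 8) / 4 \<le> (real G - 4) / 4" using G_ge by simp
    also have "\<dots> \<le> real m" using m(2) by simp
    finally show "(n powr (1 - \<beta>) - 8) / 4 \<le> real m" .
  qed
  finally have "exp (- (\<gamma> * real m)) \<le> exp (- ln n)" by simp
  have "(1 - \<gamma>) ^ m \<le> exp (- \<gamma>) ^ m"
    using \<gamma>01 exp_ge_add_one_self[of "- \<gamma>"] by (intro power_mono) auto
  also have "\<dots> = exp (- (\<gamma> * real m))" by (simp add: exp_of_nat_mult[symmetric] mult.commute)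
  also note \<open>exp (- (\<gamma> * real m)) \<le> exp (- ln n)\<close>
  also have "exp (- ln n) = n powr (- 1)" using n by (simp add: powr_def)
  also have "\<dots> \<le> n powr (- 1 / 2 - \<beta> / 2)" using n \<beta> by (intro powr_mono) auto
  finally have decay: "(1 - \<gamma>) ^ m \<le> n powr (- 1 / 2 - \<beta> / 2)" .
  have "sqrt \<Lambda> = n powr (1 / 2 + \<beta> / 2)"
    using n by (simp add: \<Lambda>_def powr_half_sqrt[symmetric] powr_powr add_divide_distrib)
  then have inv_sqrt: "1 / sqrt \<Lambda> = n powr (- 1 / 2 - \<beta> / 2)"
    using powr_minus_divide[of "real n" "1 / 2 + \<beta> / 2"] by simp
  have "(1 / sqrt \<Lambda> + (1 - \<gamma>) ^ m) * sqrt (card R) / (card R - l + 1)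
      \<le> (2 * n powr (- 1 / 2 - \<beta> / 2)) * n powr (1 / 2) / (real n / (4 * real M))"
  proof (intro frac_le mult_mono)
    show "1 / sqrt \<Lambda> + (1 - \<gamma>) ^ m \<le> 2 * n powr (- 1 / 2 - \<beta> / 2)"
      using decay inv_sqrt by simp
    show "sqrt (real (card R)) \<le> real n powr (1 / 2)" using R(2) n by (simp add: powr_half_sqrt)
    show "real n / (4 * real M) \<le> real (card R - l + 1)" using ql by simp
  qed (use n M in auto)
  also have "\<dots> = 8 * real M * (n powr (- 1 / 2 - \<beta> / 2) * n powr (1 / 2) * n powr (- 1))"
    using n M by (simp add: powr_minus field_simps)
  also have "n powr (- 1 / 2 - \<beta> / 2) * n powr (1 / 2) * n powr (- 1) = n powr (- 1 - \<beta> / 2)"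
    unfolding powr_add[symmetric] by (rule arg_cong[where f = "\<lambda>z. real n powr z"]) simp
  finally show ?thesis by (rule spread_mono[OF spread])
qed

text \<open>Each near witness costs n^(1-\<beta>) positions against a probability of order 1/n, and
  each far one costs n against n^(-1-\<beta>/2). Hence every further witness gains a fixed power of
  n, and the 6 collects the parameters of the window and the equations lost to subtraction and to
  the reservoir.\<close>

lemma union_bound_exponents:
  fixes \<beta> :: real and n M W G :: nat
  assumes n: "n > 0" and M: "M \<ge> 2" and G: "real G \<le> n powr (1 - \<beta>)"
  shows "real (n + 1) ^ 5 * (real G * 4 ^ W) ^ (M + 1) * (2 / n) ^ M
      \<le> (2 ^ 5 * (4 ^ W) ^ (M + 1) * 2 ^ M) * n powr (6 - \<beta> * (M + 1))"
    and "real (n + 1) ^ 4 * (real (n + 1) * 4 ^ W) ^ M * (8 * real M * n powr (- 1 - \<beta> / 2)) ^ (M - 2)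
      \<le> (2 ^ 4 * (2 * 4 ^ W) ^ M * (8 * real M) ^ (M - 2)) * n powr (6 - \<beta> / 2 * (real M - 2))"
proof -
  have n2: "real (n + 1) \<le> 2 * n" using n by simp
  have pw: "(n powr x) ^ j = n powr (x * j)" for x j
    using n by (simp add: powr_realpow[symmetric] powr_powr)
  have pn: "real n ^ j = n powr j" for j using n by (simp add: powr_realpow)
  have "real (n + 1) ^ 5 * (real G * 4 ^ W) ^ (M + 1) * (2 / n) ^ M
      \<le> (2 * real n) ^ 5 * (n powr (1 - \<beta>) * 4 ^ W) ^ (M + 1) * (2 / n) ^ M"
    using n by (intro mult_mono power_mono n2 G) auto
  also have "\<dots> = (2 ^ 5 * (4 ^ W) ^ (M + 1) * 2 ^ M) * (real n ^ 5 * (n powr (1 - \<beta>)) ^ (M + 1) / real n ^ M)"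
    by (simp only: power_mult_distrib power_divide of_nat_mult of_nat_power) simp
  also have "real n ^ 5 * (n powr (1 - \<beta>)) ^ (M + 1) / real n ^ M = n powr (5 + (1 - \<beta>) * real (M + 1) - real M)"
    by (simp only: pw pn powr_add[symmetric] powr_diff[symmetric] of_nat_numeral)
  also have "5 + (1 - \<beta>) * real (M + 1) - real M = 6 - \<beta> * (M + 1)"
    by (simp add: algebra_simps)
  finally show "real (n + 1) ^ 5 * (real G * 4 ^ W) ^ (M + 1) * (2 / n) ^ M
      \<le> (2 ^ 5 * (4 ^ W) ^ (M + 1) * 2 ^ M) * n powr (6 - \<beta> * (M + 1))" .
  have "real (n + 1) ^ 4 * (real (n + 1) * 4 ^ W) ^ M * (8 * real M * n powr (- 1 - \<beta> / 2)) ^ (M - 2)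
      \<le> (2 * real n) ^ 4 * (2 * real n * 4 ^ W) ^ M * (8 * real M * n powr (- 1 - \<beta> / 2)) ^ (M - 2)"
    using n by (intro mult_mono power_mono n2) auto
  also have "\<dots> = (2 ^ 4 * (2 * 4 ^ W) ^ M * (8 * real M) ^ (M - 2)) * (real n ^ 4 * real n ^ M * (n powr (- 1 - \<beta> / 2)) ^ (M - 2))"
    by (simp only: power_mult_distrib of_nat_mult of_nat_power) simp
  also have "real n ^ 4 * real n ^ M * (n powr (- 1 - \<beta> / 2)) ^ (M - 2) = n powr (4 + real M + (- 1 - \<beta> / 2) * real (M - 2))"
    by (simp only: pw pn powr_add[symmetric] of_nat_numeral)
  also have "4 + real M + (- 1 - \<beta> / 2) * real (M - 2) = 6 - \<beta> / 2 * (real M - 2)"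
    using M by (simp add: of_nat_diff algebra_simps)
  finally show "real (n + 1) ^ 4 * (real (n + 1) * 4 ^ W) ^ M * (8 * real M * n powr (- 1 - \<beta> / 2)) ^ (M - 2)
      \<le> (2 ^ 4 * (2 * 4 ^ W) ^ M * (8 * real M) ^ (M - 2)) * n powr (6 - \<beta> / 2 * (real M - 2))" .
qed

lemma eventually_large_enough:
  fixes T \<alpha> \<beta> W M H C1 C2 e1 e2 :: real
  assumes "0 < \<alpha>" "\<alpha> < 1" "\<beta> = \<alpha> / 8" "M > 0" "e1 < 0" "e2 < 0"
  shows "eventually (\<lambda>x::real.
    4 * W + 4 * x powr (1 - \<beta>) \<le> x \<and> 4 * (M + 1) * W \<le> x \<and> 2 * H \<le> x \<and> 2 * T \<le> x / (8 * M) \<and>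
    2 * x powr (1 + \<beta>) \<le> x powr (1 + \<alpha>) \<and> x powr (1 - \<beta>) \<le> x / (4 * M) \<and>
    W < 3 / 4 * (x powr (1 - \<beta>) - 1) \<and>
    ln x \<le> x powr (- 2 * \<beta>) / ((512 * M)\<^sup>2 * 16) * ((x powr (1 - \<beta>) - 8) / 4) \<and>
    8 * M * x powr (- 1 - \<beta> / 2) \<le> 1 \<and> C1 * x powr e1 < 1 / 2 \<and> C2 * x powr e2 < 1 / 2) at_top"
proof (intro eventually_conj)
  have \<beta>: "0 < \<beta>" "\<beta> < 1 / 8" "\<beta> < \<alpha>" using assms by auto
  show "eventually (\<lambda>x. 4 * W + 4 * x powr (1 - \<beta>) \<le> x) at_top" using \<beta> by real_asymp
  show "eventually (\<lambda>x. 4 * (M + 1) * W \<le> x) at_top" by real_asymp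
  show "eventually (\<lambda>x. 2 * H \<le> x) at_top" by real_asymp
  show "eventually (\<lambda>x. 2 * T \<le> x / (8 * M)) at_top" using assms(4) by real_asymp
  show "eventually (\<lambda>x. 2 * x powr (1 + \<beta>) \<le> x powr (1 + \<alpha>)) at_top" using \<beta> by real_asymp
  show "eventually (\<lambda>x. x powr (1 - \<beta>) \<le> x / (4 * M)) at_top" using assms(4) \<beta> by real_asymp
  show "eventually (\<lambda>x. W < 3 / 4 * (x powr (1 - \<beta>) - 1)) at_top" using \<beta> by real_asymp
  show "eventually (\<lambda>x. ln x \<le> x powr (- 2 * \<beta>) / ((512 * M)\<^sup>2 * 16) * ((x powr (1 - \<beta>) - 8) / 4)) at_top"
    using assms(4) \<beta> by real_asymp
  show "eventually (\<lambda>x. 8 * M * x powr (- 1 - \<beta> / 2) \<le> 1) at_top" using assms(4) \<beta> by real_asymp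
  show "eventually (\<lambda>x. C1 * x powr e1 < 1 / 2) at_top" using assms(5) by real_asymp
  show "eventually (\<lambda>x. C2 * x powr e2 < 1 / 2) at_top" using assms(6) by real_asymp
qed

text \<open>The arithmetic of k enters as a lower bound on its divisors above T, which are the
  possible orders of large subgroups. All parameters except the threshold for |S| are fixed by
  \<alpha>.\<close>

lemma exists_ordering_large:
  fixes T \<alpha> :: real
  assumes \<alpha>: "0 < \<alpha>" "\<alpha> < 1"
  shows "\<exists>C::nat. \<forall>k S. k > 0 \<and> S \<subseteq> {0<..<k} \<and> C \<le> card S \<and>
    (\<forall>d. d dvd nat k \<longrightarrow> T < real d \<longrightarrow> card S powr (1 + \<alpha>) \<le> real d) \<longrightarrow>
    (\<exists>xs. set xs = S \<and> distinct xs \<and>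
      (\<forall>i j. 0 < i \<and> i < j \<and> j \<le> length xs \<longrightarrow> sum_list (take i xs) mod k \<noteq> sum_list (take j xs) mod k))"
proof -
  define \<beta> where "\<beta> = \<alpha> / 8"
  have \<beta>: "0 < \<beta>" "\<beta> \<le> 1 / 8" using \<alpha> by (auto simp: \<beta>_def)
  \<comment> \<open>The far exponent is the more demanding one: it is negative when \<beta>(M - 2)
    exceeds 12, and this choice makes that product at least 13.\<close>
  define M where "M = nat \<lceil>13 / \<beta>\<rceil> + 3"
  define K where "K = M * 2 ^ M"
  define H where "H = 4 * K + 3"
  define W where "W = 5 * H"
  define C1 :: real where "C1 = 2 ^ 5 * (4 ^ W) ^ (M + 1) * 2 ^ M"
  define C2 :: real where "C2 = 2 ^ 4 * (2 * 4 ^ W) ^ M * (8 * real M) ^ (M - 2)"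
  define e1 where "e1 = 6 - \<beta> * (M + 1)"
  define e2 where "e2 = 6 - \<beta> / 2 * (real M - 2)"
  have M2: "M \<ge> 2" by (simp add: M_def)
  have "13 / \<beta> \<le> real (nat \<lceil>13 / \<beta>\<rceil>)" by (rule real_nat_ceiling_ge)
  then have "13 \<le> real (nat \<lceil>13 / \<beta>\<rceil>) * \<beta>" 
    unfolding pos_divide_le_eq[OF \<beta>(1)] .
  moreover have "real M = real (nat \<lceil>13 / \<beta>\<rceil>) + 3" by (simp add: M_def)
  ultimately have "13 + 3 * \<beta> \<le> \<beta> * real M" by (simp only: algebra_simps)
  then have exps: "e1 < 0" "e2 < 0" using \<beta> by (simp_all add: e1_def e2_def algebra_simps)
  obtain N where N: "\<And>x. N \<le> x \<Longrightarrow>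
    4 * real W + 4 * x powr (1 - \<beta>) \<le> x \<and> 4 * (real M + 1) * real W \<le> x \<and> 2 * real H \<le> x \<and>
    2 * T \<le> x / (8 * real M) \<and> 2 * x powr (1 + \<beta>) \<le> x powr (1 + \<alpha>) \<and>
    x powr (1 - \<beta>) \<le> x / (4 * real M) \<and> real W < 3 / 4 * (x powr (1 - \<beta>) - 1) \<and>
    ln x \<le> x powr (- 2 * \<beta>) / ((512 * real M)\<^sup>2 * 16) * ((x powr (1 - \<beta>) - 8) / 4) \<and>
    8 * real M * x powr (- 1 - \<beta> / 2) \<le> 1 \<and> C1 * x powr e1 < 1 / 2 \<and> C2 * x powr e2 < 1 / 2"
    using eventually_large_enough[OF \<alpha> \<beta>_def _ exps, of "real M" "real W" "real H" T C1 C2] M2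
    unfolding eventually_at_top_linorder by auto
  show ?thesis
  proof (intro exI[of _ "nat \<lceil>N\<rceil> + 1"] allI impI, elim conjE)
    fix k :: int and S :: "int set"
    assume k: "k > 0" and S: "S \<subseteq> {0<..<k}" and large: "nat \<lceil>N\<rceil> + 1 \<le> card S"
      and subgroups: "\<forall>d. d dvd nat k \<longrightarrow> T < real d \<longrightarrow> card S powr (1 + \<alpha>) \<le> real d"
    define n where "n = card S"
    have n: "n > 0" "N \<le> real n" using large real_nat_ceiling_ge[of N] unfolding n_def by linarith+
    note P = N[OF n(2)]
    have finS: "finite S" using S finite_subset by blast
    obtain f where f: "bij_betw f {..<n} S"
      using ex_bij_betw_nat_finite[OF finS] unfolding n_def lessThan_atLeast0 by blast
    have f': "inj_on f {..<n}" "f ` {..<n} = S" using f by (auto simp: bij_betw_def)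
    define G where "G = nat \<lfloor>n powr (1 - \<beta>)\<rfloor>"
    have G: "real G \<le> n powr (1 - \<beta>)" unfolding G_def by simp
    define \<epsilon> where "\<epsilon> = 8 * real M * n powr (- 1 - \<beta> / 2)"
    have \<epsilon>: "0 \<le> \<epsilon>" "\<epsilon> \<le> 1" using P by (auto simp: \<epsilon>_def)
    have "\<exists>p. p permutes {..<n} \<and> (\<forall>b e lo hi v. e \<le> n \<and> e \<le> b + W \<and> hi \<le> n \<and> (e \<le> lo \<or> hi \<le> b) \<longrightarrow>
      card {U. U \<subseteq> {b..<e} \<and> (\<exists>a F. lo \<le> a \<and> a \<le> hi \<and> F \<in> near_prefixes W hi a \<and> collides k f p v U F)} \<le> M * 2 ^ M)"
    proof (rule exists_good_permutation[OF f'(1) _ _ _ n(1) M2 \<epsilon>])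
      show "f ` {..<n} \<subseteq> {0..<k}" using f' S by auto
      have "4 * real W + 4 * real G \<le> real n" using P G by linarith
      then show "4 * W + 4 * G \<le> n" by linarith
      have "real (4 * (M + 1) * W) \<le> real n" using P by (simp add: algebra_simps)
      then show "4 * (M + 1) * W \<le> n" by (rule of_nat_le_iff[THEN iffD1])
      show "spread k l \<epsilon> R" if R: "R \<subseteq> f ` {..<n}" "G - W \<le> l" "l \<le> card R" "n \<le> 4 * M * (card R - l)" for R l
        unfolding \<epsilon>_def
      proof (rule spread_random_subset_sum[OF \<beta> _ n(1) _ _ _ _ _ G_def k _ _ _ R(2-4)])
        have "R \<subseteq> S" using R(1) f'(2) by simp
        then show "R \<subseteq> {0..<k}" "card R \<le> n"
          using S card_mono[OF finS] by (force, simp add: n_def)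
        show "real n powr (1 + \<alpha>) \<le> real d" if "d dvd nat k" "T < real d" for d
          using subgroups that by (simp add: n_def)
      qed (use P M2 in auto)
      have "real (n + 1) ^ 5 * (real G * 4 ^ W) ^ (M + 1) * (2 / n) ^ M \<le> C1 * n powr e1"
        unfolding C1_def e1_def by (rule union_bound_exponents(1)[OF n(1) M2 G])
      moreover have "real (n + 1) ^ 4 * (real (n + 1) * 4 ^ W) ^ M * \<epsilon> ^ (M - 2) \<le> C2 * n powr e2"
        unfolding C2_def e2_def \<epsilon>_def by (rule union_bound_exponents(2)[OF n(1) M2 G])
      ultimately show "real (n + 1) ^ 5 * (real G * 4 ^ W) ^ (M + 1) * (2 / n) ^ M
          + real (n + 1) ^ 4 * (real (n + 1) * 4 ^ W) ^ M * \<epsilon> ^ (M - 2) < 1"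
        using P by linarith
    qed
    then obtain p where p: "p permutes {..<n}"
      and few: "\<And>b e lo hi v. e \<le> n \<Longrightarrow> e \<le> b + W \<Longrightarrow> hi \<le> n \<Longrightarrow> e \<le> lo \<or> hi \<le> b \<Longrightarrow>
      card {U. U \<subseteq> {b..<e} \<and> (\<exists>a F. lo \<le> a \<and> a \<le> hi \<and> F \<in> near_prefixes W hi a \<and> collides k f p v U F)} \<le> K"
      unfolding K_def by blast
    interpret few_collisions k f p n W K
    proof
      fix i assume "i < n"
      then have "f i \<in> {0<..<k}" using f' S by auto
      then show "\<not> k dvd f i" by (auto dest: zdvd_imp_le)
    qed (use p few in auto)
    have "2 * H \<le> n" using P by linarith
    then obtain q where q: "q permutes {..<n}"
      "\<And>i j. 0 < i \<Longrightarrow> i < j \<Longrightarrow> j \<le> n \<Longrightarrow> (\<Sum>x<i. f (q x)) mod k \<noteq> (\<Sum>x<j. f (q x)) mod k"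
      using exists_distinct_prefix_sums[OF W_def] by (auto simp: H_def)
    define xs where "xs = map (\<lambda>i. f (q i)) [0..<n]"
    have inj: "inj_on (\<lambda>i. f (q i)) {..<n}"
      using comp_inj_on[OF permutes_inj_on[OF q(1)], of f "{..<n}"] f'(1) permutes_image[OF q(1)]
      by (simp add: comp_def)
    have "(\<lambda>i. f (q i)) ` {..<n} = S"
      using permutes_image[OF q(1)] f'(2) by (metis image_image)
    then have "set xs = S" by (simp add: xs_def lessThan_atLeast0)
    moreover have "distinct xs" using inj by (simp add: xs_def distinct_map lessThan_atLeast0)
    moreover have "sum_list (take i xs) = (\<Sum>x<i. f (q x))" if "i \<le> n" for i
      using that by (simp add: xs_def take_map interv_sum_list_conv_sum_set_nat lessThan_atLeast0)
    ultimately show "\<exists>xs. set xs = S \<and> distinct xs \<and>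
      (\<forall>i j. 0 < i \<and> i < j \<and> j \<le> length xs \<longrightarrow> sum_list (take i xs) mod k \<noteq> sum_list (take j xs) mod k)"
      using q(2) by (intro exI[of _ xs]) (simp add: xs_def)
  qed
qed

lemma foldr_integer_mod_group:
  "foldr (\<lambda>x y. x \<otimes>\<^bsub>integer_mod_group k\<^esub> y) xs \<one>\<^bsub>integer_mod_group k\<^esub> = sum_list xs mod int k"
  by (induction xs) (simp_all add: mod_add_right_eq)

text \<open>A divisor coprime to \<open>q\<close> would divide \<open>t\<close> and could not exceed
  it, so \<open>d\<close> shares a prime factor with \<open>q\<close>.\<close>

lemma divisor_ge_least_prime_divisor:
  fixes t q d :: nat
  assumes "d dvd t * q" "coprime t q" "t \<ge> 1" "q > 1" "t < d"
  shows "(LEAST p. prime p \<and> p dvd q) \<le> d"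
proof -
  have "\<not> coprime d q"
  proof
    assume "coprime d q"
    then have "d dvd t" using assms(1) by (simp add: coprime_dvd_mult_left_iff)
    then show False using assms dvd_imp_le[of d t] by simp
  qed
  then obtain r where r: "prime r" "r dvd d" "r dvd q"
    using coprime_iff_gcd_eq_1 prime_factor_nat[of "gcd d q"] by (metis gcd_greatest_iff dvd_refl)
  have "(LEAST p. prime p \<and> p dvd q) \<le> r" using r by (intro Least_le) simp
  also have "r \<le> d" using r assms by (intro dvd_imp_le) auto
  finally show ?thesis .
qed

theorem theorem1p4:
  fixes T \<alpha> :: real
  assumes "T \<ge> 1" and "0 < \<alpha>" and "\<alpha> < 1"
  shows "\<exists>C::real. \<forall>(k::nat) (t::nat) (q::nat) (S::int set).
           k = t * q \<and> t \<ge> 1 \<and> real t \<le> T \<and> q \<ge> 1 \<and> coprime t q \<and>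
           S \<subseteq> carrier (integer_mod_group k) - {0} \<and>
           C \<le> real (card S) \<and>
           ereal (real (card S)) \<le> enat_powr (least_prime_divisor q) (1 - \<alpha>)
           \<longrightarrow> (\<exists>xs. valid_ordering (integer_mod_group k) S xs)"
proof -
  obtain C :: nat where C: "\<forall>k S. k > 0 \<and> S \<subseteq> {0<..<k} \<and> C \<le> card S \<and>
    (\<forall>d. d dvd nat k \<longrightarrow> T < real d \<longrightarrow> card S powr (1 + \<alpha>) \<le> real d) \<longrightarrow>
    (\<exists>xs. set xs = S \<and> distinct xs \<and>
      (\<forall>i j. 0 < i \<and> i < j \<and> j \<le> length xs \<longrightarrow> sum_list (take i xs) mod k \<noteq> sum_list (take j xs) mod k))"
    using exists_ordering_large[OF assms(2,3)] by blast
  show ?thesis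
  proof (intro exI[of _ "real C"] allI impI, elim conjE)
    fix k t q :: nat and S :: "int set"
    assume k: "k = t * q" and t: "t \<ge> 1" "real t \<le> T" and q: "q \<ge> 1" and cop: "coprime t q"
      and S: "S \<subseteq> carrier (integer_mod_group k) - {0}" and C_le: "real C \<le> real (card S)"
      and upper: "ereal (real (card S)) \<le> enat_powr (least_prime_divisor q) (1 - \<alpha>)"
    have k0: "k > 0" using k t q by simp
    have S': "S \<subseteq> {0<..<int k}"
      using S k0 by (fastforce simp: carrier_integer_mod_group)
    have divisors: "card S powr (1 + \<alpha>) \<le> real d" if d: "d dvd nat (int k)" "T < real d" for d
    proof -
      have td: "t < d" using d t by linarith
      have dvd: "d dvd t * q" using d(1) unfolding nat_int k .
      \<comment> \<open>For q = 1 the least prime divisor is infinite and bounds nothing, but then k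
        = t has no divisor above \<open>t\<close>.\<close>
      have "q \<noteq> 1"
      proof
        assume "q = 1"
        then show False using dvd td t dvd_imp_le[of d t] by simp
      qed
      then have q1: "q > 1" using q by simp
      define l where "l = (LEAST p. prime p \<and> p dvd q)"
      have l_le: "l \<le> d" unfolding l_def using divisor_ge_least_prime_divisor[OF dvd cop t(1) q1 td] .
      have "\<exists>p. prime p \<and> p dvd q" using prime_factor_nat[of q] q1 by auto
      then have "prime l" unfolding l_def by (rule LeastI2_ex) simp
      then have l1: "real l \<ge> 1" using prime_ge_1_nat by simp
      have "real (card S) \<le> real l powr (1 - \<alpha>)"
        using upper q1 by (simp add: least_prime_divisor_def enat_powr_def l_def)
      then have "real (card S) powr (1 + \<alpha>) \<le> (real l powr (1 - \<alpha>)) powr (1 + \<alpha>)"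
        using assms by (intro powr_mono2) auto
      also have "\<dots> = real l powr (1 - \<alpha> * \<alpha>)" by (simp add: powr_powr algebra_simps)
      \<comment> \<open>Since (1 - \<alpha>)(1 + \<alpha>) = 1 - \<alpha>^2 is below 1, the assumed
        bound on |S| leaves exactly the kind of room that the exponent 1 + \<alpha> asks
        for.\<close>
      also have "\<dots> \<le> real l powr 1" using l1 assms by (intro powr_mono) auto
      also have "\<dots> \<le> real d" using l1 l_le by simp
      finally show ?thesis .
    qed
    have "\<exists>xs. set xs = S \<and> distinct xs \<and> (\<forall>i j. 0 < i \<and> i < j \<and> j \<le> length xs \<longrightarrow>
        sum_list (take i xs) mod int k \<noteq> sum_list (take j xs) mod int k)"
      using C[rule_format, of "int k" S] k0 S' C_le divisors by auto
    then obtain xs where xs: "set xs = S" "distinct xs"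
      "\<And>i j. 0 < i \<Longrightarrow> i < j \<Longrightarrow> j \<le> length xs \<Longrightarrow> sum_list (take i xs) mod int k \<noteq> sum_list (take j xs) mod int k"
      by blast
    have "inj_on (\<lambda>i. sum_list (take i xs) mod int k) {1..<Suc (length xs)}"
      by (rule linorder_inj_onI') (use xs(3) in auto)
    then have "distinct (partial_sums (integer_mod_group k) xs)"
      unfolding partial_sums_def foldr_integer_mod_group distinct_map by (simp del: upt_Suc)
    then show "\<exists>xs. valid_ordering (integer_mod_group k) S xs"
      unfolding valid_ordering_def using xs(1,2) by blast
  qed
qed

end
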